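(* Let $G$ be a $3$-dimensional Lie group with Lie algebra $\mathfrak{g}$, $g$ a left-invariant pseudo-Riemannian metric on $G$ and $(v_a)_{1\le a\le3}$ a $g$-orthonormal basis of $\mathfrak{g}$, $\epsilon_a=g(v_a,v_a)\in\{\pm1\}$, in which $$[v_1,v_2]=\epsilon_3\alpha_3v_3,\quad[v_3,v_1]=\epsilon_2\alpha_2v_2,\quad[v_2,v_3]=\epsilon_1\alpha_1v_1,\qquad\alpha_1,\alpha_2,\alpha_3\in\mathbb{R}.$$ Let $E_{H,F}$ be a Courant algebroid of type $B_3$ over $G$ with left-invariant $H=h\,v_1^*\wedge v_2^*\wedge v_3^*$ and $F=\frac12F_{ab}v_a^*\wedge v_b^*\neq0$, and let $\delta\in(\mathfrak{g}\oplus\mathfrak{g}^*\oplus\mathbb{R})^*$ be a left-invariant divergence operator, $\delta_A=\delta(e_A)$. i) The metric $E_-=\{X-g(X)\mid X\in TG\}$ defined on $E_{H,F}$ is generalized Einstein with divergence $\delta$ if and only if (up to a permutation of the basis $(v_a)$) $$\alpha_1=\alpha_3,\quad\epsilon_2\alpha_2(\alpha_1-\alpha_2)>0,\quad h=-\alpha_2,\quad F_{12}=F_{23}=0,\quad\delta_A=0\ \ \forall A\in\{1,3,4,6\},\quad\delta_5\in\mathbb{R},$$ and either $\delta_0\delta_2\neq0$, in which case $$\Big(\frac{\delta_2}{\delta_0}\Big)^2=\frac{\epsilon_2(\alpha_1-\alpha_2)}{\alpha_2},\qquad F_{13}=\epsilon_2\alpha_2\frac{\delta_2}{\delta_0},$$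 or $\delta_0=\delta_2=0$, in which case $(F_{13})^2=\epsilon_2\alpha_2(\alpha_1-\alpha_2)$. ii) In the situation of i): if $\alpha_1=\alpha_3=0$ then $\mathfrak{g}$ is isomorphic to $\mathfrak{heis}$. If $\alpha_1=\alpha_3\neq0$ then $\mathfrak{g}$ is isomorphic to $\mathfrak{so}(3)$ when ($\epsilon_1=\epsilon_3$ and $\mathrm{sign}(\epsilon_2\alpha_2)=\mathrm{sign}(\epsilon_1\alpha_1)$), and to $\mathfrak{so}(2,1)$ when ($\epsilon_1=\epsilon_3$ and $\mathrm{sign}(\epsilon_2\alpha_2)=-\mathrm{sign}(\epsilon_1\alpha_1)$) or when $\epsilon_3=-\epsilon_1$.
   Context: $\mathfrak{heis}$ is the $3$-dimensional Heisenberg Lie algebra. When the basis $(v_a)$ is permuted, all constants $\alpha_a,\epsilon_a,h,F_{ab},\delta_A$ are redefined by the same formulas relative to the permuted basis. Basis of $\tilde E=\mathfrak{g}\oplus\mathfrak{g}^*\oplus\mathbb{R}$ (with $n=3$): $e_0=1$, $e_a=v_a+g(v_a)$, $e_{a+3}=v_a-g(v_a)$ for $1\le a\le3$, where $g(X)=g(X,\cdot)$; $F_{ab}=F(v_a,v_b)$. Courant algebroid of type $B_3$: for left-invariant $H\in\Omega^3(G)$, $F\in\Omega^2(G)$ with $dF=0$, $E=E_{H,F}$ is the bundle $TG\oplus T^*G\oplus\mathbb{R}$ with anchor $\pi$ the projection to $TG$, scalar product $\langle X+\xi+\lambda,Y+\eta+\mu\rangle=\frac12(\xi(Y)+\eta(X))+\lambda\mu$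 and Dorfman bracket $$[X+\xi+\lambda,Y+\eta+\mu]_{H,F}=\mathcal{L}_X(Y+\eta)-i_Yd\xi+2\mu\,d\lambda+i_Xi_YH-2(\mu\, i_XF-\lambda\, i_YF)+X(\mu)-Y(\lambda)+F(X,Y).$$ Left-invariant sections of $E$ (for the action of $G$ by left translations, trivial on the $\mathbb{R}$-fibre) form $\tilde E$. For $E_-=\{X-g(X)\mid X\in TG\}$ put $E_+=E_-^\perp$. A generalized connection is a linear map $D:\Gamma(E)\to\Gamma(E^*\otimes E)$ with $D_u(fv)=\pi(u)(f)v+fD_uv$ and $\pi(u)\langle v,w\rangle=\langle D_uv,w\rangle+\langle v,D_uw\rangle$. Its torsion is $T^D(u,v,w)=\langle D_uv-D_vu-[u,v]_{H,F},w\rangle+\langle v,D_wu\rangle$; $D$ is Levi-Civita for $E_-$ if $T^D=0$ and $D_u\Gamma(E_-)\subset\Gamma(E_-)$ for all $u$. A divergence operator is an additive map $\delta:\Gamma(E)\to C^\infty(G)$ with $\delta(fu)=\pi(u)(f)+f\delta(u)$; it is left-invariant if constant on left-invariant sections, and is then identified with an element of $\tilde E^*$; $\delta^D(u)=\mathrm{tr}\,Du$. For a Levi-Civita generalized connection $D$ of $E_-$ with $\delta^D=\delta$, put $R^D(u,v)w=D_uD_vw-D_vD_uw-D_{[u,v]_{H,F}}w$ and $\mathrm{Ric}^{\delta,+}(u,v)=\mathrm{tr}(E_+\ni w\mapsto R^D(w,u)v)$ ($u\in E_-,v\in E_+$), $\mathrm{Ric}^{\delta,-}(u,v)=\mathrm{tr}(E_-\ni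 w\mapsto R^D(w,u)v)$ ($u\in E_+,v\in E_-$). These are tensors depending only on $(E_-,\delta)$. $E_-$ is generalized Einstein with divergence $\delta$ if $\mathrm{Ric}^{\delta,+}=0$ and $\mathrm{Ric}^{\delta,-}=0$. *)

theory Defs
  imports "HOL-Analysis.Analysis" "HOL-Library.Function_Algebras"
begin

section \<open>Smooth manifolds and Lie groups\<close>

text \<open>For open \<open>S\<close>, this is the class of \<open>k\<close> times continuously differentiable maps on \<open>S\<close>.\<close>

primrec Ck_on :: "nat \<Rightarrow> 'a set \<Rightarrow> ('a::euclidean_space \<Rightarrow> 'b::euclidean_space) \<Rightarrow> bool" where
  "Ck_on 0 S f \<longleftrightarrow> continuous_on S f"
| "Ck_on (Suc k) S f \<longleftrightarrow>
     f differentiable_on S \<and> (\<forall>v. Ck_on k S (\<lambda>x. frechet_derivative f (at x) v))"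

definition smooth_on :: "'a set \<Rightarrow> ('a::euclidean_space \<Rightarrow> 'b::euclidean_space) \<Rightarrow> bool" where
  "smooth_on S f \<longleftrightarrow> (\<forall>k. Ck_on k S f)"

text \<open>An atlas is a set of pairs of a chart domain \<open>U\<close> and a chart, which is a total function that
  only matters on \<open>U\<close>.\<close>

type_synonym ('g, 'e) atlas = "('g set \<times> ('g \<Rightarrow> 'e)) set"

definition smooth_atlas :: "('g::topological_space, 'e::euclidean_space) atlas \<Rightarrow> bool" where
  "smooth_atlas \<A> \<longleftrightarrow>
     (\<Union>(U, x)\<in>\<A>. U) = UNIV \<and>
     (\<forall>(U, x)\<in>\<A>. open U \<and> open (x ` U) \<and> homeomorphism U (x ` U) x (inv_into U x)) \<and>
     (\<forall>(U, x)\<in>\<A>. \<forall>(V, y)\<in>\<A>. smooth_on (x ` (U \<inter> V)) (y \<circ> inv_into U x))"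

text \<open>The group is written additively but is not assumed to be commutative (\<^class>\<open>group_add\<close>).
  Its manifold topology is the topology of the type; continuity of the group operations is part of
  the class \<^class>\<open>topological_group_add\<close>.\<close>

definition lie_group ::
    "('g::{topological_group_add,t2_space,second_countable_topology}, 'e::euclidean_space) atlas \<Rightarrow> bool" where
  "lie_group \<A> \<longleftrightarrow>
     smooth_atlas \<A> \<and>
     (\<forall>(U, x)\<in>\<A>. \<forall>(V, y)\<in>\<A>. \<forall>(W, z)\<in>\<A>.
        smooth_on {(s, t). s \<in> x ` U \<and> t \<in> y ` V \<and> inv_into U x s + inv_into V y t \<in> W}
                  (\<lambda>(s, t). z (inv_into U x s + inv_into V y t))) \<and>
     (\<forall>(U, x)\<in>\<A>. \<forall>(V, y)\<in>\<A>.
        smooth_on {s \<in> x ` U. - inv_into U x s \<in> V} (\<lambda>s. y (- inv_into U x s)))"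

section \<open>Functions, vector fields and forms\<close>

text \<open>Addition, subtraction, multiplication, \<open>0\<close> and numerals on function types are pointwise.
  Vector fields, one-forms and tensors are represented by functions that vanish outside their
  intended domain, so that equality of such objects is equality in HOL.\<close>

type_synonym 'g scal = "'g \<Rightarrow> real"
type_synonym 'g vfield = "'g scal \<Rightarrow> 'g scal"
type_synonym 'g form1 = "'g vfield \<Rightarrow> 'g scal"
type_synonym 'g form2 = "'g vfield \<Rightarrow> 'g form1"
type_synonym 'g form3 = "'g vfield \<Rightarrow> 'g form2"

definition cst :: "real \<Rightarrow> 'g scal" where
  "cst c = (\<lambda>_. c)"

definition smooth_funs :: "('g::topological_space, 'e::euclidean_space) atlas \<Rightarrow> 'g scal set" where
  "smooth_funs \<A> = {f. \<forall>(U, x)\<in>\<A>. smooth_on (x ` U) (f \<circ> inv_into U x)}"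

text \<open>Multiplication of a vector field, or of a one-form, by a function.\<close>

definition fscale :: "'g scal \<Rightarrow> ('x \<Rightarrow> 'g scal) \<Rightarrow> 'x \<Rightarrow> 'g scal" where
  "fscale f T = (\<lambda>x. f * T x)"

text \<open>A vector field is given by its action on smooth functions; at each point it is a directional
  derivative in every chart around that point.\<close>

definition vector_fields :: "('g::topological_space, 'e::euclidean_space) atlas \<Rightarrow> 'g vfield set" where
  "vector_fields \<A> = {X.
     (\<forall>f\<in>smooth_funs \<A>. X f \<in> smooth_funs \<A>) \<and>
     (\<forall>f. f \<notin> smooth_funs \<A> \<longrightarrow> X f = 0) \<and>
     (\<forall>(U, x)\<in>\<A>. \<forall>p\<in>U. \<exists>a. \<forall>f\<in>smooth_funs \<A>.
        X f p = frechet_derivative (f \<circ> inv_into U x) (at (x p)) a)}"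

definition lie_bracket :: "'g vfield \<Rightarrow> 'g vfield \<Rightarrow> 'g vfield" where
  "lie_bracket X Y = (\<lambda>f. X (Y f) - Y (X f))"

definition one_forms :: "('g::topological_space, 'e::euclidean_space) atlas \<Rightarrow> 'g form1 set" where
  "one_forms \<A> = {\<xi>.
     (\<forall>X\<in>vector_fields \<A>. \<xi> X \<in> smooth_funs \<A>) \<and>
     (\<forall>X. X \<notin> vector_fields \<A> \<longrightarrow> \<xi> X = 0) \<and>
     (\<forall>X\<in>vector_fields \<A>. \<forall>Y\<in>vector_fields \<A>. \<xi> (X + Y) = \<xi> X + \<xi> Y) \<and>
     (\<forall>f\<in>smooth_funs \<A>. \<forall>X\<in>vector_fields \<A>. \<xi> (fscale f X) = f * \<xi> X)}"

definition bilinear_forms :: "('g::topological_space, 'e::euclidean_space) atlas \<Rightarrow> 'g form2 set" where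
  "bilinear_forms \<A> = {T.
     (\<forall>X\<in>vector_fields \<A>. T X \<in> one_forms \<A> \<and> (\<lambda>Y. T Y X) \<in> one_forms \<A>) \<and>
     (\<forall>X. X \<notin> vector_fields \<A> \<longrightarrow> T X = 0)}"

definition two_forms :: "('g::topological_space, 'e::euclidean_space) atlas \<Rightarrow> 'g form2 set" where
  "two_forms \<A> = {F \<in> bilinear_forms \<A>. \<forall>X\<in>vector_fields \<A>. F X X = 0}"

definition three_forms :: "('g::topological_space, 'e::euclidean_space) atlas \<Rightarrow> 'g form3 set" where
  "three_forms \<A> = {H.
     (\<forall>X\<in>vector_fields \<A>. H X \<in> two_forms \<A> \<and> (\<lambda>Y. H Y X) \<in> two_forms \<A>) \<and>
     (\<forall>X\<in>vector_fields \<A>. H X X = 0) \<and>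
     (\<forall>X. X \<notin> vector_fields \<A> \<longrightarrow> H X = 0)}"

definition restrict_form ::
    "('g::topological_space, 'e::euclidean_space) atlas \<Rightarrow> 'g form1 \<Rightarrow> 'g form1" where
  "restrict_form \<A> \<xi> = (\<lambda>X. if X \<in> vector_fields \<A> then \<xi> X else 0)"

definition diff0 ::
    "('g::topological_space, 'e::euclidean_space) atlas \<Rightarrow> 'g scal \<Rightarrow> 'g form1" where
  "diff0 \<A> f = restrict_form \<A> (\<lambda>X. X f)"

text \<open>The contraction \<open>i\<^sub>Y d\<xi>\<close> is \<open>diff1 \<A> \<xi> Y\<close>.\<close>

definition diff1 ::
    "('g::topological_space, 'e::euclidean_space) atlas \<Rightarrow> 'g form1 \<Rightarrow> 'g form2" where
  "diff1 \<A> \<xi> = (\<lambda>Y. restrict_form \<A> (\<lambda>Z. Y (\<xi> Z) - Z (\<xi> Y) - \<xi> (lie_bracket Y Z)))"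

definition closed_two_form ::
    "('g::topological_space, 'e::euclidean_space) atlas \<Rightarrow> 'g form2 \<Rightarrow> bool" where
  "closed_two_form \<A> F \<longleftrightarrow>
     (\<forall>X\<in>vector_fields \<A>. \<forall>Y\<in>vector_fields \<A>. \<forall>Z\<in>vector_fields \<A>.
        X (F Y Z) + Y (F Z X) + Z (F X Y)
        - F (lie_bracket X Y) Z - F (lie_bracket Y Z) X - F (lie_bracket Z X) Y = 0)"

definition lie_derivative ::
    "('g::topological_space, 'e::euclidean_space) atlas \<Rightarrow> 'g vfield \<Rightarrow> 'g form1 \<Rightarrow> 'g form1" where
  "lie_derivative \<A> X \<eta> = restrict_form \<A> (\<lambda>Z. X (\<eta> Z) - \<eta> (lie_bracket X Z))"

definition pseudo_riemannian_metric ::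
    "('g::topological_space, 'e::euclidean_space) atlas \<Rightarrow> 'g form2 \<Rightarrow> bool" where
  "pseudo_riemannian_metric \<A> g \<longleftrightarrow>
     g \<in> bilinear_forms \<A> \<and>
     (\<forall>X\<in>vector_fields \<A>. \<forall>Y\<in>vector_fields \<A>. g X Y = g Y X) \<and>
     (\<forall>p. \<forall>X\<in>vector_fields \<A>.
        (\<forall>Y\<in>vector_fields \<A>. g X Y p = 0) \<longrightarrow> (\<forall>f. X f p = 0))"

section \<open>Left-invariance\<close>

text \<open>The push-forward of a vector field under the left translation by \<open>a\<close>.\<close>

definition pushforward :: "'g::group_add \<Rightarrow> 'g vfield \<Rightarrow> 'g vfield" where
  "pushforward a X = (\<lambda>f. X (f \<circ> (+) a) \<circ> (+) (- a))"

text \<open>The Lie algebra \<open>\<gg>\<close> of the group, as the left-invariant vector fields.\<close>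

definition lie_algebra ::
    "('g::topological_group_add, 'e::euclidean_space) atlas \<Rightarrow> 'g vfield set" where
  "lie_algebra \<A> = {X \<in> vector_fields \<A>. \<forall>a. pushforward a X = X}"

definition left_invariant1 ::
    "('g::topological_group_add, 'e::euclidean_space) atlas \<Rightarrow> 'g form1 \<Rightarrow> bool" where
  "left_invariant1 \<A> \<xi> \<longleftrightarrow>
     (\<forall>a. \<forall>X\<in>vector_fields \<A>. \<xi> (pushforward a X) = \<xi> X \<circ> (+) (- a))"

definition left_invariant2 ::
    "('g::topological_group_add, 'e::euclidean_space) atlas \<Rightarrow> 'g form2 \<Rightarrow> bool" where
  "left_invariant2 \<A> T \<longleftrightarrow>
     (\<forall>a. \<forall>X\<in>vector_fields \<A>. \<forall>Y\<in>vector_fields \<A>.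
        T (pushforward a X) (pushforward a Y) = T X Y \<circ> (+) (- a))"

definition left_invariant3 ::
    "('g::topological_group_add, 'e::euclidean_space) atlas \<Rightarrow> 'g form3 \<Rightarrow> bool" where
  "left_invariant3 \<A> H \<longleftrightarrow>
     (\<forall>a. \<forall>X\<in>vector_fields \<A>. \<forall>Y\<in>vector_fields \<A>. \<forall>Z\<in>vector_fields \<A>.
        H (pushforward a X) (pushforward a Y) (pushforward a Z) = H X Y Z \<circ> (+) (- a))"

text \<open>Indices run over \<open>1, 2, 3\<close>; the values of \<open>v\<close> at other numbers are irrelevant.\<close>

definition lie_algebra_basis ::
    "('g::topological_group_add, 'e::euclidean_space) atlas \<Rightarrow> (nat \<Rightarrow> 'g vfield) \<Rightarrow> bool" where
  "lie_algebra_basis \<A> v \<longleftrightarrow>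
     (\<forall>a\<in>{1..3}. v a \<in> lie_algebra \<A>) \<and>
     (\<forall>X\<in>lie_algebra \<A>. \<exists>c. X = (\<Sum>a=1..3. fscale (cst (c a)) (v a))) \<and>
     (\<forall>c. (\<Sum>a=1..3. fscale (cst (c a)) (v a)) = 0 \<longrightarrow> (\<forall>a\<in>{1..3}. c a = 0))"

section \<open>Courant algebroids of type \<open>B\<^sub>n\<close>\<close>

text \<open>The triple \<open>(X, \<xi>, \<lambda>)\<close> stands for the section \<open>X + \<xi> + \<lambda>\<close> of \<open>TG \<oplus> T\<^sup>*G \<oplus> \<real>\<close>.\<close>

type_synonym 'g sect = "'g vfield \<times> 'g form1 \<times> 'g scal"

definition sections :: "('g::topological_space, 'e::euclidean_space) atlas \<Rightarrow> 'g sect set" where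
  "sections \<A> = vector_fields \<A> \<times> one_forms \<A> \<times> smooth_funs \<A>"

definition left_invariant_sections ::
    "('g::topological_group_add, 'e::euclidean_space) atlas \<Rightarrow> 'g sect set" where
  "left_invariant_sections \<A> =
     {(X, \<xi>, l) \<in> sections \<A>. X \<in> lie_algebra \<A> \<and> left_invariant1 \<A> \<xi> \<and> (\<forall>a. l \<circ> (+) a = l)}"

definition anchor :: "'g sect \<Rightarrow> 'g vfield" where
  "anchor u = fst u"

definition sscale :: "'g scal \<Rightarrow> 'g sect \<Rightarrow> 'g sect" where
  "sscale f = (\<lambda>(X, \<xi>, l). (fscale f X, fscale f \<xi>, f * l))"

definition pairing :: "'g sect \<Rightarrow> 'g sect \<Rightarrow> 'g scal" where
  "pairing = (\<lambda>(X, \<xi>, l) (Y, \<eta>, m). cst (1/2) * (\<xi> Y + \<eta> X) + l * m)"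

text \<open>The term \<open>i\<^sub>X i\<^sub>Y H = H(Y, X, \<cdot>)\<close> is \<open>H Y X\<close>, and \<open>i\<^sub>X F\<close> is \<open>F X\<close>.\<close>

definition dorfman ::
    "('g::topological_space, 'e::euclidean_space) atlas \<Rightarrow> 'g form3 \<Rightarrow> 'g form2 \<Rightarrow>
     'g sect \<Rightarrow> 'g sect \<Rightarrow> 'g sect" where
  "dorfman \<A> H F = (\<lambda>(X, \<xi>, l) (Y, \<eta>, m).
     (lie_bracket X Y,
      lie_derivative \<A> X \<eta> - diff1 \<A> \<xi> Y + fscale (2 * m) (diff0 \<A> l) + H Y X
        - (fscale (2 * m) (F X) - fscale (2 * l) (F Y)),
      X m - Y l + F X Y))"

text \<open>Sections of \<open>E\<^sub>- = {X - g(X)}\<close> and of its orthogonal complement \<open>E\<^sub>+\<close>.\<close>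

definition E_minus ::
    "('g::topological_space, 'e::euclidean_space) atlas \<Rightarrow> 'g form2 \<Rightarrow> 'g sect set" where
  "E_minus \<A> g = {(X, - g X, 0) | X. X \<in> vector_fields \<A>}"

definition E_plus ::
    "('g::topological_space, 'e::euclidean_space) atlas \<Rightarrow> 'g form2 \<Rightarrow> 'g sect set" where
  "E_plus \<A> g = {u \<in> sections \<A>. \<forall>w\<in>E_minus \<A> g. pairing u w = 0}"

definition generalized_connection ::
    "('g::topological_space, 'e::euclidean_space) atlas \<Rightarrow> ('g sect \<Rightarrow> 'g sect \<Rightarrow> 'g sect) \<Rightarrow> bool" where
  "generalized_connection \<A> D \<longleftrightarrow>
     (\<forall>u\<in>sections \<A>. \<forall>v\<in>sections \<A>. D u v \<in> sections \<A>) \<and>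
     (\<forall>u\<in>sections \<A>. \<forall>u'\<in>sections \<A>. \<forall>v\<in>sections \<A>. D (u + u') v = D u v + D u' v) \<and>
     (\<forall>f\<in>smooth_funs \<A>. \<forall>u\<in>sections \<A>. \<forall>v\<in>sections \<A>. D (sscale f u) v = sscale f (D u v)) \<and>
     (\<forall>u\<in>sections \<A>. \<forall>v\<in>sections \<A>. \<forall>v'\<in>sections \<A>. D u (v + v') = D u v + D u v') \<and>
     (\<forall>f\<in>smooth_funs \<A>. \<forall>u\<in>sections \<A>. \<forall>v\<in>sections \<A>.
        D u (sscale f v) = sscale (anchor u f) v + sscale f (D u v)) \<and>
     (\<forall>u\<in>sections \<A>. \<forall>v\<in>sections \<A>. \<forall>w\<in>sections \<A>.
        anchor u (pairing v w) = pairing (D u v) w + pairing v (D u w))"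

definition torsion ::
    "('g::topological_space, 'e::euclidean_space) atlas \<Rightarrow> 'g form3 \<Rightarrow> 'g form2 \<Rightarrow>
     ('g sect \<Rightarrow> 'g sect \<Rightarrow> 'g sect) \<Rightarrow> 'g sect \<Rightarrow> 'g sect \<Rightarrow> 'g sect \<Rightarrow> 'g scal" where
  "torsion \<A> H F D u v w =
     pairing (D u v - D v u - dorfman \<A> H F u v) w + pairing v (D w u)"

definition levi_civita ::
    "('g::topological_space, 'e::euclidean_space) atlas \<Rightarrow> 'g form2 \<Rightarrow> 'g form3 \<Rightarrow> 'g form2 \<Rightarrow>
     ('g sect \<Rightarrow> 'g sect \<Rightarrow> 'g sect) \<Rightarrow> bool" where
  "levi_civita \<A> g H F D \<longleftrightarrow>
     generalized_connection \<A> D \<and>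
     (\<forall>u\<in>sections \<A>. \<forall>v\<in>sections \<A>. \<forall>w\<in>sections \<A>. torsion \<A> H F D u v w = 0) \<and>
     (\<forall>u\<in>sections \<A>. \<forall>v\<in>E_minus \<A> g. D u v \<in> E_minus \<A> g)"

definition curvature ::
    "('g::topological_space, 'e::euclidean_space) atlas \<Rightarrow> 'g form3 \<Rightarrow> 'g form2 \<Rightarrow>
     ('g sect \<Rightarrow> 'g sect \<Rightarrow> 'g sect) \<Rightarrow> 'g sect \<Rightarrow> 'g sect \<Rightarrow> 'g sect \<Rightarrow> 'g sect" where
  "curvature \<A> H F D u v w = D u (D v w) - D v (D u w) - D (dorfman \<A> H F u v) w"

text \<open>A global frame \<open>b\<close> of the bundle with module of sections \<open>N\<close>, with dual coframe \<open>\<beta>\<close>.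
  The bundles \<open>E\<close>, \<open>E\<^sub>+\<close> and \<open>E\<^sub>-\<close> over a Lie group have such frames, namely left-invariant ones,
  and the trace of a bundle endomorphism is the trace of its matrix in any frame.\<close>

definition dual_frames ::
    "('g::topological_space, 'e::euclidean_space) atlas \<Rightarrow> 'g sect set \<Rightarrow> nat \<Rightarrow>
     (nat \<Rightarrow> 'g sect) \<Rightarrow> (nat \<Rightarrow> 'g sect \<Rightarrow> 'g scal) \<Rightarrow> bool" where
  "dual_frames \<A> N k b \<beta> \<longleftrightarrow>
     (\<forall>i<k. b i \<in> N) \<and>
     (\<forall>i<k. \<forall>w\<in>N. \<beta> i w \<in> smooth_funs \<A>) \<and>
     (\<forall>i<k. \<forall>w\<in>N. \<forall>w'\<in>N. \<beta> i (w + w') = \<beta> i w + \<beta> i w') \<and>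
     (\<forall>i<k. \<forall>f\<in>smooth_funs \<A>. \<forall>w\<in>N. \<beta> i (sscale f w) = f * \<beta> i w) \<and>
     (\<forall>i<k. \<forall>j<k. \<beta> i (b j) = cst (if i = j then 1 else 0)) \<and>
     (\<forall>w\<in>N. w = (\<Sum>i<k. sscale (\<beta> i w) (b i)))"

definition bundle_trace ::
    "('g::topological_space, 'e::euclidean_space) atlas \<Rightarrow> 'g sect set \<Rightarrow> ('g sect \<Rightarrow> 'g sect) \<Rightarrow> 'g scal" where
  "bundle_trace \<A> N \<Phi> =
     (THE t. \<exists>k b \<beta>. dual_frames \<A> N k b \<beta> \<and> t = (\<Sum>i<k. \<beta> i (\<Phi> (b i))))"

definition divergence_operator ::
    "('g::topological_space, 'e::euclidean_space) atlas \<Rightarrow> ('g sect \<Rightarrow> 'g scal) \<Rightarrow> bool" where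
  "divergence_operator \<A> \<delta> \<longleftrightarrow>
     (\<forall>u\<in>sections \<A>. \<delta> u \<in> smooth_funs \<A>) \<and>
     (\<forall>u\<in>sections \<A>. \<forall>v\<in>sections \<A>. \<delta> (u + v) = \<delta> u + \<delta> v) \<and>
     (\<forall>f\<in>smooth_funs \<A>. \<forall>u\<in>sections \<A>. \<delta> (sscale f u) = anchor u f + f * \<delta> u)"

definition left_invariant_divergence ::
    "('g::topological_group_add, 'e::euclidean_space) atlas \<Rightarrow> ('g sect \<Rightarrow> 'g scal) \<Rightarrow> bool" where
  "left_invariant_divergence \<A> \<delta> \<longleftrightarrow>
     divergence_operator \<A> \<delta> \<and> (\<forall>u\<in>left_invariant_sections \<A>. \<exists>c. \<delta> u = cst c)"

definition divergence_of ::
    "('g::topological_space, 'e::euclidean_space) atlas \<Rightarrow> ('g sect \<Rightarrow> 'g sect \<Rightarrow> 'g sect) \<Rightarrow>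
     'g sect \<Rightarrow> 'g scal" where
  "divergence_of \<A> D u = bundle_trace \<A> (sections \<A>) (\<lambda>w. D w u)"

definition ricci_plus ::
    "('g::topological_space, 'e::euclidean_space) atlas \<Rightarrow> 'g form2 \<Rightarrow> 'g form3 \<Rightarrow> 'g form2 \<Rightarrow>
     ('g sect \<Rightarrow> 'g sect \<Rightarrow> 'g sect) \<Rightarrow> 'g sect \<Rightarrow> 'g sect \<Rightarrow> 'g scal" where
  "ricci_plus \<A> g H F D u v = bundle_trace \<A> (E_plus \<A> g) (\<lambda>w. curvature \<A> H F D w u v)"

definition ricci_minus ::
    "('g::topological_space, 'e::euclidean_space) atlas \<Rightarrow> 'g form2 \<Rightarrow> 'g form3 \<Rightarrow> 'g form2 \<Rightarrow>
     ('g sect \<Rightarrow> 'g sect \<Rightarrow> 'g sect) \<Rightarrow> 'g sect \<Rightarrow> 'g sect \<Rightarrow> 'g scal" where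
  "ricci_minus \<A> g H F D u v = bundle_trace \<A> (E_minus \<A> g) (\<lambda>w. curvature \<A> H F D w u v)"

text \<open>The Ricci curvatures do not depend on the choice of the Levi-Civita generalized connection \<open>D\<close>
  with divergence \<open>\<delta>\<close>.\<close>

definition generalized_einstein ::
    "('g::topological_space, 'e::euclidean_space) atlas \<Rightarrow> 'g form2 \<Rightarrow> 'g form3 \<Rightarrow> 'g form2 \<Rightarrow>
     ('g sect \<Rightarrow> 'g scal) \<Rightarrow> bool" where
  "generalized_einstein \<A> g H F \<delta> \<longleftrightarrow>
     (\<exists>D. levi_civita \<A> g H F D \<and>
          (\<forall>u\<in>sections \<A>. divergence_of \<A> D u = \<delta> u) \<and>
          (\<forall>u\<in>E_minus \<A> g. \<forall>v\<in>E_plus \<A> g. ricci_plus \<A> g H F D u v = 0) \<and>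
          (\<forall>u\<in>E_plus \<A> g. \<forall>v\<in>E_minus \<A> g. ricci_minus \<A> g H F D u v = 0))"

section \<open>Constants relative to a basis of the Lie algebra\<close>

definition basis_E :: "'g form2 \<Rightarrow> (nat \<Rightarrow> 'g vfield) \<Rightarrow> nat \<Rightarrow> 'g sect" where
  "basis_E g v A =
     (if A = 0 then (0, 0, 1)
      else if A \<le> 3 then (v A, g (v A), 0)
      else (v (A - 3), - g (v (A - 3)), 0))"

text \<open>\<open>h\<close> is the coefficient of \<open>H = h v\<^sub>1\<^sup>* \<and> v\<^sub>2\<^sup>* \<and> v\<^sub>3\<^sup>*\<close>.\<close>

definition relative_constants ::
    "'g form2 \<Rightarrow> 'g form3 \<Rightarrow> 'g form2 \<Rightarrow> ('g sect \<Rightarrow> 'g scal) \<Rightarrow> (nat \<Rightarrow> 'g vfield) \<Rightarrow>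
     (nat \<Rightarrow> real) \<Rightarrow> (nat \<Rightarrow> real) \<Rightarrow> real \<Rightarrow> (nat \<Rightarrow> nat \<Rightarrow> real) \<Rightarrow> (nat \<Rightarrow> real) \<Rightarrow> bool" where
  "relative_constants g H F \<delta> v \<epsilon> \<alpha> h f d \<longleftrightarrow>
     (\<forall>a\<in>{1..3}. g (v a) (v a) = cst (\<epsilon> a)) \<and>
     lie_bracket (v 1) (v 2) = fscale (cst (\<epsilon> 3 * \<alpha> 3)) (v 3) \<and>
     lie_bracket (v 3) (v 1) = fscale (cst (\<epsilon> 2 * \<alpha> 2)) (v 2) \<and>
     lie_bracket (v 2) (v 3) = fscale (cst (\<epsilon> 1 * \<alpha> 1)) (v 1) \<and>
     H (v 1) (v 2) (v 3) = cst h \<and>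
     (\<forall>a\<in>{1..3}. \<forall>b\<in>{1..3}. F (v a) (v b) = cst (f a b)) \<and>
     (\<forall>A\<in>{0..6}. \<delta> (basis_E g v A) = cst (d A))"

definition einstein_conditions ::
    "(nat \<Rightarrow> real) \<Rightarrow> (nat \<Rightarrow> real) \<Rightarrow> real \<Rightarrow> (nat \<Rightarrow> nat \<Rightarrow> real) \<Rightarrow> (nat \<Rightarrow> real) \<Rightarrow> bool" where
  "einstein_conditions \<epsilon> \<alpha> h f d \<longleftrightarrow>
     \<alpha> 1 = \<alpha> 3 \<and> \<epsilon> 2 * \<alpha> 2 * (\<alpha> 1 - \<alpha> 2) > 0 \<and> h = - \<alpha> 2 \<and>
     f 1 2 = 0 \<and> f 2 3 = 0 \<and> (\<forall>A\<in>{1, 3, 4, 6}. d A = 0) \<and>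
     ((d 0 * d 2 \<noteq> 0 \<and>
       (d 2 / d 0)\<^sup>2 = \<epsilon> 2 * (\<alpha> 1 - \<alpha> 2) / \<alpha> 2 \<and> f 1 3 = \<epsilon> 2 * \<alpha> 2 * (d 2 / d 0)) \<or>
      (d 0 = 0 \<and> d 2 = 0 \<and> (f 1 3)\<^sup>2 = \<epsilon> 2 * \<alpha> 2 * (\<alpha> 1 - \<alpha> 2)))"

section \<open>Three-dimensional matrix Lie algebras\<close>

definition heis :: "(real^3^3) set" where
  "heis = {M. M$1$1 = 0 \<and> M$2$1 = 0 \<and> M$2$2 = 0 \<and> M$3$1 = 0 \<and> M$3$2 = 0 \<and> M$3$3 = 0}"

definition so3 :: "(real^3^3) set" where
  "so3 = {M. transpose M = - M}"

definition so21 :: "(real^3^3) set" where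
  "so21 = {M. let J = (\<chi> i j. if i = j then (if i = 3 then - 1 else 1) else 0)
              in transpose M ** J + J ** M = 0}"

text \<open>Isomorphism of a Lie algebra of vector fields with a Lie algebra of matrices.\<close>

definition isomorphic_to_matrices :: "'g vfield set \<Rightarrow> (real^'n^'n) set \<Rightarrow> bool" where
  "isomorphic_to_matrices V L \<longleftrightarrow>
     (\<exists>\<phi>. bij_betw \<phi> V L \<and>
          (\<forall>X\<in>V. \<forall>Y\<in>V. \<phi> (X + Y) = \<phi> X + \<phi> Y) \<and>
          (\<forall>c. \<forall>X\<in>V. \<phi> (fscale (cst c) X) = c *\<^sub>R \<phi> X) \<and>
          (\<forall>X\<in>V. \<forall>Y\<in>V. \<phi> (lie_bracket X Y) = \<phi> X ** \<phi> Y - \<phi> Y ** \<phi> X))"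

end

theory Submission
  imports Defs
begin

text \<open>
  Everything happens in the left-invariant frame \<open>e\<^sub>0 = 1\<close>, \<open>e\<^sub>a = v\<^sub>a + g(v\<^sub>a)\<close>, \<open>e\<^bsub>a+3\<^esub> = v\<^sub>a - g(v\<^sub>a)\<close>,
  in which the scalar product is diagonal with constant entries \<open>\<eta>\<^sub>A = \<plusminus>1\<close>, the bundle \<open>E\<^sub>+\<close> is
  spanned by \<open>e\<^sub>0, \<dots>, e\<^sub>3\<close> and \<open>E\<^sub>-\<close> by \<open>e\<^sub>4, e\<^sub>5, e\<^sub>6\<close>. The numbers \<open>B\<^bsub>ABC\<^esub> = \<langle>[e\<^sub>A, e\<^sub>B], e\<^sub>C\<rangle>\<close> are constant
  and totally skew; \<open>structure_constants_E\<close> computes them from \<open>\<alpha>\<close>, \<open>h\<close> and \<open>F\<close>.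

  Let \<open>D\<close> be a Levi-Civita generalized connection, with coefficients \<open>\<omega>\<^bsub>ABC\<^esub> = \<langle>D\<^sub>A e\<^sub>B, e\<^sub>C\<rangle>\<close>. These are
  functions, since \<open>D\<close> need not be left-invariant. They are skew in the last two indices, which have
  to belong to the same one of the two blocks, and vanishing of the torsion means that the cyclic
  sum of \<open>\<omega>\<^bsub>ABC\<^esub>\<close> is \<open>B\<^bsub>ABC\<^esub>\<close>. So \<open>\<omega>\<^bsub>ibc\<^esub> = B\<^bsub>ibc\<^esub>\<close> whenever \<open>i\<close> lies in the other block than \<open>b\<close> and \<open>c\<close>.
  If this is inserted into the curvature and the trace is taken, the coefficients that remain free
  enter through the divergence \<open>\<delta>\<close>, or else through \<open>\<omega>\<^bsub>abc\<^esub> + \<omega>\<^bsub>cba\<^esub>\<close>, which is symmetric in \<open>a\<close> and \<open>c\<close>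
  and is contracted with a skew factor (\<open>ricci_frame\<close>). Hence the two Ricci curvatures are given by
  the numbers \<open>ricci_form\<close>. Conversely \<open>B/3\<close> inside the two blocks, corrected by a trace term, and
  the forced coefficients define a Levi-Civita connection with the prescribed divergence
  (\<open>levi_civita_connection_exists\<close>). So the Einstein condition is the vanishing of finitely many
  numbers (\<open>generalized_einstein_iff_ricci_form\<close>).

  The use of a frame has to be justified: all vector fields, not only the left-invariant ones, must
  be combinations of \<open>v\<^sub>1, v\<^sub>2, v\<^sub>3\<close> with smooth coefficients. Left-invariance makes the \<open>v\<^sub>a\<close> linearly
  independent at every point, Cramer's rule then makes one-forms depend only on the value of a
  vector field at a point, and by the nondegeneracy of the metric the coefficients of \<open>X\<close> are
  \<open>\<epsilon>\<^sub>a g(X, v\<^sub>a)\<close> (\<open>orthonormal_expansion\<close>).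

  For the algebra put \<open>p = (F\<^sub>2\<^sub>3, F\<^sub>3\<^sub>1, F\<^sub>1\<^sub>2)\<close>. The equations contain \<open>(\<alpha>\<^sub>1 - \<alpha>\<^sub>2) \<delta>\<^sub>6 = 2 p\<^sub>1 p\<^sub>2\<close> and
  \<open>(\<alpha>\<^sub>3 + h) \<delta>\<^sub>6 = 0\<close>, and their cyclic images. If no component of \<open>p\<close> vanished, all \<open>\<alpha>\<^sub>a\<close> would equal
  \<open>- h\<close>, contradicting the first equation. If exactly one vanished, say \<open>p\<^sub>3\<close>, the equations would
  force \<open>\<alpha>\<^sub>2 = - 2 \<alpha>\<^sub>1\<close> and \<open>\<alpha>\<^sub>1 = - 2 \<alpha>\<^sub>2\<close>, whereas the first equation gives \<open>\<alpha>\<^sub>1 \<noteq> \<alpha>\<^sub>2\<close>. So exactly one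
  component is different from \<open>0\<close>. A cyclic permutation of the basis moves it to \<open>F\<^sub>3\<^sub>1\<close>, and then the
  equations become the stated conditions.

  Part ii) compares structure constants: if the basis vectors are rescaled, the three constants
  \<open>\<epsilon>\<^sub>a \<alpha>\<^sub>a\<close> become \<open>0\<close> or \<open>\<plusminus>1\<close>, and the resulting brackets are those of explicit matrices.
\<close>

section \<open>Smooth functions and vector fields\<close>

text \<open>The derivatives in \<^const>\<open>Ck_on\<close> are taken of the total function, so openness is needed for its values
  outside the set to be irrelevant.\<close>

lemma Ck_on_cong:
  fixes f f' :: "'a::euclidean_space \<Rightarrow> 'b::euclidean_space"
  assumes "open S" "Ck_on k S f" "\<And>x. x \<in> S \<Longrightarrow> f x = f' x"
  shows "Ck_on k S f'"
  using assms(2,3)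
proof (induction k arbitrary: f f')
  case 0
  then show ?case using continuous_on_cong[of S S f f'] by simp
next
  case (Suc k)
  have d: "f differentiable_on S" using Suc.prems by simp
  have d': "f' differentiable_on S"
    using d Suc.prems(2) differentiable_transform_within[OF _ zero_less_one]
    unfolding differentiable_on_def by blast
  have "Ck_on k S (\<lambda>x. frechet_derivative f' (at x) v)" for v
  proof (rule Suc.IH)
    show "Ck_on k S (\<lambda>x. frechet_derivative f (at x) v)" using Suc.prems(1) by simp
    fix x assume "x \<in> S"
    then have "frechet_derivative f (at x) = frechet_derivative f' (at x)"
      using d \<open>open S\<close> Suc.prems(2)
      by (intro frechet_derivative_transform_within_open[where X = S])
         (auto simp: differentiable_on_eq_differentiable_at)
    then show "frechet_derivative f (at x) v = frechet_derivative f' (at x) v" by simp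
  qed
  then show ?case using d' by simp
qed

lemma Ck_on_Suc_lower: "Ck_on (Suc k) S f \<Longrightarrow> Ck_on k S f"
proof (induction k arbitrary: f)
  case 0
  then show ?case by (simp add: differentiable_imp_continuous_on)
next
  case (Suc k)
  then show ?case by (metis Ck_on.simps(2))
qed

lemma Ck_on_const: "Ck_on k S (\<lambda>_. c)"
  by (induction k arbitrary: c) (auto simp: frechet_derivative_const)

text \<open>The closure of \<^const>\<open>Ck_on\<close> under sums and products goes by induction on the order, with the sum and
  product rule for one derivative as induction step.\<close>

lemma frechet_derivative_add_real:
  fixes f f' :: "'a::euclidean_space \<Rightarrow> real"
  assumes "f differentiable at x" "f' differentiable at x"
  shows "frechet_derivative (\<lambda>x. f x + f' x) (at x) v =
    frechet_derivative f (at x) v + frechet_derivative f' (at x) v"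
  using frechet_derivative_at[OF has_derivative_add[OF assms[unfolded frechet_derivative_works]]]
  by metis

lemma Ck_on_add:
  fixes f f' :: "'a::euclidean_space \<Rightarrow> real"
  assumes "open S" "Ck_on k S f" "Ck_on k S f'"
  shows "Ck_on k S (\<lambda>x. f x + f' x)"
  using assms(2,3)
proof (induction k arbitrary: f f')
  case 0
  then show ?case by (simp add: continuous_on_add)
next
  case (Suc k)
  have "Ck_on k S (\<lambda>x. frechet_derivative (\<lambda>x. f x + f' x) (at x) v)" for v
  proof (rule Ck_on_cong[OF \<open>open S\<close> Suc.IH])
    show "Ck_on k S (\<lambda>x. frechet_derivative f (at x) v)"
      and "Ck_on k S (\<lambda>x. frechet_derivative f' (at x) v)" using Suc.prems by auto
    fix x assume "x \<in> S"
    then have "f differentiable at x" "f' differentiable at x"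
      using Suc.prems \<open>open S\<close> by (auto simp: differentiable_on_eq_differentiable_at)
    then show "frechet_derivative f (at x) v + frechet_derivative f' (at x) v =
          frechet_derivative (\<lambda>x. f x + f' x) (at x) v"
      by (simp add: frechet_derivative_add_real)
  qed
  then show ?case using Suc.prems by (simp add: differentiable_on_add)
qed

lemma frechet_derivative_times_real:
  fixes f f' :: "'a::euclidean_space \<Rightarrow> real"
  assumes "f differentiable at x" "f' differentiable at x"
  shows "frechet_derivative (\<lambda>x. f x * f' x) (at x) v =
    f x * frechet_derivative f' (at x) v + frechet_derivative f (at x) v * f' x"
  using frechet_derivative_at[OF has_derivative_mult[OF assms[unfolded frechet_derivative_works]]]
  by metis

lemma Ck_on_mult:
  fixes f f' :: "'a::euclidean_space \<Rightarrow> real"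
  assumes "open S" "Ck_on k S f" "Ck_on k S f'"
  shows "Ck_on k S (\<lambda>x. f x * f' x)"
  using assms(2,3)
proof (induction k arbitrary: f f')
  case 0
  then show ?case by (simp add: continuous_on_mult)
next
  case (Suc k)
  have "Ck_on k S (\<lambda>x. frechet_derivative (\<lambda>x. f x * f' x) (at x) v)" for v
  proof (rule Ck_on_cong[OF \<open>open S\<close>])
    show "Ck_on k S (\<lambda>x. f x * frechet_derivative f' (at x) v + frechet_derivative f (at x) v * f' x)"
      using Suc.prems Ck_on_Suc_lower by (intro Ck_on_add[OF \<open>open S\<close>] Suc.IH) auto
    fix x assume "x \<in> S"
    then have "f differentiable at x" "f' differentiable at x"
      using Suc.prems \<open>open S\<close> by (auto simp: differentiable_on_eq_differentiable_at)
    then show "f x * frechet_derivative f' (at x) v + frechet_derivative f (at x) v * f' x =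
          frechet_derivative (\<lambda>x. f x * f' x) (at x) v"
      by (simp add: frechet_derivative_times_real)
  qed
  then show ?case using Suc.prems by (simp add: differentiable_on_mult)
qed

locale smooth_manifold =
  fixes \<A> :: "('g::topological_space, 'e::euclidean_space) atlas"
  assumes atlas: "smooth_atlas \<A>"
begin

abbreviation R where "R \<equiv> smooth_funs \<A>"
abbreviation VF where "VF \<equiv> vector_fields \<A>"

lemma chart_image_open: "(U, x) \<in> \<A> \<Longrightarrow> open (x ` U)"
  using atlas unfolding smooth_atlas_def by auto

lemma smooth_funs_add: 
  assumes "f \<in> R" "f' \<in> R"
  shows "f + f' \<in> R"
proof -
  have "Ck_on k (x ` U) ((f + f') \<circ> inv_into U x)" if "(U, x) \<in> \<A>" for U x k
  proof -
    have "Ck_on k (x ` U) (f \<circ> inv_into U x)" "Ck_on k (x ` U) (f' \<circ> inv_into U x)"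
      using assms that unfolding smooth_funs_def smooth_on_def by blast+
    then show ?thesis
      using Ck_on_add[OF chart_image_open[OF that]] by (simp add: comp_def)
  qed
  then show ?thesis by (auto simp: smooth_funs_def smooth_on_def)
qed

lemma smooth_funs_mult: 
  assumes "f \<in> R" "f' \<in> R"
  shows "f * f' \<in> R"
proof -
  have "Ck_on k (x ` U) ((f * f') \<circ> inv_into U x)" if "(U, x) \<in> \<A>" for U x k
  proof -
    have "Ck_on k (x ` U) (f \<circ> inv_into U x)" "Ck_on k (x ` U) (f' \<circ> inv_into U x)"
      using assms that unfolding smooth_funs_def smooth_on_def by blast+
    then show ?thesis
      using Ck_on_mult[OF chart_image_open[OF that]] by (simp add: comp_def)
  qed
  then show ?thesis by (auto simp: smooth_funs_def smooth_on_def)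
qed

lemma smooth_funs_cst: "cst c \<in> R"
  by (auto simp: smooth_funs_def smooth_on_def comp_def cst_def Ck_on_const)

lemma chart_around: obtains U x where "(U, x) \<in> \<A>" "p \<in> U" "x p \<in> x ` U" "inv_into U x (x p) = p"
proof -
  have "p \<in> (\<Union>(U, x)\<in>\<A>. U)" using atlas unfolding smooth_atlas_def by auto
  then obtain U x where U: "(U, x) \<in> \<A>" "p \<in> U" by auto
  then have "homeomorphism U (x ` U) x (inv_into U x)"
    using atlas unfolding smooth_atlas_def by auto
  then have "inv_into U x (x p) = p" using U by (simp add: homeomorphism_def)
  then show ?thesis using that U by blast
qed

lemma smooth_fun_differentiable_in_chart:
  assumes "f \<in> R" "(U, x) \<in> \<A>" "p \<in> U"
  shows "(f \<circ> inv_into U x) differentiable at (x p)"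
proof -
  have "Ck_on (Suc 0) (x ` U) (f \<circ> inv_into U x)"
    using assms unfolding smooth_funs_def smooth_on_def by blast
  then have "(f \<circ> inv_into U x) differentiable_on (x ` U)" by simp
  then show ?thesis
    using chart_image_open[OF assms(2)] assms(3)
    by (simp add: differentiable_on_eq_differentiable_at)
qed

lemma vector_field_at:
  assumes "X \<in> VF" "(U, x) \<in> \<A>" "p \<in> U"
  obtains a where "\<And>f. f \<in> R \<Longrightarrow> X f p = frechet_derivative (f \<circ> inv_into U x) (at (x p)) a"
  using assms unfolding vector_fields_def by fast

lemma vector_field_smooth: "X \<in> VF \<Longrightarrow> f \<in> R \<Longrightarrow> X f \<in> R"
  unfolding vector_fields_def by auto

lemma vector_field_nonsmooth: "X \<in> VF \<Longrightarrow> f \<notin> R \<Longrightarrow> X f = 0"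
  unfolding vector_fields_def by auto

text \<open>The pointwise description of a vector field as a directional derivative yields that it is a
  derivation of the ring of smooth functions; the Cartan calculus below rests on this property.\<close>

lemma vector_field_cst: 
  assumes "X \<in> VF" shows "X (cst c) = 0"
proof
  fix p
  obtain U x where U: "(U, x) \<in> \<A>" "p \<in> U" using chart_around by metis
  obtain a where a: "\<And>f. f \<in> R \<Longrightarrow> X f p = frechet_derivative (f \<circ> inv_into U x) (at (x p)) a"
    using vector_field_at[OF assms(1) U] by metis
  show "X (cst c) p = 0 p"
    using a[OF smooth_funs_cst] by (simp add: comp_def cst_def frechet_derivative_const)
qed

lemma vector_field_add: 
  assumes "X \<in> VF" "f \<in> R" "f' \<in> R"
  shows "X (f + f') = X f + X f'"
proof
  fix p
  obtain U x where U: "(U, x) \<in> \<A>" "p \<in> U" using chart_around by metis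
  obtain a where a: "\<And>f. f \<in> R \<Longrightarrow> X f p = frechet_derivative (f \<circ> inv_into U x) (at (x p)) a"
    using vector_field_at[OF assms(1) U] by metis
  have eq: "(f + f') \<circ> inv_into U x = (\<lambda>y. (f \<circ> inv_into U x) y + (f' \<circ> inv_into U x) y)" by auto
  show "X (f + f') p = (X f + X f') p"
    using frechet_derivative_add_real[OF assms(2,3)[THEN smooth_fun_differentiable_in_chart[OF _ U]]]
    by (simp only: a[OF assms(2)] a[OF assms(3)] a[OF smooth_funs_add[OF assms(2,3)]] eq plus_fun_apply)
qed

lemma vector_field_mult: 
  assumes "X \<in> VF" "f \<in> R" "f' \<in> R"
  shows "X (f * f') = f * X f' + X f * f'"
proof
  fix p
  obtain U x where U: "(U, x) \<in> \<A>" "p \<in> U" "inv_into U x (x p) = p" using chart_around by metis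
  obtain a where a: "\<And>f. f \<in> R \<Longrightarrow> X f p = frechet_derivative (f \<circ> inv_into U x) (at (x p)) a"
    using vector_field_at[OF assms(1) U(1,2)] by metis
  have eq: "(f * f') \<circ> inv_into U x = (\<lambda>y. (f \<circ> inv_into U x) y * (f' \<circ> inv_into U x) y)" by auto
  show "X (f * f') p = (f * X f' + X f * f') p"
    using frechet_derivative_times_real[OF assms(2,3)[THEN smooth_fun_differentiable_in_chart[OF _ U(1,2)]]]
    by (simp only: a[OF assms(2)] a[OF assms(3)] a[OF smooth_funs_mult[OF assms(2,3)]] eq times_fun_apply
        plus_fun_apply comp_apply U(3))
qed

lemma vector_fields_plus:
  assumes "X \<in> VF" "Y \<in> VF"
  shows "X + Y \<in> VF"
proof -
  have "\<exists>a. \<forall>f\<in>R. (X + Y) f p = frechet_derivative (f \<circ> inv_into U x) (at (x p)) a"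
    if U: "(U, x) \<in> \<A>" "p \<in> U" for U x p
  proof -
    obtain a b where
      a: "\<And>f. f \<in> R \<Longrightarrow> X f p = frechet_derivative (f \<circ> inv_into U x) (at (x p)) a" and
      b: "\<And>f. f \<in> R \<Longrightarrow> Y f p = frechet_derivative (f \<circ> inv_into U x) (at (x p)) b"
      using vector_field_at[OF assms(1) U] vector_field_at[OF assms(2) U] by metis
    have "(X + Y) f p = frechet_derivative (f \<circ> inv_into U x) (at (x p)) (a + b)"
      if "f \<in> R" for f
      using smooth_fun_differentiable_in_chart[OF that U] a[OF that] b[OF that]
      by (simp add: linear_add linear_frechet_derivative)
    then show ?thesis by blast
  qed
  then show ?thesis
    using assms smooth_funs_add unfolding vector_fields_def by auto
qed

lemma vector_fields_fscale:
  assumes "X \<in> VF" "k \<in> R"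
  shows "fscale k X \<in> VF"
proof -
  have "\<exists>a. \<forall>f\<in>R. fscale k X f p = frechet_derivative (f \<circ> inv_into U x) (at (x p)) a"
    if U: "(U, x) \<in> \<A>" "p \<in> U" for U x p
  proof -
    obtain a where
      a: "\<And>f. f \<in> R \<Longrightarrow> X f p = frechet_derivative (f \<circ> inv_into U x) (at (x p)) a"
      using vector_field_at[OF assms(1) U] by metis
    have "fscale k X f p = frechet_derivative (f \<circ> inv_into U x) (at (x p)) (k p *\<^sub>R a)"
      if "f \<in> R" for f
      using smooth_fun_differentiable_in_chart[OF that U] a[OF that]
      by (simp add: linear_cmul linear_frechet_derivative fscale_def)
    then show ?thesis by blast
  qed
  then show ?thesis
    using assms smooth_funs_mult unfolding vector_fields_def by (auto simp: fscale_def)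
qed

lemma smooth_funs_uminus: "f \<in> R \<Longrightarrow> - f \<in> R"
  using smooth_funs_mult[OF smooth_funs_cst[of "-1"], of f]
  by (simp add: cst_def times_fun_def fun_Compl_def)

lemma smooth_funs_diff: "f \<in> R \<Longrightarrow> f' \<in> R \<Longrightarrow> f - f' \<in> R"
  using smooth_funs_add[OF _ smooth_funs_uminus, of f f'] by simp

lemma smooth_funs_sum: "(\<And>i. i \<in> I \<Longrightarrow> F i \<in> R) \<Longrightarrow> sum F I \<in> R"
  using smooth_funs_cst[of 0]
  by (induction I rule: infinite_finite_induct) (auto simp: smooth_funs_add cst_def zero_fun_def)

lemma vector_fields_0: "0 \<in> VF"
proof -
  have "\<exists>a. \<forall>f\<in>R. (0 :: 'g vfield) f p = frechet_derivative (f \<circ> inv_into U x) (at (x p)) a"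
    if "(U, x) \<in> \<A>" "p \<in> U" for U x p
    using smooth_fun_differentiable_in_chart[OF _ that]
    by (intro exI[of _ 0]) (simp add: linear_0 linear_frechet_derivative)
  then show ?thesis
    using smooth_funs_cst[of 0] unfolding vector_fields_def by (auto simp: cst_def zero_fun_def)
qed

lemma vector_fields_sum: "(\<And>i. i \<in> I \<Longrightarrow> F i \<in> VF) \<Longrightarrow> sum F I \<in> VF"
  using vector_fields_0
  by (induction I rule: infinite_finite_induct) (auto simp: vector_fields_plus)

lemma vector_fields_uminus:
  assumes "X \<in> VF" shows "- X \<in> VF"
proof -
  have "fscale (cst (-1)) X = - X" by (simp add: fscale_def cst_def fun_eq_iff)
  then show ?thesis using vector_fields_fscale[OF assms smooth_funs_cst] by metis
qed

lemma vector_fields_diff: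
  "X \<in> VF \<Longrightarrow> Y \<in> VF \<Longrightarrow> X - Y \<in> VF"
  using vector_fields_plus[OF _ vector_fields_uminus, of X Y] by simp

end

lemma one_form_add: "\<xi> \<in> one_forms \<A> \<Longrightarrow> X \<in> vector_fields \<A> \<Longrightarrow> Y \<in> vector_fields \<A> \<Longrightarrow>
    \<xi> (X + Y) = \<xi> X + \<xi> Y"
  and one_form_fscale: "\<xi> \<in> one_forms \<A> \<Longrightarrow> f \<in> smooth_funs \<A> \<Longrightarrow> X \<in> vector_fields \<A> \<Longrightarrow>
    \<xi> (fscale f X) = f * \<xi> X"
  and one_form_smooth: "\<xi> \<in> one_forms \<A> \<Longrightarrow> X \<in> vector_fields \<A> \<Longrightarrow> \<xi> X \<in> smooth_funs \<A>"
  and one_form_outside: "\<xi> \<in> one_forms \<A> \<Longrightarrow> X \<notin> vector_fields \<A> \<Longrightarrow> \<xi> X = 0"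
  unfolding one_forms_def by auto

lemma sum_apply: "(\<Sum>i\<in>I. F i) x = (\<Sum>i\<in>I. F i x)" for F :: "'i \<Rightarrow> 'x \<Rightarrow> 'y::comm_monoid_add"
  by (induction I rule: infinite_finite_induct) auto

lemma sum_1_to_3:
  fixes F :: "nat \<Rightarrow> 'y::comm_monoid_add"
  shows "(\<Sum>a=1..3. F a) = F 1 + F 2 + F 3" and "(\<Sum>a=Suc 0..3. F a) = F 1 + F 2 + F 3"
proof -
  have "{1..3} = {1, 2, 3::nat}" by auto
  then show "(\<Sum>a=1..3. F a) = F 1 + F 2 + F 3" by (simp add: add.assoc)
  then show "(\<Sum>a=Suc 0..3. F a) = F 1 + F 2 + F 3" by simp
qed

lemma ball_1_to_3:
  "(\<forall>a\<in>{1..3}. P a) \<longleftrightarrow> P 1 \<and> P 2 \<and> P (3::nat)"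
  "(\<forall>a\<in>{Suc 0..3}. P a) \<longleftrightarrow> P 1 \<and> P 2 \<and> P (3::nat)"
proof -
  have "{1..3} = {1, 2, 3::nat}" by auto
  then show "(\<forall>a\<in>{1..3}. P a) \<longleftrightarrow> P 1 \<and> P 2 \<and> P (3::nat)" by simp
  then show "(\<forall>a\<in>{Suc 0..3}. P a) \<longleftrightarrow> P 1 \<and> P 2 \<and> P (3::nat)" by simp
qed

section \<open>Left-invariant frames\<close>

locale left_invariant_frame =
  smooth_manifold \<A> for \<A> :: "('g::{topological_group_add,t2_space,second_countable_topology}, real^3) atlas" +
  fixes v :: "nat \<Rightarrow> 'g vfield"
  assumes basis: "lie_algebra_basis \<A> v"
begin

lemma basis_vector_field: "a \<in> {1..3} \<Longrightarrow> v a \<in> VF"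
  using basis unfolding lie_algebra_basis_def lie_algebra_def by auto

text \<open>A linear relation between the \<open>v\<^sub>a\<close> at one point is transported by left translations to every other
  point, where it contradicts linear independence in the Lie algebra. Vector fields vanish on
  nonsmooth functions, so the relation holds at \<open>f \<circ> (+) t\<close> whether this function is smooth or not.\<close>

lemma basis_independent_at:
  assumes "\<And>f. f \<in> R \<Longrightarrow> (\<Sum>a=1..3. c a * v a f p) = 0"
  shows "\<forall>a\<in>{1..3}. c a = 0"
proof -
  have zero: "(\<Sum>a=1..3. c a * v a f p) = 0" for f
  proof (cases "f \<in> R")
    case False
    then have "v a f p = 0" if "a \<in> {1..3}" for a
      using vector_field_nonsmooth[OF basis_vector_field[OF that]] by simp
    then show ?thesis by simp
  qed (use assms in blast)
  have "(\<Sum>a=1..3. fscale (cst (c a)) (v a)) f q = 0" for f q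
  proof -
    \<comment> \<open>Translation by this element maps \<open>p\<close> to \<open>q\<close>.\<close>
    let ?t = "q - p"
    have "pushforward ?t (v a) = v a" if "a \<in> {1..3}" for a
      using basis that unfolding lie_algebra_basis_def lie_algebra_def by auto
    then have "v a f q = v a (f \<circ> (+) ?t) (- ?t + q)" if "a \<in> {1..3}" for a
      using that unfolding pushforward_def by (metis comp_apply)
    moreover have "- ?t + q = p" by (simp only: minus_diff_eq diff_add_cancel)
    ultimately have "v a f q = v a (f \<circ> (+) ?t) p" if "a \<in> {1..3}" for a
      using that by simp
    then show ?thesis
      using zero[of "f \<circ> (+) ?t"] by (simp add: sum_apply fscale_def cst_def)
  qed
  then have "(\<Sum>a=1..3. fscale (cst (c a)) (v a)) = 0" by (auto simp: fun_eq_iff)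
  then show ?thesis using basis unfolding lie_algebra_basis_def by blast
qed

text \<open>The tangent space at a point, seen through directional derivatives in a chart, has dimension at
  most three, so three independent vectors span it.\<close>

lemma vector_field_basis_at:
  assumes X: "X \<in> VF"
  obtains c where "\<And>f. X f p = (\<Sum>a=1..3. c a * v a f p)"
proof -
  obtain U x where U: "(U, x) \<in> \<A>" "p \<in> U" using chart_around by metis
  have "\<exists>b. \<forall>f\<in>R. v a f p = frechet_derivative (f \<circ> inv_into U x) (at (x p)) b"
    if "a \<in> {1..3}" for a
    using vector_field_at[OF basis_vector_field[OF that] U] by metis
  then obtain b where b: "\<And>a f. a \<in> {1..3} \<Longrightarrow> f \<in> R \<Longrightarrow>
      v a f p = frechet_derivative (f \<circ> inv_into U x) (at (x p)) (b a)"
    by metis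
  obtain y where y: "\<And>f. f \<in> R \<Longrightarrow>
      X f p = frechet_derivative (f \<circ> inv_into U x) (at (x p)) y"
    using vector_field_at[OF X U] by metis
  define L :: "real^3 \<Rightarrow> real^3" where "L z = z$1 *\<^sub>R b 1 + z$2 *\<^sub>R b 2 + z$3 *\<^sub>R b 3" for z
  have L: "linear L" unfolding L_def by (rule linearI) (auto simp: algebra_simps)
  have deriv: "frechet_derivative (f \<circ> inv_into U x) (at (x p)) (L z)
      = z$1 * v 1 f p + z$2 * v 2 f p + z$3 * v 3 f p" if f: "f \<in> R" for f z
    using linear_frechet_derivative[OF smooth_fun_differentiable_in_chart[OF f U]] b[OF _ f]
    unfolding L_def by (simp add: linear_add linear_cmul)
  have "z = 0" if "L z = 0" for z
  proof -
    define c where "c a = (if a = 1 then z$1 else if a = 2 then z$2 else z$3)" for a :: nat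
    have "(\<Sum>a=1..3. c a * v a f p) = 0" if "f \<in> R" for f
      using deriv[OF that, of z] \<open>L z = 0\<close>
        linear_frechet_derivative[OF smooth_fun_differentiable_in_chart[OF that U]]
      by (simp add: sum_1_to_3 c_def linear_0)
    from basis_independent_at[OF this] show "z = 0"
      by (simp add: ball_1_to_3 c_def vec_eq_iff forall_3)
  qed
  then have "inj L" using L by (simp add: linear_injective_0)
  then obtain z where z: "L z = y"
    using linear_injective_imp_surjective[OF L] by (metis surjD)
  have "X f p = (\<Sum>a=1..3. (if a = 1 then z$1 else if a = 2 then z$2 else z$3) * v a f p)" for f
  proof (cases "f \<in> R")
    case True
    then show ?thesis using y deriv[of f z] z by (simp add: sum_1_to_3)
  next
    case False
    then show ?thesis
      using vector_field_nonsmooth[OF basis_vector_field] vector_field_nonsmooth[OF X]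
      by simp
  qed
  then show ?thesis by (rule that)
qed

text \<open>Otherwise the vectors \<open>(v\<^sub>1 f, v\<^sub>2 f, v\<^sub>3 f)\<close> at the point would lie in a plane, and a normal vector
  of that plane would be a relation between the \<open>v\<^sub>a\<close>.\<close>

lemma dual_functions_at:
  obtains \<phi> where "\<And>j. \<phi> j \<in> R"
    "\<And>a j. a \<in> {1..3} \<Longrightarrow> j \<in> {1..3} \<Longrightarrow> v a (\<phi> j) p = (if a = j then 1 else 0)"
proof -
  define J where "J f = (vector [v 1 f p, v 2 f p, v 3 f p] :: real^3)" for f
  have add: "J (f + f') = J f + J f'" if "f \<in> R" "f' \<in> R" for f f'
    using vector_field_add[OF basis_vector_field that]
    by (simp add: J_def vec_eq_iff forall_3)
  have scale: "J (cst c * f) = c *\<^sub>R J f" if "f \<in> R" for f c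
    using vector_field_mult[OF basis_vector_field smooth_funs_cst that]
      vector_field_cst[OF basis_vector_field]
    by (simp add: J_def vec_eq_iff forall_3 cst_def)
  have "J (cst 0) = 0"
    using vector_field_cst[OF basis_vector_field] by (simp add: J_def vec_eq_iff forall_3)
  then have "0 \<in> J ` R" using smooth_funs_cst by (metis image_eqI)
  then have subbundle: "subspace (J ` R)"
    using smooth_funs_add smooth_funs_mult[OF smooth_funs_cst]
    unfolding subspace_def by (auto simp flip: add scale)
  have "span (J ` R) = UNIV"
  proof (rule ccontr)
    assume "span (J ` R) \<noteq> UNIV"
    from span_not_UNIV_orthogonal[OF this] obtain z where
      z: "z \<noteq> 0" "\<And>x. x \<in> span (J ` R) \<Longrightarrow> z \<bullet> x = 0" by blast
    define c where "c a = (if a = 1 then z$1 else if a = 2 then z$2 else z$3)" for a :: nat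
    have "(\<Sum>a=1..3. c a * v a f p) = 0" if "f \<in> R" for f
      using z(2)[of "J f"] that by (simp add: span_base J_def inner_vec_def sum_3 sum_1_to_3 c_def)
    from basis_independent_at[OF this] have "z = 0"
      by (simp add: ball_1_to_3 c_def vec_eq_iff forall_3)
    then show False using z(1) by simp
  qed
  then have all: "J ` R = UNIV" using subbundle by (metis span_eq_iff)
  have "\<exists>f\<in>R. J f = vector [if j = 1 then 1 else 0, if j = 2 then 1 else 0, if j = 3 then 1 else 0]"
    for j :: nat
    using all by (metis UNIV_I imageE)
  then obtain \<phi> where \<phi>: "\<And>j. \<phi> j \<in> R"
    "\<And>j::nat. J (\<phi> j) = vector [if j = 1 then 1 else 0, if j = 2 then 1 else 0, if j = 3 then 1 else 0]"
    by metis
  have "v a (\<phi> j) p = (if a = j then 1 else 0)" if "a \<in> {1..3}" for a j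
  proof -
    have "\<forall>a\<in>{1..3}. v a (\<phi> j) p = (if a = j then 1 else 0)"
      using \<phi>(2)[of j] by (simp add: ball_1_to_3 J_def vec_eq_iff forall_3 eq_commute)
    then show ?thesis using that by blast
  qed
  then show ?thesis using that \<phi>(1) by blast
qed

text \<open>The usual proof cuts off with bump functions. Cramer's rule avoids them: with \<open>M = (v\<^sub>a \<phi>\<^sub>j)\<close>, the
  vector field \<open>det M \<cdot> Z\<close> is globally a combination of the \<open>v\<^sub>a\<close> whose coefficients are smooth and
  vanish where \<open>Z\<close> does.\<close>

lemma one_form_tensorial:
  assumes \<xi>: "\<xi> \<in> one_forms \<A>" and Z: "Z \<in> VF" and zero: "\<And>f. Z f p = 0"
  shows "\<xi> Z p = 0"
proof -
  obtain \<phi> where \<phi>: "\<And>j. \<phi> j \<in> R"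
    "\<And>a j. a \<in> {1..3} \<Longrightarrow> j \<in> {1..3} \<Longrightarrow> v a (\<phi> j) p = (if a = j then 1 else 0)"
    using dual_functions_at by metis
  define det3 :: "(nat \<Rightarrow> nat \<Rightarrow> 'g scal) \<Rightarrow> 'g scal" where
    "det3 M = M 1 1 * (M 2 2 * M 3 3 - M 2 3 * M 3 2) - M 1 2 * (M 2 1 * M 3 3 - M 2 3 * M 3 1)
       + M 1 3 * (M 2 1 * M 3 2 - M 2 2 * M 3 1)" for M
  define M where "M a j = v a (\<phi> j)" for a j
  define N where "N a = det3 (M(a := (\<lambda>j. Z (\<phi> j))))" for a
  have smooth_M: "M a j \<in> R" if "a \<in> {1..3}" for a j
    using that \<phi>(1) vector_field_smooth[OF basis_vector_field] by (simp add: M_def)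
  have smooth_Z: "Z (\<phi> j) \<in> R" for j
    using \<phi>(1) vector_field_smooth[OF Z] by simp
  have smooth_det: "det3 M' \<in> R" if "\<And>a j. a \<in> {1..3} \<Longrightarrow> M' a j \<in> R" for M'
    unfolding det3_def
    by (intro smooth_funs_add smooth_funs_diff smooth_funs_mult that) auto
  have smooth_D: "det3 M \<in> R" and smooth_N: "N a \<in> R" for a
    unfolding N_def by (auto intro!: smooth_det simp: smooth_M smooth_Z)
  have "det3 M q * Z f q = (\<Sum>a=1..3. N a q * v a f q)" for f q
  proof -
    obtain c where c: "\<And>f. Z f q = (\<Sum>a=1..3. c a * v a f q)"
      using vector_field_basis_at[OF Z] by metis
    have "N 1 q = c 1 * det3 M q" "N 2 q = c 2 * det3 M q" "N 3 q = c 3 * det3 M q"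
      unfolding N_def det3_def M_def by (simp_all add: c sum_1_to_3) algebra+
    then show ?thesis by (simp add: c[of f] sum_1_to_3 algebra_simps)
  qed
  then have eq: "fscale (det3 M) Z = (\<Sum>a=1..3. fscale (N a) (v a))"
    by (auto simp: fun_eq_iff fscale_def sum_apply)
  have "det3 M * \<xi> Z = \<xi> (\<Sum>a=1..3. fscale (N a) (v a))"
    using \<xi> Z smooth_D unfolding eq[symmetric] one_forms_def by auto
  also have "\<dots> = (\<Sum>a=1..3. N a * \<xi> (v a))"
    using \<xi> smooth_N basis_vector_field vector_fields_plus vector_fields_fscale
    unfolding one_forms_def sum_1_to_3 by simp
  finally have "det3 M p * \<xi> Z p = (\<Sum>a=1..3. N a p * \<xi> (v a) p)"
    by (metis (mono_tags, lifting) sum.cong sum_apply times_fun_apply)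
  moreover have "det3 M p = 1" unfolding det3_def M_def by (simp add: \<phi>(2))
  moreover have "N a p = 0" if "a \<in> {1..3}" for a
  proof -
    have "\<forall>a\<in>{1..3}. N a p = 0"
      unfolding N_def det3_def ball_1_to_3 by (simp add: zero)
    then show ?thesis using that by blast
  qed
  ultimately show ?thesis by simp
qed

text \<open>The difference \<open>W\<close> of the two sides is orthogonal to all \<open>v\<^sub>a\<close>. By tensoriality it is orthogonal to
  every vector field, and the metric is nondegenerate.\<close>

lemma orthonormal_expansion:
  assumes g: "pseudo_riemannian_metric \<A> g"
    and orth: "\<And>a b. a \<in> {1..3} \<Longrightarrow> b \<in> {1..3} \<Longrightarrow> g (v a) (v b) = cst (if a = b then \<epsilon> a else 0)"
    and \<epsilon>: "\<And>a. a \<in> {1..3} \<Longrightarrow> \<epsilon> a * \<epsilon> a = 1"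
    and X: "X \<in> VF"
  shows "X = (\<Sum>a=1..3. fscale (cst (\<epsilon> a) * g X (v a)) (v a))"
proof -
  have form: "g Y \<in> one_forms \<A>" "(\<lambda>Z. g Z Y) \<in> one_forms \<A>" if "Y \<in> VF" for Y
    using g that unfolding pseudo_riemannian_metric_def bilinear_forms_def by auto
  have coeff: "cst (\<epsilon> a) * g X (v a) \<in> R" if "a \<in> {1..3}" for a
    using form(1)[OF X] basis_vector_field[OF that] smooth_funs_mult[OF smooth_funs_cst]
    unfolding one_forms_def by blast
  define W where "W = X - (\<Sum>a=1..3. fscale (cst (\<epsilon> a) * g X (v a)) (v a))"
  have W: "W \<in> VF"
    unfolding W_def using X coeff basis_vector_field
    by (intro vector_fields_diff vector_fields_sum vector_fields_fscale)
  have X_eq: "X = W + (\<Sum>a=1..3. fscale (cst (\<epsilon> a) * g X (v a)) (v a))" unfolding W_def by simp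
  have W_orth: "g W (v b) = 0" if b: "b \<in> {1..3}" for b
  proof -
    have frm: "(\<lambda>Z. g Z (v b)) \<in> one_forms \<A>" by (rule form(2)[OF basis_vector_field[OF b]])
    have mem: "fscale (cst (\<epsilon> a) * g X (v a)) (v a) \<in> VF" if "a \<in> {1..3}" for a
      using that coeff basis_vector_field by (intro vector_fields_fscale)
    have "g X (v b) = g W (v b) + g (\<Sum>a=1..3. fscale (cst (\<epsilon> a) * g X (v a)) (v a)) (v b)"
      by (rule trans[OF arg_cong[OF X_eq, of "\<lambda>X. g X (v b)"]
          one_form_add[OF frm W vector_fields_sum[OF mem]]])
    also have "g (\<Sum>a=1..3. fscale (cst (\<epsilon> a) * g X (v a)) (v a)) (v b)
        = (\<Sum>a=1..3. g (fscale (cst (\<epsilon> a) * g X (v a)) (v a)) (v b))"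
      using frm mem vector_fields_plus unfolding one_forms_def sum_1_to_3 by simp
    also have "\<dots> = (\<Sum>a=1..3. if a = b then g X (v b) else 0)"
    proof (rule sum.cong[OF refl])
      fix a :: nat assume a: "a \<in> {1..3}"
      have "g (fscale (cst (\<epsilon> a) * g X (v a)) (v a)) (v b) = cst (\<epsilon> a) * g X (v a) * g (v a) (v b)"
        using frm basis_vector_field[OF a] coeff[OF a] unfolding one_forms_def by auto
      then show "g (fscale (cst (\<epsilon> a) * g X (v a)) (v a)) (v b) = (if a = b then g X (v b) else 0)"
        using orth[OF a b] \<epsilon>[OF a] by (auto simp: cst_def fun_eq_iff)
    qed
    also have "\<dots> = g X (v b)" using b by simp
    finally show ?thesis by (simp add: fun_eq_iff)
  qed
  have "g W Y p = 0" if Y: "Y \<in> VF" for Y p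
  proof -
    obtain c where c: "\<And>f. Y f p = (\<Sum>a=1..3. c a * v a f p)"
      using vector_field_basis_at[OF Y] by metis
    define S where "S = (\<Sum>a=1..3. fscale (cst (c a)) (v a))"
    have S: "S \<in> VF"
      unfolding S_def using basis_vector_field smooth_funs_cst
      by (intro vector_fields_sum vector_fields_fscale)
    have YS: "Y - S \<in> VF" by (rule vector_fields_diff[OF Y S])
    have "(Y - S) f p = 0" for f
      using c by (simp add: S_def sum_apply fscale_def cst_def)
    from one_form_tensorial[OF form(1)[OF W] YS this] have "g W (Y - S) p = 0" .
    moreover have "g W S = 0"
      using form(1)[OF W] basis_vector_field vector_fields_plus vector_fields_fscale
        smooth_funs_cst
      unfolding one_forms_def S_def sum_1_to_3 by (simp add: W_orth)
    moreover have "g W Y = g W (Y - S) + g W S"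
      using one_form_add[OF form(1)[OF W] YS S] by simp
    ultimately show ?thesis by simp
  qed
  then have "W f p = 0" for f p
    using g W unfolding pseudo_riemannian_metric_def by blast
  then have "W = 0" by (auto simp: fun_eq_iff)
  then show ?thesis unfolding W_def by simp
qed

end

section \<open>Sections and the Dorfman bracket\<close>

lemma cst_add: "cst a + cst b = cst (a + b)"
  and cst_mult: "cst a * cst b = cst (a * b)"
  and cst_diff: "cst a - cst b = cst (a - b)"
  and cst_minus: "- cst a = cst (- a)"
  and cst_0: "cst 0 = 0" and cst_1: "cst 1 = 1"
  by (auto simp: cst_def fun_eq_iff)

lemma cst_sum: "(\<Sum>i\<in>I. cst (F i)) = cst (\<Sum>i\<in>I. F i)"
  by (simp add: fun_eq_iff sum_apply cst_def)

lemma fscale_apply: "fscale f T x = f * T x"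
  by (simp add: fscale_def)

lemma fscale_simps:
  "fscale f (T + T') = fscale f T + fscale f T'" "fscale f (T - T') = fscale f T - fscale f T'"
  "fscale (f + k) T = fscale f T + fscale k T" "fscale (f - k) T = fscale f T - fscale k T"
  "fscale f (fscale k T) = fscale (f * k) T" "fscale f 0 = 0" "fscale 0 T = 0" "fscale 1 T = T"
  by (auto simp: fscale_def fun_eq_iff algebra_simps)

lemma anchor_simps [simp]:
  "anchor (u + v) = anchor u + anchor v" "anchor (u - v) = anchor u - anchor v"
  "anchor (sscale f u) = fscale f (anchor u)" "anchor 0 = 0" "anchor (X, \<xi>, l) = X"
  by (auto simp: anchor_def sscale_def split: prod.splits)

lemma pairing_commute: "pairing u v = pairing v u"
  by (auto simp: pairing_def add.commute mult.commute split: prod.splits)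

lemma sscale_simps:
  "sscale f (u + v) = sscale f u + sscale f v"
  "sscale (f + k) u = sscale f u + sscale k u"
  "sscale f (sscale k u) = sscale (f * k) u"
  "sscale 0 u = 0" "sscale 1 u = u" "sscale f 0 = 0"
  "sscale f (u - v) = sscale f u - sscale f v"
  "sscale (f - k) u = sscale f u - sscale k u"
  by (cases u; cases v; simp add: sscale_def fscale_simps algebra_simps zero_prod_def)+

context smooth_manifold
begin

abbreviation \<Gamma> where "\<Gamma> \<equiv> sections \<A>"

lemma vector_field_0: "X \<in> VF \<Longrightarrow> X 0 = 0"
  using vector_field_cst[of X 0] by (simp add: cst_0)

lemma smooth_funs_0: "0 \<in> R" and smooth_funs_1: "1 \<in> R" and smooth_funs_2: "2 \<in> R"
proof -
  show "0 \<in> R" "1 \<in> R" using smooth_funs_cst[of 0] smooth_funs_cst[of 1] by (auto simp: cst_0 cst_1)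
  then show "2 \<in> R" using smooth_funs_add[of 1 1] by simp
qed

lemma vector_field_sum:
  assumes "X \<in> VF" "\<And>i. i \<in> I \<Longrightarrow> F i \<in> R" shows "X (sum F I) = (\<Sum>i\<in>I. X (F i))"
  using assms(2)
  by (induction I rule: infinite_finite_induct)
    (auto simp: vector_field_0[OF assms(1)] vector_field_add[OF assms(1)] smooth_funs_sum)

lemma vector_field_cst_mult:
  assumes "X \<in> VF" "f \<in> R" shows "X (cst c * f) = cst c * X f"
  using vector_field_mult[OF assms(1) smooth_funs_cst assms(2)] vector_field_cst[OF assms(1)] by simp

lemma one_form_diff:
  assumes "\<xi> \<in> one_forms \<A>" "X \<in> VF" "Y \<in> VF" shows "\<xi> (X - Y) = \<xi> X - \<xi> Y"
  using one_form_add[OF assms(1) vector_fields_diff[OF assms(2,3)] assms(3)] by simp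

lemma one_formI:
  assumes "\<And>X. X \<in> VF \<Longrightarrow> \<xi> X \<in> R" "\<And>X. X \<notin> VF \<Longrightarrow> \<xi> X = 0"
    "\<And>X Y. X \<in> VF \<Longrightarrow> Y \<in> VF \<Longrightarrow> \<xi> (X + Y) = \<xi> X + \<xi> Y"
    "\<And>f X. f \<in> R \<Longrightarrow> X \<in> VF \<Longrightarrow> \<xi> (fscale f X) = f * \<xi> X"
  shows "\<xi> \<in> one_forms \<A>"
  using assms unfolding one_forms_def by blast

lemma one_forms_add: "\<xi> \<in> one_forms \<A> \<Longrightarrow> \<eta> \<in> one_forms \<A> \<Longrightarrow> \<xi> + \<eta> \<in> one_forms \<A>"
  by (rule one_formI)
    (auto simp: one_form_add one_form_fscale one_form_smooth one_form_outside smooth_funs_add algebra_simps)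

lemma one_forms_fscale: "f \<in> R \<Longrightarrow> \<xi> \<in> one_forms \<A> \<Longrightarrow> fscale f \<xi> \<in> one_forms \<A>"
  by (rule one_formI)
    (auto simp: fscale_apply one_form_add one_form_fscale one_form_smooth one_form_outside smooth_funs_mult algebra_simps)

lemma one_forms_diff: "\<xi> \<in> one_forms \<A> \<Longrightarrow> \<eta> \<in> one_forms \<A> \<Longrightarrow> \<xi> - \<eta> \<in> one_forms \<A>"
  by (rule one_formI)
    (auto simp: one_form_add one_form_fscale one_form_smooth one_form_outside smooth_funs_diff algebra_simps)

lemma one_forms_0: "0 \<in> one_forms \<A>"
  by (rule one_formI) (auto simp: smooth_funs_0)

lemma sections_add: "u \<in> \<Gamma> \<Longrightarrow> v \<in> \<Gamma> \<Longrightarrow> u + v \<in> \<Gamma>"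
  and sections_diff: "u \<in> \<Gamma> \<Longrightarrow> v \<in> \<Gamma> \<Longrightarrow> u - v \<in> \<Gamma>"
  and sections_sscale: "f \<in> R \<Longrightarrow> u \<in> \<Gamma> \<Longrightarrow> sscale f u \<in> \<Gamma>"
  and sections_0: "0 \<in> \<Gamma>"
  by (auto simp: sections_def sscale_def zero_prod_def vector_fields_plus vector_fields_diff
      vector_fields_fscale vector_fields_0 one_forms_add one_forms_diff one_forms_fscale one_forms_0
      smooth_funs_add smooth_funs_diff smooth_funs_mult smooth_funs_0)

lemma sections_sum: "(\<And>i. i \<in> I \<Longrightarrow> u i \<in> \<Gamma>) \<Longrightarrow> sum u I \<in> \<Gamma>"
  by (induction I rule: infinite_finite_induct) (auto simp: sections_0 sections_add)

lemma anchor_vector_field: "u \<in> \<Gamma> \<Longrightarrow> anchor u \<in> VF"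
  by (auto simp: sections_def anchor_def)

lemma pairing_add_left:
  "u \<in> \<Gamma> \<Longrightarrow> u' \<in> \<Gamma> \<Longrightarrow> w \<in> \<Gamma> \<Longrightarrow> pairing (u + u') w = pairing u w + pairing u' w"
  by (auto simp: sections_def pairing_def one_form_add algebra_simps)

lemma pairing_sscale_left:
  "f \<in> R \<Longrightarrow> u \<in> \<Gamma> \<Longrightarrow> w \<in> \<Gamma> \<Longrightarrow> pairing (sscale f u) w = f * pairing u w"
  by (auto simp: sections_def pairing_def sscale_def one_form_fscale fscale_apply algebra_simps)

lemma pairing_add_right:
  "u \<in> \<Gamma> \<Longrightarrow> u' \<in> \<Gamma> \<Longrightarrow> w \<in> \<Gamma> \<Longrightarrow> pairing w (u + u') = pairing w u + pairing w u'"
  and pairing_sscale_right: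
  "f \<in> R \<Longrightarrow> u \<in> \<Gamma> \<Longrightarrow> w \<in> \<Gamma> \<Longrightarrow> pairing w (sscale f u) = f * pairing w u"
  using pairing_add_left pairing_sscale_left by (simp_all add: pairing_commute[of w])

lemma pairing_diff_left:
  "u \<in> \<Gamma> \<Longrightarrow> u' \<in> \<Gamma> \<Longrightarrow> w \<in> \<Gamma> \<Longrightarrow> pairing (u - u') w = pairing u w - pairing u' w"
  using pairing_add_left[of "u - u'" u' w] sections_diff[of u u'] by simp

lemma pairing_smooth: "u \<in> \<Gamma> \<Longrightarrow> w \<in> \<Gamma> \<Longrightarrow> pairing u w \<in> R"
  by (auto simp: sections_def pairing_def one_form_smooth smooth_funs_add smooth_funs_mult smooth_funs_cst)

lemma pairing_0_left: "w \<in> \<Gamma> \<Longrightarrow> pairing 0 w = 0"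
  using pairing_sscale_left[OF smooth_funs_0 sections_0, of w] by (simp add: sscale_simps)

lemma pairing_sum_left:
  assumes "\<And>i. i \<in> I \<Longrightarrow> u i \<in> \<Gamma>" "w \<in> \<Gamma>"
  shows "pairing (sum u I) w = (\<Sum>i\<in>I. pairing (u i) w)"
  using assms(1)
  by (induction I rule: infinite_finite_induct)
    (auto simp: pairing_0_left[OF assms(2)] pairing_add_left[OF _ _ assms(2)] sections_sum)

lemma lie_bracket_fscale_left:
  assumes X: "X \<in> VF" and Y: "Y \<in> VF" and f: "f \<in> R"
  shows "lie_bracket (fscale f X) Y = fscale f (lie_bracket X Y) - fscale (Y f) X"
proof
  fix k
  show "lie_bracket (fscale f X) Y k = (fscale f (lie_bracket X Y) - fscale (Y f) X) k"
  proof (cases "k \<in> R")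
    case True
    then show ?thesis
      using vector_field_mult[OF Y f vector_field_smooth[OF X True]]
      by (simp add: lie_bracket_def fscale_apply algebra_simps)
  next
    case False
    have zero: "X k = 0" "Y k = 0" "X 0 = 0" "Y 0 = 0"
      using vector_field_nonsmooth[OF X False] vector_field_nonsmooth[OF Y False]
        vector_field_0[OF X] vector_field_0[OF Y] by auto
    then have "lie_bracket (fscale f X) Y k = 0" "lie_bracket X Y k = 0"
      by (simp_all only: lie_bracket_def fscale_apply mult_zero_right diff_self)
    then show ?thesis using zero by (simp add: fscale_apply)
  qed
qed

lemma lie_bracket_commute: "lie_bracket Y X = - lie_bracket X Y"
  by (auto simp: lie_bracket_def)

lemma lie_bracket_fscale_right:
  assumes X: "X \<in> VF" and Y: "Y \<in> VF" and f: "f \<in> R"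
  shows "lie_bracket X (fscale f Y) = fscale f (lie_bracket X Y) + fscale (X f) Y"
  using lie_bracket_fscale_left[OF Y X f]
  by (simp add: lie_bracket_def fscale_def fun_eq_iff algebra_simps)

lemma lie_bracket_add_left:
  assumes X: "X \<in> VF" and X': "X' \<in> VF" and Y: "Y \<in> VF"
  shows "lie_bracket (X + X') Y = lie_bracket X Y + lie_bracket X' Y"
proof
  fix k
  show "lie_bracket (X + X') Y k = (lie_bracket X Y + lie_bracket X' Y) k"
    using vector_field_add[OF Y vector_field_smooth[OF X] vector_field_smooth[OF X']]
      vector_field_nonsmooth[OF X] vector_field_nonsmooth[OF X'] vector_field_0[OF Y]
    by (cases "k \<in> R") (simp_all add: lie_bracket_def algebra_simps)
qed

lemma lie_bracket_add_right:
  assumes "X \<in> VF" "X' \<in> VF" "Y \<in> VF"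
  shows "lie_bracket Y (X + X') = lie_bracket Y X + lie_bracket Y X'"
  using lie_bracket_add_left[OF assms] by (simp add: lie_bracket_commute[of Y])

end

text \<open>Closure under the Lie bracket is an assumption here, because it is immediate in a frame with
  constant structure functions, whereas a proof in charts needs the symmetry of second derivatives.\<close>

locale courant_algebroid = smooth_manifold +
  fixes H :: "'a form3" and F :: "'a form2"
  assumes lie_bracket_closed: "X \<in> vector_fields \<A> \<Longrightarrow> Y \<in> vector_fields \<A> \<Longrightarrow> lie_bracket X Y \<in> vector_fields \<A>"
    and H: "H \<in> three_forms \<A>" and F: "F \<in> two_forms \<A>"
begin

abbreviation dorf where "dorf \<equiv> dorfman \<A> H F"

lemma two_form_one_form: "T \<in> two_forms \<A> \<Longrightarrow> X \<in> VF \<Longrightarrow> T X \<in> one_forms \<A>"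
  and two_form_one_form': "T \<in> two_forms \<A> \<Longrightarrow> X \<in> VF \<Longrightarrow> (\<lambda>Y. T Y X) \<in> one_forms \<A>"
  and three_form_two_form: "X \<in> VF \<Longrightarrow> H X \<in> two_forms \<A>"
  and three_form_two_form': "X \<in> VF \<Longrightarrow> (\<lambda>Y. H Y X) \<in> two_forms \<A>"
  using H by (auto simp: two_forms_def three_forms_def bilinear_forms_def)

lemma form_linear:
  assumes "X \<in> VF" "X' \<in> VF" "Y \<in> VF" "f \<in> R"
  shows "F (X + X') = F X + F X'" "F (fscale f X) = fscale f (F X)"
    "H (X + X') Y = H X Y + H X' Y" "H (fscale f X) Y = fscale f (H X Y)"
    "H Y (X + X') = H Y X + H Y X'" "H Y (fscale f X) = fscale f (H Y X)"
proof -
  have two: "T (X + X') = T X + T X' \<and> T (fscale f X) = fscale f (T X)" if T: "T \<in> two_forms \<A>" for T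
  proof (intro conjI; rule ext)
    fix Z
    have "T (X + X') Z = T X Z + T X' Z \<and> T (fscale f X) Z = f * T X Z"
    proof (cases "Z \<in> VF")
      case True
      note form = two_form_one_form'[OF T this]
      show ?thesis
        using one_form_add[OF form assms(1,2)] one_form_fscale[OF form assms(4,1)] by simp
    next
      case False
      then have "T Y Z = 0" if "Y \<in> VF" for Y
        using one_form_outside[OF two_form_one_form[OF T that]] by simp
      then show ?thesis
        using assms vector_fields_plus vector_fields_fscale by simp
    qed
    then show "T (X + X') Z = (T X + T X') Z" "T (fscale f X) Z = fscale f (T X) Z"
      by (auto simp: fscale_apply)
  qed
  show "F (X + X') = F X + F X'" "F (fscale f X) = fscale f (F X)" using two[OF F] by auto
  show "H Y (X + X') = H Y X + H Y X'" "H Y (fscale f X) = fscale f (H Y X)"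
    using two[OF three_form_two_form[OF assms(3)]] by auto
  show "H (X + X') Y = H X Y + H X' Y" "H (fscale f X) Y = fscale f (H X Y)"
    using two[OF three_form_two_form'[OF assms(3)]] by auto
qed

lemma diff0_one_form:
  assumes f: "f \<in> R" shows "diff0 \<A> f \<in> one_forms \<A>"
  using f vector_field_smooth
  by (intro one_formI) (auto simp: diff0_def restrict_form_def vector_fields_plus vector_fields_fscale fscale_apply)

lemma lie_derivative_one_form:
  assumes X: "X \<in> VF" and \<eta>: "\<eta> \<in> one_forms \<A>"
  shows "lie_derivative \<A> X \<eta> \<in> one_forms \<A>"
proof (rule one_formI)
  note forms = one_form_smooth[OF \<eta>] one_form_add[OF \<eta>] one_form_fscale[OF \<eta>]
  show "lie_derivative \<A> X \<eta> Y \<in> R" if Y: "Y \<in> VF" for Y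
    using X Y forms by (simp add: lie_derivative_def restrict_form_def smooth_funs_diff
      vector_field_smooth lie_bracket_closed)
  show "lie_derivative \<A> X \<eta> (Y + Z) = lie_derivative \<A> X \<eta> Y + lie_derivative \<A> X \<eta> Z"
    if Y: "Y \<in> VF" and Z: "Z \<in> VF" for Y Z
    using X Y Z forms by (simp add: lie_derivative_def restrict_form_def vector_fields_plus
      lie_bracket_add_right lie_bracket_closed vector_field_add algebra_simps) (simp add: fun_eq_iff)
  show "lie_derivative \<A> X \<eta> (fscale f Y) = f * lie_derivative \<A> X \<eta> Y"
    if f: "f \<in> R" and Y: "Y \<in> VF" for f Y
    using X Y f forms by (simp add: lie_derivative_def restrict_form_def vector_fields_plus
      vector_fields_fscale lie_bracket_fscale_right lie_bracket_closed vector_field_mult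
      vector_field_smooth algebra_simps) (simp add: fun_eq_iff)
qed (simp add: lie_derivative_def restrict_form_def)

lemma diff1_one_form:
  assumes X: "X \<in> VF" and \<eta>: "\<eta> \<in> one_forms \<A>"
  shows "diff1 \<A> \<eta> X \<in> one_forms \<A>"
proof (rule one_formI)
  note forms = one_form_smooth[OF \<eta>] one_form_add[OF \<eta>] one_form_fscale[OF \<eta>]
  show "diff1 \<A> \<eta> X Y \<in> R" if Y: "Y \<in> VF" for Y
    using X Y forms by (simp add: diff1_def restrict_form_def smooth_funs_diff
      vector_field_smooth lie_bracket_closed)
  show "diff1 \<A> \<eta> X (Y + Z) = diff1 \<A> \<eta> X Y + diff1 \<A> \<eta> X Z"
    if Y: "Y \<in> VF" and Z: "Z \<in> VF" for Y Z
    using X Y Z forms by (simp add: diff1_def restrict_form_def vector_fields_plus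
      lie_bracket_add_right lie_bracket_closed vector_field_add algebra_simps) (simp add: fun_eq_iff)
  show "diff1 \<A> \<eta> X (fscale f Y) = f * diff1 \<A> \<eta> X Y"
    if f: "f \<in> R" and Y: "Y \<in> VF" for f Y
    using X Y f forms by (simp add: diff1_def restrict_form_def vector_fields_plus
      vector_fields_fscale lie_bracket_fscale_right lie_bracket_closed vector_field_mult
      vector_field_smooth fscale_apply algebra_simps) (simp add: fun_eq_iff)
qed (simp add: diff1_def restrict_form_def)

lemma dorfman_section:
  assumes "u \<in> \<Gamma>" "w \<in> \<Gamma>" shows "dorf u w \<in> \<Gamma>"
proof -
  obtain X \<xi> l where u: "u = (X, \<xi>, l)" by (rule prod_cases3)
  obtain Y \<eta> m where w: "w = (Y, \<eta>, m)" by (rule prod_cases3)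
  note eq = u w
  have mem: "X \<in> VF" "Y \<in> VF" "\<xi> \<in> one_forms \<A>" "\<eta> \<in> one_forms \<A>" "l \<in> R" "m \<in> R"
    using assms eq by (auto simp: sections_def)
  have forms: "H Y X \<in> one_forms \<A>" "F X \<in> one_forms \<A>" "F Y \<in> one_forms \<A>"
    using mem two_form_one_form[OF three_form_two_form] two_form_one_form[OF F] by auto
  have "2 * m \<in> R" "2 * l \<in> R" using mem by (auto intro: smooth_funs_mult smooth_funs_2)
  then have "lie_derivative \<A> X \<eta> - diff1 \<A> \<xi> Y + fscale (2 * m) (diff0 \<A> l) + H Y X
        - (fscale (2 * m) (F X) - fscale (2 * l) (F Y)) \<in> one_forms \<A>"
    using mem forms by (intro one_forms_diff one_forms_add lie_derivative_one_form diff1_one_form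
      one_forms_fscale diff0_one_form)
  moreover have "X m - Y l + F X Y \<in> R"
    using vector_field_smooth[OF mem(1,6)] vector_field_smooth[OF mem(2,5)] one_form_smooth[OF forms(2) mem(2)]
    by (simp add: smooth_funs_add smooth_funs_diff)
  ultimately show ?thesis
    using mem by (simp add: eq dorfman_def sections_def lie_bracket_closed)
qed

lemma anchor_dorfman: "anchor (dorf u w) = lie_bracket (anchor u) (anchor w)"
  by (auto simp: dorfman_def anchor_def split: prod.splits)

lemma dorfman_add_left:
  assumes "u \<in> \<Gamma>" "u' \<in> \<Gamma>" "w \<in> \<Gamma>" shows "dorf (u + u') w = dorf u w + dorf u' w"
proof -
  obtain X \<xi> l where u: "u = (X, \<xi>, l)" by (rule prod_cases3)
  obtain X' \<xi>' l' where u': "u' = (X', \<xi>', l')" by (rule prod_cases3)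
  obtain Y \<eta> m where w: "w = (Y, \<eta>, m)" by (rule prod_cases3)
  note eq = u u' w
  have mem: "X \<in> VF" "X' \<in> VF" "Y \<in> VF" "\<xi> \<in> one_forms \<A>" "\<xi>' \<in> one_forms \<A>" "\<eta> \<in> one_forms \<A>"
    "l \<in> R" "l' \<in> R" "m \<in> R"
    using assms eq by (auto simp: sections_def)
  note lin = form_linear[OF mem(1,2,3) mem(7)] lie_bracket_add_left[OF mem(1,2)] 
  have "lie_derivative \<A> (X + X') \<eta> = lie_derivative \<A> X \<eta> + lie_derivative \<A> X' \<eta>"
    by (auto simp: fun_eq_iff lie_derivative_def restrict_form_def lin one_form_add[OF mem(6)]
        lie_bracket_closed mem)
  moreover have "diff1 \<A> (\<xi> + \<xi>') Y = diff1 \<A> \<xi> Y + diff1 \<A> \<xi>' Y"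
    using mem by (auto simp: fun_eq_iff diff1_def restrict_form_def vector_field_add one_form_smooth)
  moreover have "diff0 \<A> (l + l') = diff0 \<A> l + diff0 \<A> l'"
    using mem by (auto simp: fun_eq_iff diff0_def restrict_form_def vector_field_add)
  ultimately show ?thesis
    using mem by (simp add: eq dorfman_def lin vector_field_add fscale_simps)
      (simp add: fun_eq_iff fscale_def algebra_simps)
qed

lemma dorfman_add_right:
  assumes "u \<in> \<Gamma>" "u' \<in> \<Gamma>" "w \<in> \<Gamma>" shows "dorf w (u + u') = dorf w u + dorf w u'"
proof -
  obtain X \<xi> l where u: "u = (X, \<xi>, l)" by (rule prod_cases3)
  obtain X' \<xi>' l' where u': "u' = (X', \<xi>', l')" by (rule prod_cases3)
  obtain Y \<eta> m where w: "w = (Y, \<eta>, m)" by (rule prod_cases3)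
  note eq = u u' w
  have mem: "X \<in> VF" "X' \<in> VF" "Y \<in> VF" "\<xi> \<in> one_forms \<A>" "\<xi>' \<in> one_forms \<A>" "\<eta> \<in> one_forms \<A>"
    "l \<in> R" "l' \<in> R" "m \<in> R"
    using assms eq by (auto simp: sections_def)
  note lin = form_linear[OF mem(1,2,3) mem(7)] lie_bracket_add_left[OF mem(1,2)] lie_bracket_add_right[OF mem(1,2)]
  have "lie_derivative \<A> Y (\<xi> + \<xi>') = lie_derivative \<A> Y \<xi> + lie_derivative \<A> Y \<xi>'"
    using mem by (auto simp: fun_eq_iff lie_derivative_def restrict_form_def vector_field_add one_form_smooth)
  moreover have "diff1 \<A> \<eta> (X + X') = diff1 \<A> \<eta> X + diff1 \<A> \<eta> X'"
    using mem by (auto simp: fun_eq_iff diff1_def restrict_form_def vector_field_add one_form_smooth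
        lin one_form_add[OF mem(6)] lie_bracket_closed)
  ultimately show ?thesis
    using mem two_form_one_form[OF F mem(3)]
    by (simp add: eq dorfman_def lin vector_field_add fscale_simps one_form_add)
      (simp add: fun_eq_iff fscale_def algebra_simps)
qed

lemma dorfman_sscale_right:
  assumes f: "f \<in> R" and "u \<in> \<Gamma>" "w \<in> \<Gamma>"
  shows "dorf u (sscale f w) = sscale f (dorf u w) + sscale (anchor u f) w"
proof -
  obtain X \<xi> l where u: "u = (X, \<xi>, l)" by (rule prod_cases3)
  obtain Y \<eta> m where w: "w = (Y, \<eta>, m)" by (rule prod_cases3)
  note eq = u w
  have mem: "X \<in> VF" "Y \<in> VF" "\<xi> \<in> one_forms \<A>" "\<eta> \<in> one_forms \<A>" "l \<in> R" "m \<in> R"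
    using assms eq by (auto simp: sections_def)
  note lin = form_linear[OF mem(2) mem(2) mem(1) f]
  have "lie_derivative \<A> X (fscale f \<eta>) = fscale f (lie_derivative \<A> X \<eta>) + fscale (X f) \<eta>"
  proof
    fix Z show "lie_derivative \<A> X (fscale f \<eta>) Z = (fscale f (lie_derivative \<A> X \<eta>) + fscale (X f) \<eta>) Z"
      using mem f by (cases "Z \<in> VF"; simp add: lie_derivative_def restrict_form_def vector_field_mult one_form_smooth
          one_form_outside fscale_apply; simp add: fun_eq_iff algebra_simps)
  qed
  moreover have "diff1 \<A> \<xi> (fscale f Y) = fscale f (diff1 \<A> \<xi> Y)"
  proof
    fix Z show "diff1 \<A> \<xi> (fscale f Y) Z = fscale f (diff1 \<A> \<xi> Y) Z"
    proof (cases "Z \<in> VF")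
      case True
      have "Z (\<xi> (fscale f Y)) = f * Z (\<xi> Y) + Z f * \<xi> Y"
        using vector_field_mult[OF True f one_form_smooth[OF mem(3,2)]] one_form_fscale[OF mem(3) f mem(2)]
        by simp
      moreover have "\<xi> (lie_bracket (fscale f Y) Z) = f * \<xi> (lie_bracket Y Z) - Z f * \<xi> Y"
        using mem f True
        by (simp add: lie_bracket_fscale_left one_form_diff one_form_fscale lie_bracket_closed
            vector_fields_fscale vector_field_smooth) (simp add: fun_eq_iff)
      ultimately show ?thesis
        using True by (simp add: diff1_def restrict_form_def fscale_apply right_diff_distrib)
    qed (simp add: diff1_def restrict_form_def fscale_apply)
  qed
  ultimately show ?thesis
    using mem f two_form_one_form[OF F mem(1)] lie_bracket_fscale_right[OF mem(1,2) f]
    by (simp add: eq dorfman_def sscale_def lin vector_field_mult fscale_simps one_form_fscale)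
      (simp add: fun_eq_iff fscale_def algebra_simps)
qed

text \<open>The bracket is not skew: the last term is the derivative of \<open>f\<close> times \<open>2\<langle>u, w\<rangle>\<close>. It disappears for
  orthogonal \<open>u\<close> and \<open>w\<close>, which is what makes the two Ricci curvatures tensors.\<close>

lemma dorfman_sscale_left:
  assumes f: "f \<in> R" and "u \<in> \<Gamma>" "w \<in> \<Gamma>"
  shows "dorf (sscale f u) w =
    sscale f (dorf u w) - sscale (anchor w f) u + sscale (2 * pairing u w) (0, diff0 \<A> f, 0)"
proof -
  obtain X \<xi> l where u: "u = (X, \<xi>, l)" by (rule prod_cases3)
  obtain Y \<eta> m where w: "w = (Y, \<eta>, m)" by (rule prod_cases3)
  note eq = u w
  have mem: "X \<in> VF" "Y \<in> VF" "\<xi> \<in> one_forms \<A>" "\<eta> \<in> one_forms \<A>" "l \<in> R" "m \<in> R"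
    using assms eq by (auto simp: sections_def)
  note lin = form_linear[OF mem(1) mem(1) mem(2) f]
  have dbl: "2 * pairing u w = \<xi> Y + \<eta> X + 2 * l * m"
    by (simp add: eq pairing_def fun_eq_iff cst_def)
  \<comment> \<open>The terms with \<open>df\<close> in these three equations add up to the last term of the claim.\<close>
  have "lie_derivative \<A> (fscale f X) \<eta> = fscale f (lie_derivative \<A> X \<eta>) + fscale (\<eta> X) (diff0 \<A> f)"
  proof
    fix Z show "lie_derivative \<A> (fscale f X) \<eta> Z = (fscale f (lie_derivative \<A> X \<eta>) + fscale (\<eta> X) (diff0 \<A> f)) Z"
      using mem f by (cases "Z \<in> VF"; simp add: lie_derivative_def diff0_def restrict_form_def one_form_fscale one_form_diff
          lie_bracket_fscale_left lie_bracket_closed vector_fields_fscale vector_field_smooth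
          fscale_apply; simp add: fun_eq_iff algebra_simps)
  qed
  moreover have "diff1 \<A> (fscale f \<xi>) Y = fscale f (diff1 \<A> \<xi> Y) + fscale (Y f) \<xi> - fscale (\<xi> Y) (diff0 \<A> f)"
  proof
    fix Z show "diff1 \<A> (fscale f \<xi>) Y Z = (fscale f (diff1 \<A> \<xi> Y) + fscale (Y f) \<xi> - fscale (\<xi> Y) (diff0 \<A> f)) Z"
      using mem f by (cases "Z \<in> VF"; simp add: diff1_def diff0_def restrict_form_def vector_field_mult one_form_smooth
          one_form_outside fscale_apply; simp add: fun_eq_iff algebra_simps)
  qed
  moreover have "diff0 \<A> (f * l) = fscale f (diff0 \<A> l) + fscale l (diff0 \<A> f)"
  proof
    fix Z show "diff0 \<A> (f * l) Z = (fscale f (diff0 \<A> l) + fscale l (diff0 \<A> f)) Z"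
      using mem f by (cases "Z \<in> VF"; simp add: diff0_def restrict_form_def vector_field_mult fscale_apply;
        simp add: fun_eq_iff algebra_simps)
  qed
  ultimately show ?thesis
    unfolding dbl
    using mem f lie_bracket_fscale_left[OF mem(1,2) f]
    by (simp add: eq dorfman_def sscale_def lin vector_field_mult fscale_simps fscale_apply)
      (simp add: fun_eq_iff fscale_def algebra_simps)
qed

lemma pairing_differential:
  assumes f: "f \<in> R" and "w \<in> \<Gamma>"
  shows "(0, diff0 \<A> f, 0) \<in> \<Gamma>" "2 * pairing (0, diff0 \<A> f, 0) w = anchor w f"
proof -
  show "(0, diff0 \<A> f, 0) \<in> \<Gamma>"
    using diff0_one_form[OF f] by (auto simp: sections_def vector_fields_0 smooth_funs_0)
  obtain Y \<eta> m where eq: "w = (Y, \<eta>, m)" by (rule prod_cases3)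
  have mem: "Y \<in> VF" "\<eta> \<in> one_forms \<A>" using assms eq by (auto simp: sections_def)
  have "\<eta> 0 = 0" using one_form_add[OF mem(2) vector_fields_0 vector_fields_0] by (simp add: fun_eq_iff)
  then show "2 * pairing (0, diff0 \<A> f, 0) w = anchor w f"
    using mem by (simp add: eq pairing_def diff0_def restrict_form_def anchor_def fun_eq_iff cst_def)
qed

end

section \<open>Frames, traces and tensoriality\<close>

lemma linear_on_frame_sum:
  assumes N: "0 \<in> N" "\<And>u v. u \<in> N \<Longrightarrow> v \<in> N \<Longrightarrow> u + v \<in> N" "\<And>f u. f \<in> S \<Longrightarrow> u \<in> N \<Longrightarrow> sscale f u \<in> N"
    and \<beta>: "\<And>u v. u \<in> N \<Longrightarrow> v \<in> N \<Longrightarrow> \<beta> (u + v) = \<beta> u + \<beta> v" 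
      "\<And>f u. f \<in> S \<Longrightarrow> u \<in> N \<Longrightarrow> \<beta> (sscale f u) = (f * \<beta> u :: 'g scal)"
    and I: "\<And>i. i \<in> I \<Longrightarrow> k i \<in> S" "\<And>i. i \<in> I \<Longrightarrow> b i \<in> N"
  shows "\<beta> (\<Sum>i\<in>I. sscale (k i) (b i)) = (\<Sum>i\<in>I. k i * \<beta> (b i))"
proof -
  have z: "\<beta> 0 = 0" using \<beta>(1)[OF N(1) N(1)] by (simp add: fun_eq_iff)
  have "(\<Sum>i\<in>I. sscale (k i) (b i)) \<in> N \<and> \<beta> (\<Sum>i\<in>I. sscale (k i) (b i)) = (\<Sum>i\<in>I. k i * \<beta> (b i))"
    using I
  proof (induction I rule: infinite_finite_induct)
    case (insert j I)
    then show ?case by (simp add: N \<beta>)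
  qed (simp_all add: N z)
  then show ?thesis ..
qed

lemma endomorphism_on_frame_sum:
  assumes N: "0 \<in> N" "\<And>u v. u \<in> N \<Longrightarrow> v \<in> N \<Longrightarrow> u + v \<in> N" "\<And>f u. f \<in> S \<Longrightarrow> u \<in> N \<Longrightarrow> sscale f u \<in> N"
    and \<Phi>: "\<And>u v. u \<in> N \<Longrightarrow> v \<in> N \<Longrightarrow> \<Phi> (u + v) = \<Phi> u + \<Phi> v" 
      "\<And>f u. f \<in> S \<Longrightarrow> u \<in> N \<Longrightarrow> \<Phi> (sscale f u) = (sscale f (\<Phi> u) :: 'g sect)"
    and I: "\<And>i. i \<in> I \<Longrightarrow> k i \<in> S" "\<And>i. i \<in> I \<Longrightarrow> b i \<in> N"
  shows "\<Phi> (\<Sum>i\<in>I. sscale (k i) (b i)) = (\<Sum>i\<in>I. sscale (k i) (\<Phi> (b i)))"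
proof -
  have z: "\<Phi> 0 = 0" using \<Phi>(1)[OF N(1) N(1)] by (metis add_cancel_right_right add.right_neutral)
  have "(\<Sum>i\<in>I. sscale (k i) (b i)) \<in> N \<and> \<Phi> (\<Sum>i\<in>I. sscale (k i) (b i)) = (\<Sum>i\<in>I. sscale (k i) (\<Phi> (b i)))"
    using I
  proof (induction I rule: infinite_finite_induct)
    case (insert j I)
    then show ?case by (simp add: N \<Phi>)
  qed (simp_all add: N z)
  then show ?thesis ..
qed

text \<open>The trace is the same in all frames: expand \<open>b' j\<close> in the frame \<open>b\<close> and \<open>\<Phi> (b i)\<close> in the frame
  \<open>b'\<close>, and exchange the sums. This also covers frames of different lengths, so that the definite
  description in \<^const>\<open>bundle_trace\<close> is proper.\<close>

lemma bundle_trace_eq: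
  assumes frame: "dual_frames \<A> N k b \<beta>"
    and N: "0 \<in> N" "\<And>u v. u \<in> N \<Longrightarrow> v \<in> N \<Longrightarrow> u + v \<in> N"
      "\<And>f u. f \<in> smooth_funs \<A> \<Longrightarrow> u \<in> N \<Longrightarrow> sscale f u \<in> N"
    and \<Phi>: "\<And>u. u \<in> N \<Longrightarrow> \<Phi> u \<in> N" "\<And>u v. u \<in> N \<Longrightarrow> v \<in> N \<Longrightarrow> \<Phi> (u + v) = \<Phi> u + \<Phi> v"
      "\<And>f u. f \<in> smooth_funs \<A> \<Longrightarrow> u \<in> N \<Longrightarrow> \<Phi> (sscale f u) = sscale f (\<Phi> u)"
  shows "bundle_trace \<A> N \<Phi> = (\<Sum>i<k. \<beta> i (\<Phi> (b i)))"
  unfolding bundle_trace_def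
proof (rule the_equality)
  show "\<exists>k' b' \<beta>'. dual_frames \<A> N k' b' \<beta>' \<and> (\<Sum>i<k. \<beta> i (\<Phi> (b i))) = (\<Sum>i<k'. \<beta>' i (\<Phi> (b' i)))"
    using frame by blast
next
  fix t assume "\<exists>k' b' \<beta>'. dual_frames \<A> N k' b' \<beta>' \<and> t = (\<Sum>i<k'. \<beta>' i (\<Phi> (b' i)))"
  then obtain k' b' \<beta>' where frame': "dual_frames \<A> N k' b' \<beta>'" and t: "t = (\<Sum>j<k'. \<beta>' j (\<Phi> (b' j)))"
    by blast
  have dual: "b i \<in> N" "w \<in> N \<Longrightarrow> \<beta> i w \<in> smooth_funs \<A>"
      "w \<in> N \<Longrightarrow> w' \<in> N \<Longrightarrow> \<beta> i (w + w') = \<beta> i w + \<beta> i w'"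
      "f \<in> smooth_funs \<A> \<Longrightarrow> w \<in> N \<Longrightarrow> \<beta> i (sscale f w) = f * \<beta> i w"
      "w \<in> N \<Longrightarrow> w = (\<Sum>i<k. sscale (\<beta> i w) (b i))"
    if "i < k" for i w w' f
    using frame that unfolding dual_frames_def by blast+
  have dual': "b' i \<in> N" "w \<in> N \<Longrightarrow> \<beta>' i w \<in> smooth_funs \<A>"
      "w \<in> N \<Longrightarrow> w' \<in> N \<Longrightarrow> \<beta>' i (w + w') = \<beta>' i w + \<beta>' i w'"
      "f \<in> smooth_funs \<A> \<Longrightarrow> w \<in> N \<Longrightarrow> \<beta>' i (sscale f w) = f * \<beta>' i w"
    if "i < k'" for i w w' f
    using frame' that unfolding dual_frames_def by blast+
  have expand: "w = (\<Sum>i<k. sscale (\<beta> i w) (b i))" "w = (\<Sum>j<k'. sscale (\<beta>' j w) (b' j))" if "w \<in> N" for w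
    using frame frame' that unfolding dual_frames_def by blast+
  have "\<beta>' j (\<Phi> (b' j)) = (\<Sum>i<k. \<beta> i (b' j) * \<beta>' j (\<Phi> (b i)))" if j: "j < k'" for j
  proof -
    have "\<Phi> (b' j) = \<Phi> (\<Sum>i<k. sscale (\<beta> i (b' j)) (b i))"
      using expand(1)[OF dual'(1)[OF j]] by simp
    also have "\<dots> = (\<Sum>i<k. sscale (\<beta> i (b' j)) (\<Phi> (b i)))"
      by (rule endomorphism_on_frame_sum[OF N \<Phi>(2,3)]) (auto simp: dual dual'(1)[OF j])
    also have "\<beta>' j \<dots> = (\<Sum>i<k. \<beta> i (b' j) * \<beta>' j (\<Phi> (b i)))"
      by (rule linear_on_frame_sum[OF N dual'(3,4)[OF j]]) (auto simp: dual dual'(1)[OF j] \<Phi>)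
    finally show ?thesis .
  qed
  then have "t = (\<Sum>i<k. \<Sum>j<k'. \<beta> i (b' j) * \<beta>' j (\<Phi> (b i)))"
    unfolding t by (subst sum.swap) simp
  also have "\<dots> = (\<Sum>i<k. \<beta> i (\<Phi> (b i)))"
  proof (rule sum.cong[OF refl])
    fix i assume "i \<in> {..<k}" then have i: "i < k" by simp
    have "\<beta> i (\<Phi> (b i)) = \<beta> i (\<Sum>j<k'. sscale (\<beta>' j (\<Phi> (b i))) (b' j))"
      using expand(2)[OF \<Phi>(1)[OF dual(1)[OF i]]] by simp
    also have "\<dots> = (\<Sum>j<k'. \<beta>' j (\<Phi> (b i)) * \<beta> i (b' j))"
      by (rule linear_on_frame_sum[OF N dual(3,4)[OF i]]) (auto simp: dual'(1,2) dual(1)[OF i] \<Phi>)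
    finally show "(\<Sum>j<k'. \<beta> i (b' j) * \<beta>' j (\<Phi> (b i))) = \<beta> i (\<Phi> (b i))"
      by (simp add: mult.commute)
  qed
  finally show "t = (\<Sum>i<k. \<beta> i (\<Phi> (b i)))" .
qed

text \<open>The Ricci curvature at \<open>(e\<^sub>i, e\<^sub>b)\<close>, with the trace over the block \<open>P\<close>, in terms of the structure
  constants and the divergence \<open>d\<close>. Exchanging \<open>P\<close> and \<open>Q\<close> turns one of the two Ricci curvatures
  into the other.\<close>

definition ricci_form ::
    "(nat \<Rightarrow> real) \<Rightarrow> (nat \<Rightarrow> nat \<Rightarrow> nat \<Rightarrow> real) \<Rightarrow> (nat \<Rightarrow> real) \<Rightarrow> nat set \<Rightarrow> nat set \<Rightarrow> nat \<Rightarrow> nat \<Rightarrow> real" where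
  "ricci_form \<eta> B d P Q i b =
     (\<Sum>c\<in>P. \<eta> c * B i b c * d c) - (\<Sum>a\<in>P. \<Sum>j\<in>Q. \<eta> a * \<eta> j * B a i j * B j b a)"

text \<open>A global orthonormal frame with constant structure constants. The expansion is assumed in the form
  that defines the coordinates of a section by the scalar product.\<close>

locale courant_frame = courant_algebroid +
  fixes n :: nat and e :: "nat \<Rightarrow> 'a sect" and \<eta> :: "nat \<Rightarrow> real" and B :: "nat \<Rightarrow> nat \<Rightarrow> nat \<Rightarrow> real"
  assumes frame_section: "A < n \<Longrightarrow> e A \<in> sections \<A>"
    and pairing_frame: "A < n \<Longrightarrow> C < n \<Longrightarrow> pairing (e A) (e C) = cst (if A = C then \<eta> A else 0)"
    and \<eta>_square: "A < n \<Longrightarrow> \<eta> A * \<eta> A = 1"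
    and expansion: "u \<in> sections \<A> \<Longrightarrow> u = (\<Sum>A<n. sscale (cst (\<eta> A) * pairing u (e A)) (e A))"
    and structure_constants: "A < n \<Longrightarrow> C < n \<Longrightarrow> K < n \<Longrightarrow>
      pairing (dorfman \<A> H F (e A) (e C)) (e K) = cst (B A C K)"
    and B_skew12: "A < n \<Longrightarrow> C < n \<Longrightarrow> K < n \<Longrightarrow> B C A K = - B A C K"
    and B_skew23: "A < n \<Longrightarrow> C < n \<Longrightarrow> K < n \<Longrightarrow> B A K C = - B A C K"
begin

definition coord :: "nat \<Rightarrow> 'a sect \<Rightarrow> 'a scal" where
  "coord A u = cst (\<eta> A) * pairing u (e A)"

lemma coord_smooth: "A < n \<Longrightarrow> u \<in> \<Gamma> \<Longrightarrow> coord A u \<in> R"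
  by (simp add: coord_def smooth_funs_mult smooth_funs_cst pairing_smooth frame_section)

lemma coord_add: "A < n \<Longrightarrow> u \<in> \<Gamma> \<Longrightarrow> w \<in> \<Gamma> \<Longrightarrow> coord A (u + w) = coord A u + coord A w"
  by (simp add: coord_def pairing_add_left frame_section distrib_left)

lemma coord_sscale: "A < n \<Longrightarrow> f \<in> R \<Longrightarrow> u \<in> \<Gamma> \<Longrightarrow> coord A (sscale f u) = f * coord A u"
  by (simp add: coord_def pairing_sscale_left frame_section mult.left_commute)

lemma coord_frame: "A < n \<Longrightarrow> C < n \<Longrightarrow> coord A (e C) = cst (if A = C then 1 else 0)"
  by (simp add: coord_def pairing_frame cst_mult \<eta>_square)

text \<open>The span of the frame vectors with index in \<open>S\<close>, described as an orthogonal complement; this is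
  how \<open>E\<^sub>+\<close> is given.\<close>

definition subbundle :: "nat set \<Rightarrow> 'a sect set" where
  "subbundle S = {u \<in> \<Gamma>. \<forall>A<n. A \<notin> S \<longrightarrow> pairing u (e A) = 0}"

lemma subbundle_all: "subbundle {..<n} = \<Gamma>"
  by (auto simp: subbundle_def)

lemma subbundle_section: "u \<in> subbundle S \<Longrightarrow> u \<in> \<Gamma>"
  by (simp add: subbundle_def)

lemma subbundle_0: "0 \<in> subbundle S"
  and subbundle_add: "u \<in> subbundle S \<Longrightarrow> w \<in> subbundle S \<Longrightarrow> u + w \<in> subbundle S"
  and subbundle_diff: "u \<in> subbundle S \<Longrightarrow> w \<in> subbundle S \<Longrightarrow> u - w \<in> subbundle S"
  and subbundle_sscale: "f \<in> R \<Longrightarrow> u \<in> subbundle S \<Longrightarrow> sscale f u \<in> subbundle S"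
  by (auto simp: subbundle_def sections_0 sections_add sections_diff sections_sscale pairing_0_left
      pairing_add_left pairing_diff_left pairing_sscale_left frame_section)

lemma frame_subbundle: "A \<in> S \<Longrightarrow> A < n \<Longrightarrow> e A \<in> subbundle S"
  by (auto simp: subbundle_def frame_section pairing_frame cst_0)

lemma subbundle_expansion:
  assumes S: "S \<subseteq> {..<n}" and u: "u \<in> subbundle S"
  shows "u = (\<Sum>A\<in>S. sscale (coord A u) (e A))"
proof -
  have "u = (\<Sum>A<n. sscale (coord A u) (e A))"
    using expansion[OF subbundle_section[OF u]] unfolding coord_def .
  also have "\<dots> = (\<Sum>A\<in>S. sscale (coord A u) (e A))"
  proof (rule sum.mono_neutral_right)
    show "\<forall>A\<in>{..<n} - S. sscale (coord A u) (e A) = 0"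
      using u by (auto simp: subbundle_def coord_def sscale_simps)
  qed (use S in auto)
  finally show ?thesis .
qed

text \<open>This is how tensors are compared below: a linear expression in a section is determined by its
  values on the frame.\<close>

lemma linear_on_subbundle:
  assumes S: "S \<subseteq> {..<n}" and u: "u \<in> subbundle S"
    and T: "\<And>u w. u \<in> subbundle S \<Longrightarrow> w \<in> subbundle S \<Longrightarrow> T (u + w) = T u + T w" 
      "\<And>f u. f \<in> R \<Longrightarrow> u \<in> subbundle S \<Longrightarrow> T (sscale f u) = (f * T u :: 'a scal)"
  shows "T u = (\<Sum>A\<in>S. coord A u * T (e A))"
proof -
  have "T u = T (\<Sum>A\<in>S. sscale (coord A u) (e A))" using subbundle_expansion[OF S u] by simp
  also have "\<dots> = (\<Sum>A\<in>S. coord A u * T (e A))"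
    using S u by (intro linear_on_frame_sum[of "subbundle S" R])
      (auto simp: subbundle_0 subbundle_add subbundle_sscale T intro!: coord_smooth subbundle_section[of u S] frame_subbundle)
  finally show ?thesis .
qed

lemma linear_on_sections:
  assumes u: "u \<in> \<Gamma>"
    and T: "\<And>u w. u \<in> \<Gamma> \<Longrightarrow> w \<in> \<Gamma> \<Longrightarrow> T (u + w) = T u + T w" 
      "\<And>f u. f \<in> R \<Longrightarrow> u \<in> \<Gamma> \<Longrightarrow> T (sscale f u) = (f * T u :: 'a scal)"
  shows "T u = (\<Sum>A<n. coord A u * T (e A))"
  using linear_on_subbundle[of "{..<n}" u T] assms by (simp add: subbundle_all)

lemma pairing_parseval:
  assumes "u \<in> \<Gamma>" "w \<in> \<Gamma>"
  shows "pairing u w = (\<Sum>A<n. cst (\<eta> A) * pairing u (e A) * pairing w (e A))"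
proof -
  have "pairing u w = (\<Sum>A<n. coord A u * pairing (e A) w)"
    by (rule linear_on_sections[OF assms(1)]) (auto simp: pairing_add_left pairing_sscale_left assms)
  then show ?thesis by (simp add: coord_def pairing_commute[of w])
qed

lemma pairing_disjoint_subbundles:
  assumes "P \<inter> Q = {}" "u \<in> subbundle P" "w \<in> subbundle Q"
  shows "pairing u w = 0"
proof -
  have "pairing u (e A) = 0 \<or> pairing w (e A) = 0" if "A < n" for A
    using assms that unfolding subbundle_def by blast
  then have z: "cst (\<eta> A) * pairing u (e A) * pairing w (e A) = 0" if "A < n" for A
    using that by (metis mult_zero_left mult_zero_right)
  show ?thesis
    unfolding pairing_parseval[OF subbundle_section[OF assms(2)] subbundle_section[OF assms(3)]]
    by (rule sum.neutral) (use z in auto)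
qed

lemma section_eqI:
  assumes "u \<in> \<Gamma>" "w \<in> \<Gamma>" "\<And>A. A < n \<Longrightarrow> pairing u (e A) = pairing w (e A)"
  shows "u = w"
  using expansion[OF assms(1)] expansion[OF assms(2)] assms(3) by (metis (no_types, lifting) lessThan_iff sum.cong)

lemma trace_subbundle:
  assumes S: "S \<subseteq> {..<n}"
    and \<Phi>: "\<And>u. u \<in> subbundle S \<Longrightarrow> \<Phi> u \<in> subbundle S" "\<And>u w. u \<in> subbundle S \<Longrightarrow> w \<in> subbundle S \<Longrightarrow> \<Phi> (u + w) = \<Phi> u + \<Phi> w"
      "\<And>f u. f \<in> R \<Longrightarrow> u \<in> subbundle S \<Longrightarrow> \<Phi> (sscale f u) = sscale f (\<Phi> u)"
  shows "bundle_trace \<A> (subbundle S) \<Phi> = (\<Sum>A\<in>S. coord A (\<Phi> (e A)))"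
proof -
  have "finite S" using S finite_subset by blast
  then obtain p where p: "bij_betw p {..<card S} S"
    using ex_bij_betw_nat_finite lessThan_atLeast0 by metis
  have pS: "p i \<in> S" "p i < n" if "i < card S" for i
    using p S that by (auto simp: bij_betw_def)
  have inj: "p i = p j \<longleftrightarrow> i = j" if "i < card S" "j < card S" for i j
    using p that by (auto simp: bij_betw_def inj_on_def)
  have "w = (\<Sum>i<card S. sscale (coord (p i) w) (e (p i)))" if "w \<in> subbundle S" for w
    using subbundle_expansion[OF S that] sum.reindex_bij_betw[OF p, of "\<lambda>A. sscale (coord A w) (e A)"] by simp
  then have "dual_frames \<A> (subbundle S) (card S) (\<lambda>i. e (p i)) (\<lambda>i. coord (p i))"
    unfolding dual_frames_def using pS inj
    by (auto simp: frame_subbundle coord_smooth coord_add coord_sscale coord_frame subbundle_section)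
  from bundle_trace_eq[OF this subbundle_0 subbundle_add subbundle_sscale \<Phi>]
  have "bundle_trace \<A> (subbundle S) \<Phi> = (\<Sum>i<card S. coord (p i) (\<Phi> (e (p i))))" by blast
  then show ?thesis
    using sum.reindex_bij_betw[OF p, of "\<lambda>A. coord A (\<Phi> (e A))"] by simp
qed

end

locale framed_connection = courant_frame +
  fixes D :: "'a sect \<Rightarrow> 'a sect \<Rightarrow> 'a sect"
  assumes connection: "generalized_connection \<A> D"
begin

lemma D_section: "u \<in> \<Gamma> \<Longrightarrow> w \<in> \<Gamma> \<Longrightarrow> D u w \<in> \<Gamma>"
  and D_add_left: "u \<in> \<Gamma> \<Longrightarrow> u' \<in> \<Gamma> \<Longrightarrow> w \<in> \<Gamma> \<Longrightarrow> D (u + u') w = D u w + D u' w"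
  and D_sscale_left: "f \<in> R \<Longrightarrow> u \<in> \<Gamma> \<Longrightarrow> w \<in> \<Gamma> \<Longrightarrow> D (sscale f u) w = sscale f (D u w)"
  and D_add_right: "u \<in> \<Gamma> \<Longrightarrow> w \<in> \<Gamma> \<Longrightarrow> w' \<in> \<Gamma> \<Longrightarrow> D u (w + w') = D u w + D u w'"
  and D_sscale_right: "f \<in> R \<Longrightarrow> u \<in> \<Gamma> \<Longrightarrow> w \<in> \<Gamma> \<Longrightarrow>
    D u (sscale f w) = sscale (anchor u f) w + sscale f (D u w)"
  and D_metric: "u \<in> \<Gamma> \<Longrightarrow> w \<in> \<Gamma> \<Longrightarrow> w' \<in> \<Gamma> \<Longrightarrow>
    anchor u (pairing w w') = pairing (D u w) w' + pairing w (D u w')"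
  using connection unfolding generalized_connection_def by blast+

lemma D_diff_left: "u \<in> \<Gamma> \<Longrightarrow> u' \<in> \<Gamma> \<Longrightarrow> w \<in> \<Gamma> \<Longrightarrow> D (u - u') w = D u w - D u' w"
  using D_add_left[of "u - u'" u' w] sections_diff[of u u'] by (simp add: algebra_simps)

abbreviation curv where "curv \<equiv> curvature \<A> H F D"

lemma anchor_smooth: "u \<in> \<Gamma> \<Longrightarrow> f \<in> R \<Longrightarrow> anchor u f \<in> R"
  using vector_field_smooth[OF anchor_vector_field] by blast

lemma curvature_section: "u \<in> \<Gamma> \<Longrightarrow> w \<in> \<Gamma> \<Longrightarrow> x \<in> \<Gamma> \<Longrightarrow> curv u w x \<in> \<Gamma>"
  unfolding curvature_def by (intro sections_diff D_section dorfman_section)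

lemma curvature_add:
  assumes "u \<in> \<Gamma>" "u' \<in> \<Gamma>" "w \<in> \<Gamma>" "x \<in> \<Gamma>"
  shows "curv (u + u') w x = curv u w x + curv u' w x"
    "curv w (u + u') x = curv w u x + curv w u' x"
    "curv w x (u + u') = curv w x u + curv w x u'"
  using assms unfolding curvature_def
  by (simp_all add: D_section D_add_left D_add_right dorfman_add_left dorfman_add_right dorfman_section)

text \<open>For fixed \<open>w\<close> and \<open>x\<close> the curvature is tensorial in \<open>u\<close> only where \<open>u\<close> and \<open>w\<close> are orthogonal; the
  traces in the Ricci curvatures are of this kind, with \<open>u\<close> in one of \<open>E\<^sub>+\<close>, \<open>E\<^sub>-\<close> and \<open>w\<close> in the
  other.\<close>

lemma curvature_sscale_left:
  assumes "f \<in> R" "u \<in> \<Gamma>" "w \<in> \<Gamma>" "x \<in> \<Gamma>" and orth: "pairing u w = 0"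
  shows "curv (sscale f u) w x = sscale f (curv u w x)"
proof -
  have "dorf (sscale f u) w = sscale f (dorf u w) - sscale (anchor w f) u"
    using dorfman_sscale_left[OF assms(1-3)] orth by (simp add: sscale_simps)
  then show ?thesis
    using assms unfolding curvature_def
    by (simp add: D_section D_sscale_left D_sscale_right D_diff_left dorfman_section sections_sscale
        anchor_smooth sscale_simps)
qed

lemma curvature_sscale_middle:
  assumes "f \<in> R" "u \<in> \<Gamma>" "w \<in> \<Gamma>" "x \<in> \<Gamma>"
  shows "curv u (sscale f w) x = sscale f (curv u w x)"
  using assms unfolding curvature_def
  by (simp add: dorfman_sscale_right D_section D_sscale_left D_sscale_right D_add_left dorfman_section
      sections_sscale anchor_smooth sscale_simps)

lemma curvature_sscale_right:
  assumes f: "f \<in> R" and uwx: "u \<in> \<Gamma>" "w \<in> \<Gamma>" "x \<in> \<Gamma>"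
  shows "curv u w (sscale f x) = sscale f (curv u w x)"
proof -
  have *: "D u (D w (sscale f x)) = sscale (anchor u (anchor w f)) x + sscale (anchor w f) (D u x)
      + (sscale (anchor u f) (D w x) + sscale f (D u (D w x)))" if "u \<in> \<Gamma>" "w \<in> \<Gamma>" for u w
    using that f uwx by (simp add: D_section D_sscale_right D_add_right sections_sscale anchor_smooth)
  \<comment> \<open>The anchor maps the Dorfman bracket to the commutator, so the second derivatives of \<open>f\<close>
    cancel.\<close>
  have "D (dorf u w) (sscale f x) =
      sscale (anchor u (anchor w f) - anchor w (anchor u f)) x + sscale f (D (dorf u w) x)"
    using f uwx by (simp add: D_sscale_right dorfman_section anchor_dorfman lie_bracket_def)
  then show ?thesis
    unfolding curvature_def *[OF uwx(1,2)] *[OF uwx(2,1)] by (simp add: sscale_simps)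
qed

abbreviation tors where "tors \<equiv> torsion \<A> H F D"

lemma torsion_add:
  assumes "u \<in> \<Gamma>" "u' \<in> \<Gamma>" "w \<in> \<Gamma>" "x \<in> \<Gamma>"
  shows "tors (u + u') w x = tors u w x + tors u' w x"
    "tors w (u + u') x = tors w u x + tors w u' x"
    "tors w x (u + u') = tors w x u + tors w x u'"
  using assms unfolding torsion_def
  by (simp_all add: D_section D_add_left D_add_right dorfman_add_left dorfman_add_right dorfman_section
     sections_diff sections_add pairing_add_left pairing_add_right pairing_diff_left)

text \<open>In the first slot, the defect of the Dorfman bracket cancels against the derivative of \<open>f\<close> that
  comes from \<open>D\<^sub>x (f u)\<close>; this is the reason for the last term in the definition of the torsion.\<close>

lemma torsion_sscale:
  assumes f: "f \<in> R" and uwx: "u \<in> \<Gamma>" "w \<in> \<Gamma>" "x \<in> \<Gamma>"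
  shows "tors (sscale f u) w x = f * tors u w x"
    "tors u (sscale f w) x = f * tors u w x"
    "tors u w (sscale f x) = f * tors u w x"
proof -
  have smooth: "anchor u f \<in> R" "anchor w f \<in> R" "anchor x f \<in> R" "2 * pairing u w \<in> R"
    using assms by (auto simp: anchor_smooth smooth_funs_mult smooth_funs_2 pairing_smooth)
  have diff: "pairing (0, diff0 \<A> f, 0) x * 2 = anchor x f" "(0, diff0 \<A> f, 0) \<in> \<Gamma>"
    using pairing_differential[OF f uwx(3)] by (auto simp: mult.commute)
  have "pairing (sscale (2 * pairing u w) (0, diff0 \<A> f, 0)) x = pairing u w * anchor x f"
    using diff by (simp add: pairing_sscale_left smooth uwx flip: diff(1))
  then show "tors (sscale f u) w x = f * tors u w x"
    using assms smooth diff(2) unfolding torsion_def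
    by (simp add: D_section D_sscale_left D_sscale_right dorfman_sscale_left dorfman_section
     sections_diff sections_add sections_sscale pairing_add_left pairing_add_right pairing_diff_left
     pairing_sscale_left pairing_sscale_right)
     (simp add: pairing_commute[of w u] fun_eq_iff algebra_simps)
  show "tors u (sscale f w) x = f * tors u w x"
    using assms smooth unfolding torsion_def
    by (simp add: D_section D_sscale_left D_sscale_right dorfman_sscale_right dorfman_section
     sections_diff sections_add sections_sscale pairing_add_left pairing_add_right pairing_diff_left
     pairing_sscale_left pairing_sscale_right)
     (simp add: fun_eq_iff algebra_simps)
  show "tors u w (sscale f x) = f * tors u w x"
    using assms unfolding torsion_def
    by (simp add: D_section D_sscale_left dorfman_section
     sections_diff pairing_sscale_right distrib_left)
qed

lemma torsion_vanishes_on_frame: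
  assumes "\<And>A C K. A < n \<Longrightarrow> C < n \<Longrightarrow> K < n \<Longrightarrow> tors (e A) (e C) (e K) = 0"
    and uwx: "u \<in> \<Gamma>" "w \<in> \<Gamma>" "x \<in> \<Gamma>"
  shows "tors u w x = 0"
proof -
  have 1: "tors u (e C) (e K) = 0" if "C < n" "K < n" for C K
    using linear_on_sections[OF uwx(1), of "\<lambda>u. tors u (e C) (e K)"] assms(1) that
    by (simp add: torsion_add torsion_sscale frame_section)
  have 2: "tors u w (e K) = 0" if "K < n" for K
    using linear_on_sections[OF uwx(2), of "\<lambda>w. tors u w (e K)"] 1 that uwx
    by (simp add: torsion_add torsion_sscale frame_section)
  show ?thesis
    using linear_on_sections[OF uwx(3), of "\<lambda>x. tors u w x"] 2 uwx
    by (simp add: torsion_add torsion_sscale frame_section)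
qed

lemma divergence_of_eq:
  assumes "u \<in> \<Gamma>" shows "divergence_of \<A> D u = (\<Sum>A<n. coord A (D (e A) u))"
  unfolding divergence_of_def subbundle_all[symmetric]
  by (rule trace_subbundle) (auto simp: subbundle_all D_section D_add_left D_sscale_left assms)

end

section \<open>The Ricci curvatures in an orthonormal frame\<close>

text \<open>Metricity carries over the invariance of \<open>subbundle P\<close> to the complementary block \<open>Q\<close>.\<close>

locale levi_civita_frame = framed_connection +
  fixes P Q :: "nat set"
  assumes split: "P \<union> Q = {..<n}" "P \<inter> Q = {}"
    and torsion_free: "u \<in> sections \<A> \<Longrightarrow> w \<in> sections \<A> \<Longrightarrow> x \<in> sections \<A> \<Longrightarrow> torsion \<A> H F D u w x = 0"
    and preserves_P: "u \<in> sections \<A> \<Longrightarrow> w \<in> subbundle P \<Longrightarrow> D u w \<in> subbundle P"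
begin

lemma less_n: "A \<in> P \<Longrightarrow> A < n" "A \<in> Q \<Longrightarrow> A < n"
  and subset_n: "P \<subseteq> {..<n}" "Q \<subseteq> {..<n}"
  and fin: "finite P" "finite Q"
proof -
  show s: "P \<subseteq> {..<n}" "Q \<subseteq> {..<n}" using split by auto
  show "A \<in> P \<Longrightarrow> A < n" "A \<in> Q \<Longrightarrow> A < n" using s by auto
  show "finite P" "finite Q" using s finite_subset by blast+
qed

lemma sum_split: "(\<Sum>A<n. k A) = (\<Sum>A\<in>P. k A) + (\<Sum>A\<in>Q. k A)" for k :: "nat \<Rightarrow> 'y::comm_monoid_add"
  using sum.union_disjoint[OF fin split(2), of k] split(1) by simp

definition \<omega> :: "nat \<Rightarrow> nat \<Rightarrow> nat \<Rightarrow> 'a scal" where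
  "\<omega> A C K = pairing (D (e A) (e C)) (e K)"

lemma \<omega>_smooth: "A < n \<Longrightarrow> C < n \<Longrightarrow> K < n \<Longrightarrow> \<omega> A C K \<in> R"
  by (simp add: \<omega>_def pairing_smooth D_section frame_section)

lemma \<omega>_skew:
  assumes "A < n" "C < n" "K < n" shows "\<omega> A C K = - \<omega> A K C"
proof -
  have "anchor (e A) (pairing (e C) (e K)) = 0"
    using assms by (simp only: pairing_frame vector_field_cst[OF anchor_vector_field[OF frame_section]])
  then have "\<omega> A C K + \<omega> A K C = 0"
    using assms D_metric[of "e A" "e C" "e K"]
    by (simp add: \<omega>_def frame_section pairing_commute[of "e C"])
  then show ?thesis by (simp add: eq_neg_iff_add_eq_0)
qed

lemma \<omega>_mixed:
  assumes "A < n" "p \<in> P" "q \<in> Q" shows "\<omega> A p q = 0" "\<omega> A q p = 0"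
proof -
  have "D (e A) (e p) \<in> subbundle P"
    using assms preserves_P frame_section frame_subbundle less_n by blast
  then show "\<omega> A p q = 0"
    using assms split less_n unfolding \<omega>_def subbundle_def by blast
  then show "\<omega> A q p = 0" using \<omega>_skew[of A q p] assms less_n by simp
qed

text \<open>The torsion at three frame vectors; skewness turns \<open>- \<omega>\<^bsub>CAK\<^esub>\<close> into \<open>\<omega>\<^bsub>CKA\<^esub>\<close>.\<close>

lemma \<omega>_cyclic:
  assumes "A < n" "C < n" "K < n"
  shows "\<omega> A C K + \<omega> C K A + \<omega> K A C = cst (B A C K)"
proof -
  have "tors (e A) (e C) (e K) = 0" using assms by (simp add: torsion_free frame_section)
  then have "\<omega> A C K - \<omega> C A K - cst (B A C K) + \<omega> K A C = 0"
    using assms unfolding torsion_def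
    by (simp add: pairing_diff_left sections_diff D_section dorfman_section frame_section
        structure_constants \<omega>_def pairing_commute[of "e C"])
  then show ?thesis using \<omega>_skew[of C A K] assms by (simp add: algebra_simps)
qed

text \<open>If the first index lies in the other block, then the remaining two terms of the cyclic sum vanish,
  and the coefficient is forced.\<close>

lemma \<omega>_opposite:
  assumes "i \<in> Q" "b \<in> P" "c \<in> P" shows "\<omega> i b c = cst (B i b c)"
  using \<omega>_cyclic[of i b c] \<omega>_mixed[of b c i] \<omega>_mixed[of c b i] assms less_n by simp

lemma D_in_frame:
  assumes u: "u \<in> \<Gamma>" and "C < n" "K < n"
  shows "pairing (D u (e C)) (e K) = (\<Sum>A<n. cst (\<eta> A) * pairing u (e A) * \<omega> A C K)"
  using linear_on_sections[OF u, of "\<lambda>u. pairing (D u (e C)) (e K)"] assms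
  by (simp add: D_add_left D_sscale_left D_section frame_section pairing_add_left pairing_sscale_left
      coord_def \<omega>_def)

text \<open>The three terms of the curvature are evaluated separately, using metricity to move a derivative to
  the other factor and Parseval's formula for the remaining product. The second sum uses that
  \<open>B\<^bsub>aic\<^esub> = - B\<^bsub>iac\<^esub>\<close>.\<close>

lemma curvature_component:
  assumes i: "i \<in> Q" and b: "b \<in> P" and a: "a \<in> P"
  shows "pairing (curv (e a) (e i) (e b)) (e a) =
    (\<Sum>c\<in>P. cst (\<eta> c * B i b c) * \<omega> a c a) - anchor (e i) (\<omega> a b a)
    + (\<Sum>c\<in>P. cst (\<eta> c * B i a c) * (\<omega> a b c + \<omega> c b a))
    - cst (\<Sum>j\<in>Q. \<eta> j * B a i j * B j b a)"
proof -
  note lt = less_n(2)[OF i] less_n(1)[OF b] less_n(1)[OF a]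
  note sec = frame_section[OF lt(1)] frame_section[OF lt(2)] frame_section[OF lt(3)]
  have "pairing (D (e a) (D (e i) (e b))) (e a) =
      anchor (e a) (\<omega> i b a) - pairing (D (e i) (e b)) (D (e a) (e a))"
    using D_metric[OF sec(3) D_section[OF sec(1,2)] sec(3)] unfolding \<omega>_def by simp
  also have "anchor (e a) (\<omega> i b a) = 0"
    using vector_field_cst[OF anchor_vector_field[OF sec(3)]] \<omega>_opposite[OF i b a] by simp
  also have "pairing (D (e i) (e b)) (D (e a) (e a)) = (\<Sum>C<n. cst (\<eta> C) * \<omega> i b C * \<omega> a a C)"
    unfolding \<omega>_def by (rule pairing_parseval) (auto intro: D_section sec)
  also have "\<dots> = - (\<Sum>c\<in>P. cst (\<eta> c * B i b c) * \<omega> a c a)"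
    unfolding sum_split sum_negf[symmetric]
    using b i lt \<omega>_mixed[OF lt(1) b] less_n \<omega>_skew[OF lt(3) lt(3)]
    by (simp add: \<omega>_opposite cst_mult flip: cst_mult)
  finally have 1: "pairing (D (e a) (D (e i) (e b))) (e a) = (\<Sum>c\<in>P. cst (\<eta> c * B i b c) * \<omega> a c a)"
    by simp
  have "pairing (D (e i) (D (e a) (e b))) (e a) =
      anchor (e i) (\<omega> a b a) - pairing (D (e a) (e b)) (D (e i) (e a))"
    using D_metric[OF sec(1) D_section[OF sec(3,2)] sec(3)] unfolding \<omega>_def by simp
  also have "pairing (D (e a) (e b)) (D (e i) (e a)) = (\<Sum>C<n. cst (\<eta> C) * \<omega> a b C * \<omega> i a C)"
    unfolding \<omega>_def by (rule pairing_parseval) (auto intro: D_section sec)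
  also have "\<dots> = (\<Sum>c\<in>P. cst (\<eta> c * B i a c) * \<omega> a b c)"
    unfolding sum_split using a i \<omega>_mixed[OF lt(3) b]
    by (simp add: \<omega>_opposite mult_ac flip: cst_mult)
  finally have 2: "pairing (D (e i) (D (e a) (e b))) (e a) =
      anchor (e i) (\<omega> a b a) - (\<Sum>c\<in>P. cst (\<eta> c * B i a c) * \<omega> a b c)" .
  have "pairing (D (dorf (e a) (e i)) (e b)) (e a)
      = (\<Sum>C<n. cst (\<eta> C) * cst (B a i C) * \<omega> C b a)"
    using lt by (subst D_in_frame) (auto simp: dorfman_section sec structure_constants)
  also have "\<dots> = (\<Sum>c\<in>P. cst (\<eta> c * B a i c) * \<omega> c b a) + (\<Sum>j\<in>Q. cst (\<eta> j * B a i j * B j b a))"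
    unfolding sum_split using a b by (simp add: \<omega>_opposite flip: cst_mult)
  also have "(\<Sum>c\<in>P. cst (\<eta> c * B a i c) * \<omega> c b a) = - (\<Sum>c\<in>P. cst (\<eta> c * B i a c) * \<omega> c b a)"
    unfolding sum_negf[symmetric] using lt less_n B_skew12[OF lt(1) lt(3)]
    by (simp add: flip: cst_minus)
  finally have 3: "pairing (D (dorf (e a) (e i)) (e b)) (e a) =
      - (\<Sum>c\<in>P. cst (\<eta> c * B i a c) * \<omega> c b a) + cst (\<Sum>j\<in>Q. \<eta> j * B a i j * B j b a)"
    by (simp only: cst_sum)
  have "pairing (curv (e a) (e i) (e b)) (e a) = pairing (D (e a) (D (e i) (e b))) (e a)
      - pairing (D (e i) (D (e a) (e b))) (e a) - pairing (D (dorf (e a) (e i)) (e b)) (e a)"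
    unfolding curvature_def by (simp add: pairing_diff_left sections_diff D_section dorfman_section sec)
  then show ?thesis unfolding 1 2 3 by (simp add: distrib_left sum.distrib)
qed

text \<open>In the sum over \<open>a\<close>, the first term of the preceding lemma produces the divergence, the second one
  is the derivative of the constant \<open>d b\<close>, and the third one pairs a symmetric with a skew
  expression. So the free coefficients of the connection drop out.\<close>

lemma ricci_frame:
  assumes i: "i \<in> Q" and b: "b \<in> P"
    and div: "\<And>c. c \<in> P \<Longrightarrow> divergence_of \<A> D (e c) = cst (d c)"
  shows "(\<Sum>a\<in>P. coord a (curv (e a) (e i) (e b))) = cst (ricci_form \<eta> B d P Q i b)"
proof -
  have div': "(\<Sum>a\<in>P. cst (\<eta> a) * \<omega> a c a) = cst (d c)" if c: "c \<in> P" for c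
  proof -
    have "cst (d c) = (\<Sum>A<n. cst (\<eta> A) * \<omega> A c A)"
      using div[OF c] divergence_of_eq[OF frame_section[OF less_n(1)[OF c]]] by (simp add: coord_def \<omega>_def)
    also have "\<dots> = (\<Sum>a\<in>P. cst (\<eta> a) * \<omega> a c a)"
      unfolding sum_split using \<omega>_mixed[OF _ c] less_n by simp
    finally show ?thesis ..
  qed
  have T1: "(\<Sum>a\<in>P. cst (\<eta> a) * (\<Sum>c\<in>P. cst (\<eta> c * B i b c) * \<omega> a c a)) =
      cst (\<Sum>c\<in>P. \<eta> c * B i b c * d c)" (is "?L = _")
  proof -
    have "?L = (\<Sum>c\<in>P. cst (\<eta> c * B i b c) * (\<Sum>a\<in>P. cst (\<eta> a) * \<omega> a c a))"
      unfolding sum_distrib_left by (subst sum.swap) (simp add: mult_ac)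
    then show ?thesis by (simp add: div' cst_mult cst_sum)
  qed
  have T2: "(\<Sum>a\<in>P. cst (\<eta> a) * anchor (e i) (\<omega> a b a)) = 0"
  proof -
    have X: "anchor (e i) \<in> VF" using i less_n frame_section anchor_vector_field by blast
    have "(\<Sum>a\<in>P. cst (\<eta> a) * anchor (e i) (\<omega> a b a)) = anchor (e i) (\<Sum>a\<in>P. cst (\<eta> a) * \<omega> a b a)"
      using b less_n
      by (subst vector_field_sum[OF X])
        (auto intro!: smooth_funs_mult smooth_funs_cst \<omega>_smooth simp: vector_field_cst_mult[OF X \<omega>_smooth])
    then show ?thesis using div'[OF b] vector_field_cst[OF X] by simp
  qed
  have T3: "(\<Sum>a\<in>P. cst (\<eta> a) * (\<Sum>c\<in>P. cst (\<eta> c * B i a c) * (\<omega> a b c + \<omega> c b a))) = 0" (is "?S = 0")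
  proof -
    have "?S = (\<Sum>a\<in>P. \<Sum>c\<in>P. cst (\<eta> a * \<eta> c * B i a c) * (\<omega> a b c + \<omega> c b a))"
      by (simp add: sum_distrib_left mult_ac flip: cst_mult)
    also have "\<dots> = (\<Sum>a\<in>P. \<Sum>c\<in>P. cst (\<eta> a * \<eta> c * B i c a) * (\<omega> a b c + \<omega> c b a))"
      by (subst sum.swap) (simp add: mult_ac add.commute)
    also have "\<dots> = - (\<Sum>a\<in>P. \<Sum>c\<in>P. cst (\<eta> a * \<eta> c * B i a c) * (\<omega> a b c + \<omega> c b a))"
      unfolding sum_negf[symmetric]
    proof (intro sum.cong refl)
      fix a c assume "a \<in> P" "c \<in> P"
      then have "B i c a = - B i a c" using B_skew23[of i a c] i less_n by simp
      then show "cst (\<eta> a * \<eta> c * B i c a) * (\<omega> a b c + \<omega> c b a)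
          = - (cst (\<eta> a * \<eta> c * B i a c) * (\<omega> a b c + \<omega> c b a))"
        by (simp add: fun_eq_iff cst_def)
    qed
    finally show ?thesis
      using \<open>?S = _\<close> by (simp add: fun_eq_iff)
  qed
  have T4: "(\<Sum>a\<in>P. cst (\<eta> a) * cst (\<Sum>j\<in>Q. \<eta> j * B a i j * B j b a)) =
      cst (\<Sum>a\<in>P. \<Sum>j\<in>Q. \<eta> a * \<eta> j * B a i j * B j b a)"
    by (simp add: cst_mult cst_sum sum_distrib_left mult_ac)
  have "(\<Sum>a\<in>P. coord a (curv (e a) (e i) (e b))) =
    (\<Sum>a\<in>P. cst (\<eta> a) * (\<Sum>c\<in>P. cst (\<eta> c * B i b c) * \<omega> a c a))
    - (\<Sum>a\<in>P. cst (\<eta> a) * anchor (e i) (\<omega> a b a))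
    + (\<Sum>a\<in>P. cst (\<eta> a) * (\<Sum>c\<in>P. cst (\<eta> c * B i a c) * (\<omega> a b c + \<omega> c b a)))
    - (\<Sum>a\<in>P. cst (\<eta> a) * cst (\<Sum>j\<in>Q. \<eta> j * B a i j * B j b a))"
    unfolding coord_def
    by (simp add: curvature_component[OF i b] distrib_left right_diff_distrib sum.distrib sum_subtractf)
  then show ?thesis unfolding T1 T2 T3 T4 ricci_form_def by (simp add: cst_diff)
qed

lemma curvature_preserves:
  assumes "u \<in> \<Gamma>" "w \<in> \<Gamma>" "x \<in> subbundle P" shows "curv u w x \<in> subbundle P"
  unfolding curvature_def using assms
  by (intro subbundle_diff preserves_P dorfman_section) auto

lemma ricci_eq:
  assumes u: "u \<in> subbundle Q" and x: "x \<in> subbundle P"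
  shows "bundle_trace \<A> (subbundle P) (\<lambda>w. curv w u x) = (\<Sum>a\<in>P. coord a (curv (e a) u x))"
proof (rule trace_subbundle[OF subset_n(1)])
  fix w w' f assume w: "w \<in> subbundle P"
  note sec = subbundle_section[OF u] subbundle_section[OF x] subbundle_section[OF w]
  show "curv w u x \<in> subbundle P" by (rule curvature_preserves[OF sec(3,1) x])
  show "curv (w + w') u x = curv w u x + curv w' u x" if "w' \<in> subbundle P"
    using curvature_add(1)[OF sec(3) subbundle_section[OF that] sec(1,2)] .
  show "curv (sscale f w) u x = sscale f (curv w u x)" if "f \<in> R"
    using curvature_sscale_left[OF that sec(3,1,2) pairing_disjoint_subbundles[OF split(2) w u]] .
qed

text \<open>The trace is tensorial in both arguments, so that it suffices to test it on the frame.\<close>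

lemma ricci_flat_iff:
  assumes div: "\<And>c. c \<in> P \<Longrightarrow> divergence_of \<A> D (e c) = cst (d c)"
  shows "(\<forall>u\<in>subbundle Q. \<forall>x\<in>subbundle P. bundle_trace \<A> (subbundle P) (\<lambda>w. curv w u x) = 0) \<longleftrightarrow>
    (\<forall>i\<in>Q. \<forall>b\<in>P. ricci_form \<eta> B d P Q i b = 0)"
proof
  assume flat: "\<forall>u\<in>subbundle Q. \<forall>x\<in>subbundle P. bundle_trace \<A> (subbundle P) (\<lambda>w. curv w u x) = 0"
  show "\<forall>i\<in>Q. \<forall>b\<in>P. ricci_form \<eta> B d P Q i b = 0"
  proof (intro ballI)
    fix i b assume ib: "i \<in> Q" "b \<in> P"
    then have mem: "e i \<in> subbundle Q" "e b \<in> subbundle P" using frame_subbundle less_n by auto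
    from flat mem have "bundle_trace \<A> (subbundle P) (\<lambda>w. curv w (e i) (e b)) = 0" by blast
    then have "(cst (ricci_form \<eta> B d P Q i b) :: 'a scal) = 0"
      using ricci_eq[OF mem] ricci_frame[OF ib div] by simp
    then show "ricci_form \<eta> B d P Q i b = 0" by (simp add: fun_eq_iff cst_def)
  qed
next
  assume flat: "\<forall>i\<in>Q. \<forall>b\<in>P. ricci_form \<eta> B d P Q i b = 0"
  show "\<forall>u\<in>subbundle Q. \<forall>x\<in>subbundle P. bundle_trace \<A> (subbundle P) (\<lambda>w. curv w u x) = 0"
  proof (intro ballI)
    fix u x assume u: "u \<in> subbundle Q" and x: "x \<in> subbundle P"
    define \<rho> where "\<rho> u x = (\<Sum>a\<in>P. coord a (curv (e a) u x))" for u x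
    have add: "\<rho> (u + u') x = \<rho> u x + \<rho> u' x" "\<rho> x (u + u') = \<rho> x u + \<rho> x u'"
      if "u \<in> \<Gamma>" "u' \<in> \<Gamma>" "x \<in> \<Gamma>" for u u' x
      using that less_n unfolding \<rho>_def
      by (simp_all add: curvature_add coord_add curvature_section frame_section sum.distrib)
    have scale: "\<rho> (sscale f u) x = f * \<rho> u x" "\<rho> u (sscale f x) = f * \<rho> u x"
      if "f \<in> R" "u \<in> \<Gamma>" "x \<in> \<Gamma>" for f u x
      using that less_n unfolding \<rho>_def
      by (simp_all add: curvature_sscale_middle curvature_sscale_right coord_sscale curvature_section
          frame_section sum_distrib_left)
    have 0: "\<rho> (e i) (e b) = 0" if "i \<in> Q" "b \<in> P" for i b
      using flat that ricci_frame[OF that div] by (simp add: \<rho>_def cst_0)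
    have 1: "\<rho> u (e b) = 0" if b: "b \<in> P" for b
      using linear_on_subbundle[OF subset_n(2) u, of "\<lambda>u. \<rho> u (e b)"] b less_n 0 subbundle_section
      by (simp add: add scale frame_section)
    have "\<rho> u x = 0"
      using linear_on_subbundle[OF subset_n(1) x, of "\<lambda>x. \<rho> u x"] 1 subbundle_section[of _ P] subbundle_section[OF u]
      by (simp add: add scale)
    then show "bundle_trace \<A> (subbundle P) (\<lambda>w. curv w u x) = 0"
      unfolding ricci_eq[OF u x] \<rho>_def .
  qed
qed

end

section \<open>Levi-Civita connections with prescribed divergence\<close>

context courant_frame
begin

text \<open>The scalar product of \<open>D\<^sub>u w\<close> with \<open>e\<^sub>K\<close>, for the connection with constant coefficients \<open>\<Omega>\<close>.\<close>

definition component :: "(nat \<Rightarrow> nat \<Rightarrow> nat \<Rightarrow> real) \<Rightarrow> 'a sect \<Rightarrow> 'a sect \<Rightarrow> nat \<Rightarrow> 'a scal" where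
  "component \<Omega> u w K = anchor u (pairing w (e K)) +
     (\<Sum>A<n. \<Sum>C<n. cst (\<Omega> A C K) * coord A u * coord C w)"

definition connection_of :: "(nat \<Rightarrow> nat \<Rightarrow> nat \<Rightarrow> real) \<Rightarrow> 'a sect \<Rightarrow> 'a sect \<Rightarrow> 'a sect" where
  "connection_of \<Omega> u w = (\<Sum>K<n. sscale (cst (\<eta> K) * component \<Omega> u w K) (e K))"

lemma component_smooth: 
  assumes "u \<in> \<Gamma>" "w \<in> \<Gamma>" "K < n" shows "component \<Omega> u w K \<in> R"
proof -
  have "anchor u (pairing w (e K)) \<in> R"
    using assms vector_field_smooth[OF anchor_vector_field pairing_smooth] frame_section by blast
  moreover have "cst (\<Omega> A C K) * coord A u * coord C w \<in> R" if "A < n" "C < n" for A C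
    using that assms by (simp add: smooth_funs_mult smooth_funs_cst coord_smooth)
  ultimately show ?thesis
    unfolding component_def by (intro smooth_funs_add smooth_funs_sum) auto
qed

lemma connection_section: "u \<in> \<Gamma> \<Longrightarrow> w \<in> \<Gamma> \<Longrightarrow> connection_of \<Omega> u w \<in> \<Gamma>"
  unfolding connection_of_def
  by (intro sections_sum sections_sscale smooth_funs_mult smooth_funs_cst)
    (auto simp: component_smooth frame_section)

lemma pairing_connection:
  assumes "u \<in> \<Gamma>" "w \<in> \<Gamma>" "K < n"
  shows "pairing (connection_of \<Omega> u w) (e K) = component \<Omega> u w K"
proof -
  have "pairing (connection_of \<Omega> u w) (e K) =
      (\<Sum>J<n. cst (\<eta> J) * component \<Omega> u w J * cst (if J = K then \<eta> J else 0))"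
    unfolding connection_of_def using assms
    by (subst pairing_sum_left)
      (auto simp: pairing_sscale_left sections_sscale smooth_funs_mult smooth_funs_cst
        component_smooth frame_section pairing_frame)
  also have "\<dots> = (\<Sum>J<n. if J = K then component \<Omega> u w K else 0)"
  proof (rule sum.cong[OF refl])
    fix J assume "J \<in> {..<n}"
    then show "cst (\<eta> J) * component \<Omega> u w J * cst (if J = K then \<eta> J else 0) =
        (if J = K then component \<Omega> u w K else 0)"
      using \<eta>_square[of J] by (auto simp: fun_eq_iff cst_def)
  qed
  finally show ?thesis using assms(3) by simp
qed

lemma component_frame:
  assumes "A < n" "C < n" "K < n"
  shows "component \<Omega> (e A) (e C) K = cst (\<Omega> A C K)"
proof -
  have "anchor (e A) (pairing (e C) (e K)) = 0"
    using assms by (simp only: pairing_frame vector_field_cst[OF anchor_vector_field[OF frame_section]])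
  moreover have "(\<Sum>A'<n. \<Sum>C'<n. cst (\<Omega> A' C' K) * coord A' (e A) * coord C' (e C)) =
      (\<Sum>A'<n. if A' = A then (\<Sum>C'<n. if C' = C then cst (\<Omega> A C K) else 0) else 0)"
  proof (rule sum.cong[OF refl])
    fix A' assume "A' \<in> {..<n}"
    then have A': "coord A' (e A) = (if A' = A then 1 else 0)"
      using assms by (simp add: coord_frame cst_0 cst_1)
    have "coord C' (e C) = (if C' = C then 1 else 0)" if "C' < n" for C'
      using assms that by (simp add: coord_frame cst_0 cst_1)
    then have "(\<Sum>C'<n. cst (\<Omega> A C' K) * coord C' (e C)) = (\<Sum>C'<n. if C' = C then cst (\<Omega> A C K) else 0)"
      by (intro sum.cong refl) simp
    then show "(\<Sum>C'<n. cst (\<Omega> A' C' K) * coord A' (e A) * coord C' (e C)) =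
        (if A' = A then (\<Sum>C'<n. if C' = C then cst (\<Omega> A C K) else 0) else 0)"
      using A' by simp
  qed
  ultimately show ?thesis using assms unfolding component_def by simp
qed

lemma component_linear:
  assumes mem: "u \<in> \<Gamma>" "w \<in> \<Gamma>" "K < n"
  shows "u' \<in> \<Gamma> \<Longrightarrow> component \<Omega> (u + u') w K = component \<Omega> u w K + component \<Omega> u' w K"
    "f \<in> R \<Longrightarrow> component \<Omega> (sscale f u) w K = f * component \<Omega> u w K"
    "u' \<in> \<Gamma> \<Longrightarrow> component \<Omega> w (u + u') K = component \<Omega> w u K + component \<Omega> w u' K"
    "f \<in> R \<Longrightarrow> component \<Omega> w (sscale f u) K = anchor w f * pairing u (e K) + f * component \<Omega> w u K"
proof -
  have p: "pairing u (e K) \<in> R" "anchor w \<in> VF"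
    using mem by (auto simp: pairing_smooth frame_section anchor_vector_field)
  show "component \<Omega> (u + u') w K = component \<Omega> u w K + component \<Omega> u' w K" if "u' \<in> \<Gamma>"
    using mem that by (simp add: component_def coord_add sum.distrib distrib_left distrib_right)
  show "component \<Omega> (sscale f u) w K = f * component \<Omega> u w K" if f: "f \<in> R"
    using mem f by (simp add: component_def coord_sscale fscale_apply sum_distrib_left distrib_left mult_ac)
  show "component \<Omega> w (u + u') K = component \<Omega> w u K + component \<Omega> w u' K" if "u' \<in> \<Gamma>"
    using mem p that by (simp add: component_def coord_add sum.distrib distrib_left pairing_add_left
      frame_section vector_field_add pairing_smooth) (simp add: fun_eq_iff)
  show "component \<Omega> w (sscale f u) K = anchor w f * pairing u (e K) + f * component \<Omega> w u K" if f: "f \<in> R"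
    using mem f p by (simp add: component_def coord_sscale pairing_sscale_left frame_section
      vector_field_mult sum_distrib_left distrib_left mult_ac) (simp add: fun_eq_iff)
qed

lemma connection_of_generalized_connection:
  assumes skew: "\<And>A C K. A < n \<Longrightarrow> C < n \<Longrightarrow> K < n \<Longrightarrow> \<Omega> A K C = - \<Omega> A C K"
  shows "generalized_connection \<A> (connection_of \<Omega>)"
  unfolding generalized_connection_def
proof (intro conjI ballI)
  note simps = connection_section sections_add sections_sscale pairing_connection pairing_add_left
    pairing_sscale_left frame_section component_linear
  show "connection_of \<Omega> u w \<in> \<Gamma>" if "u \<in> \<Gamma>" "w \<in> \<Gamma>" for u w
    using that by (rule connection_section)
  show "connection_of \<Omega> (u + u') w = connection_of \<Omega> u w + connection_of \<Omega> u' w"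
    if "u \<in> \<Gamma>" "u' \<in> \<Gamma>" "w \<in> \<Gamma>" for u u' w
    by (rule section_eqI) (simp_all add: simps that)
  show "connection_of \<Omega> (sscale f u) w = sscale f (connection_of \<Omega> u w)"
    if "f \<in> R" "u \<in> \<Gamma>" "w \<in> \<Gamma>" for f u w
    by (rule section_eqI) (simp_all add: simps that)
  show "connection_of \<Omega> u (w + w') = connection_of \<Omega> u w + connection_of \<Omega> u w'"
    if "u \<in> \<Gamma>" "w \<in> \<Gamma>" "w' \<in> \<Gamma>" for u w w'
    by (rule section_eqI) (simp_all add: simps that)
  show "connection_of \<Omega> u (sscale f w) = sscale (anchor u f) w + sscale f (connection_of \<Omega> u w)"
    if "f \<in> R" "u \<in> \<Gamma>" "w \<in> \<Gamma>" for f u w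
  proof -
    have "anchor u f \<in> R" using vector_field_smooth[OF anchor_vector_field[OF that(2)] that(1)] .
    then show ?thesis by (intro section_eqI) (simp_all add: simps that)
  qed
  fix u w w' assume mem: "u \<in> \<Gamma>" "w \<in> \<Gamma>" "w' \<in> \<Gamma>"
  show "anchor u (pairing w w') = pairing (connection_of \<Omega> u w) w' + pairing w (connection_of \<Omega> u w')"
  proof -
    \<comment> \<open>The part of \<open>\<langle>D\<^sub>u x, y\<rangle>\<close> that does not differentiate \<open>x\<close>.\<close>
    define G where "G x y = (\<Sum>K<n. \<Sum>A<n. \<Sum>C<n. cst (\<Omega> A C K) * coord A u * coord C x * coord K y)" for x y
    have G_skew: "G y x = - G x y" for x y
    proof -
      have "G y x = (\<Sum>A<n. \<Sum>K<n. \<Sum>C<n. cst (\<Omega> A C K) * coord A u * coord C y * coord K x)"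
        unfolding G_def by (rule sum.swap)
      also have "\<dots> = (\<Sum>A<n. \<Sum>C<n. \<Sum>K<n. cst (\<Omega> A C K) * coord A u * coord C y * coord K x)"
        by (intro sum.cong refl sum.swap)
      also have "\<dots> = (\<Sum>C<n. \<Sum>A<n. \<Sum>K<n. cst (\<Omega> A C K) * coord A u * coord C y * coord K x)"
        by (rule sum.swap)
      also have "\<dots> = - G x y"
        unfolding G_def sum_negf[symmetric]
      proof (intro sum.cong refl)
        fix C A K assume "C \<in> {..<n}" "A \<in> {..<n}" "K \<in> {..<n}"
        then have "\<Omega> A C K = - \<Omega> A K C" using skew[of A K C] by simp
        then show "cst (\<Omega> A C K) * coord A u * coord C y * coord K x =
            - (cst (\<Omega> A K C) * coord A u * coord K x * coord C y)"
          by (simp add: fun_eq_iff cst_def)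
      qed
      finally show ?thesis .
    qed
    have G0: "G w w' + G w' w = 0" unfolding G_skew[of w' w] by simp
    have half: "pairing (connection_of \<Omega> u x) y =
        (\<Sum>K<n. cst (\<eta> K) * (anchor u (pairing x (e K)) * pairing y (e K))) + G x y"
      if "x \<in> \<Gamma>" "y \<in> \<Gamma>" for x y
      unfolding pairing_parseval[OF connection_section[OF mem(1) that(1)] that(2)] G_def
      using mem that
      by (simp add: pairing_connection component_def coord_def sum.distrib distrib_left distrib_right
          sum_distrib_left sum_distrib_right mult_ac)
    have p: "pairing x (e K) \<in> R" if "x \<in> \<Gamma>" "K < n" for x K
      using that by (simp add: pairing_smooth frame_section)
    have "anchor u (pairing w w') =
        (\<Sum>K<n. anchor u (cst (\<eta> K) * (pairing w (e K) * pairing w' (e K))))"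
      unfolding pairing_parseval[OF mem(2,3)] mult.assoc
      using mem p by (intro vector_field_sum anchor_vector_field smooth_funs_mult smooth_funs_cst) auto
    also have "\<dots> = (\<Sum>K<n. cst (\<eta> K) * (anchor u (pairing w (e K)) * pairing w' (e K)
        + pairing w (e K) * anchor u (pairing w' (e K))))"
      using mem p by (intro sum.cong refl)
        (simp add: vector_field_cst_mult vector_field_mult smooth_funs_mult anchor_vector_field;
          simp add: fun_eq_iff algebra_simps)
    also have "\<dots> = (\<Sum>K<n. cst (\<eta> K) * (anchor u (pairing w (e K)) * pairing w' (e K)))
        + (\<Sum>K<n. cst (\<eta> K) * (anchor u (pairing w' (e K)) * pairing w (e K)))"
      by (simp add: sum.distrib distrib_left mult_ac)
    also have "\<dots> = pairing (connection_of \<Omega> u w) w' + pairing (connection_of \<Omega> u w') w"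
      unfolding half[OF mem(2,3)] half[OF mem(3,2)] using G0 by (simp add: fun_eq_iff algebra_simps)
    finally show ?thesis by (simp add: pairing_commute[of w])
  qed
qed

lemma connection_of_preserves:
  assumes u: "u \<in> \<Gamma>" and w: "w \<in> subbundle S"
    and mixed: "\<And>A C K. A < n \<Longrightarrow> C \<in> S \<Longrightarrow> K < n \<Longrightarrow> K \<notin> S \<Longrightarrow> \<Omega> A C K = 0"
  shows "connection_of \<Omega> u w \<in> subbundle S"
proof -
  have "component \<Omega> u w K = 0" if K: "K < n" "K \<notin> S" for K
  proof -
    have "pairing w (e K) = 0" using w K by (simp add: subbundle_def)
    then have "anchor u (pairing w (e K)) = 0"
      using vector_field_0[OF anchor_vector_field[OF u]] by simp
    moreover have "cst (\<Omega> A C K) * coord A u * coord C w = 0" if "A < n" "C < n" for A C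
      using mixed[OF that(1) _ K, of C] w that(2)
      by (cases "C \<in> S") (auto simp: subbundle_def coord_def cst_0)
    ultimately show ?thesis unfolding component_def by simp
  qed
  then show ?thesis
    using u w by (simp add: subbundle_def connection_section pairing_connection)
qed

text \<open>Coefficients with all three indices in the block \<open>S\<close>. The fraction has cyclic sum \<open>0\<close>, hence does
  not contribute to the torsion; its trace is \<open>d C\<close> because the sum over \<open>S\<close> gives \<open>card S\<close> times
  \<open>d C\<close> minus one term. This needs \<open>card S > 1\<close>.\<close>

definition pure_coeff :: "(nat \<Rightarrow> real) \<Rightarrow> nat set \<Rightarrow> nat \<Rightarrow> nat \<Rightarrow> nat \<Rightarrow> real" where
  "pure_coeff d S A C K = B A C K / 3 +
     ((if A = K then \<eta> A * d C else 0) - (if A = C then \<eta> A * d K else 0)) / (real (card S) - 1)"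

definition lc_coeff :: "(nat \<Rightarrow> real) \<Rightarrow> nat set \<Rightarrow> nat set \<Rightarrow> nat \<Rightarrow> nat \<Rightarrow> nat \<Rightarrow> real" where
  "lc_coeff d P Q A C K =
     (if C \<in> P \<and> K \<in> P then if A \<in> P then pure_coeff d P A C K else B A C K
      else if C \<in> Q \<and> K \<in> Q then if A \<in> Q then pure_coeff d Q A C K else B A C K
      else 0)"

lemma B_cyclic: "A < n \<Longrightarrow> C < n \<Longrightarrow> K < n \<Longrightarrow> B C K A = B A C K"
  using B_skew12[of A C K] B_skew23[of C A K] by simp

lemma B_repeated: "A < n \<Longrightarrow> C < n \<Longrightarrow> B A C A = 0"
  using B_cyclic[of A C A] B_skew23[of C A A] by simp

lemma pure_coeff_skew: "A < n \<Longrightarrow> C < n \<Longrightarrow> K < n \<Longrightarrow> pure_coeff d S A K C = - pure_coeff d S A C K"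
  unfolding pure_coeff_def using B_skew23[of A C K] by (auto simp: diff_divide_distrib)

lemma pure_coeff_cyclic:
  "A < n \<Longrightarrow> C < n \<Longrightarrow> K < n \<Longrightarrow> pure_coeff d S A C K + pure_coeff d S C K A + pure_coeff d S K A C = B A C K"
  unfolding pure_coeff_def using B_cyclic[of A C K] B_cyclic[of C K A] by (simp add: field_simps)

lemma pure_coeff_divergence:
  assumes S: "S \<subseteq> {..<n}" and card: "card S \<ge> 2" and C: "C \<in> S"
  shows "(\<Sum>A\<in>S. \<eta> A * pure_coeff d S A C A) = d C"
proof -
  have fin: "finite S" using S finite_subset by blast
  have "(\<Sum>A\<in>S. \<eta> A * pure_coeff d S A C A) = (\<Sum>A\<in>S. (d C - (if A = C then d C else 0)) / (real (card S) - 1))"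
  proof (rule sum.cong[OF refl])
    fix A assume "A \<in> S"
    then have "\<eta> A * \<eta> A = 1" "B A C A = 0"
      using S C \<eta>_square[of A] B_repeated[of A C] by auto
    then show "\<eta> A * pure_coeff d S A C A = (d C - (if A = C then d C else 0)) / (real (card S) - 1)"
      unfolding pure_coeff_def by (cases "A = C") (simp_all add: right_diff_distrib flip: mult.assoc)
  qed
  also have "\<dots> = (real (card S) * d C - d C) / (real (card S) - 1)"
    using C fin by (simp add: sum_subtractf flip: sum_divide_distrib)
  also have "\<dots> = d C" using card by (simp add: field_simps)
  finally show ?thesis .
qed

text \<open>A left-invariant connection: the pure coefficients are chosen as above, the mixed ones are the
  forced ones.\<close>

theorem levi_civita_connection_exists:
  assumes split: "P \<union> Q = {..<n}" "P \<inter> Q = {}" and card: "card P \<ge> 2" "card Q \<ge> 2"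
  obtains D where "generalized_connection \<A> D"
    "\<And>u w x. u \<in> \<Gamma> \<Longrightarrow> w \<in> \<Gamma> \<Longrightarrow> x \<in> \<Gamma> \<Longrightarrow> torsion \<A> H F D u w x = 0"
    "\<And>u w. u \<in> \<Gamma> \<Longrightarrow> w \<in> subbundle P \<Longrightarrow> D u w \<in> subbundle P"
    "\<And>u w. u \<in> \<Gamma> \<Longrightarrow> w \<in> subbundle Q \<Longrightarrow> D u w \<in> subbundle Q"
    "\<And>A. A < n \<Longrightarrow> divergence_of \<A> D (e A) = cst (d A)"
proof -
  define \<Omega> where "\<Omega> = lc_coeff d P Q"
  have subset: "P \<subseteq> {..<n}" "Q \<subseteq> {..<n}" using split by auto
  have cases: "A \<in> P \<and> A \<notin> Q \<or> A \<in> Q \<and> A \<notin> P" if "A < n" for A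
    using split that by blast
  have skew: "\<Omega> A K C = - \<Omega> A C K" if "A < n" "C < n" "K < n" for A C K
    using that pure_coeff_skew[OF that] B_skew23[OF that] by (simp add: \<Omega>_def lc_coeff_def conj_commute)
  have cyclic: "\<Omega> A C K + \<Omega> C K A + \<Omega> K A C = B A C K" if "A < n" "C < n" "K < n" for A C K
    using cases[OF that(1)] cases[OF that(2)] cases[OF that(3)] pure_coeff_cyclic[OF that]
      B_cyclic[of A C K] B_cyclic[of C K A] that
    unfolding \<Omega>_def lc_coeff_def by auto
  let ?D = "connection_of \<Omega>"
  interpret framed_connection \<A> H F n e \<eta> B ?D
    by unfold_locales (rule connection_of_generalized_connection[OF skew])
  show ?thesis
  proof
    show "generalized_connection \<A> ?D" by (rule connection)
    show "torsion \<A> H F ?D u w x = 0" if "u \<in> \<Gamma>" "w \<in> \<Gamma>" "x \<in> \<Gamma>" for u w x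
    proof (rule torsion_vanishes_on_frame[OF _ that])
      fix A C K assume lt: "A < n" "C < n" "K < n"
      then have "tors (e A) (e C) (e K) = cst (\<Omega> A C K - \<Omega> C A K - B A C K + \<Omega> K A C)"
        unfolding torsion_def
        by (simp add: pairing_diff_left sections_diff connection_section dorfman_section frame_section
            structure_constants pairing_connection component_frame pairing_commute[of "e C"]
            cst_diff cst_add)
      then show "tors (e A) (e C) (e K) = 0"
        using cyclic[OF lt] skew[of C K A] lt
        by (metis (no_types, lifting) add.commute add_diff_cancel_left' cst_0 diff_add_eq diff_minus_eq_add diff_self)
    qed
    show "?D u w \<in> subbundle P" if "u \<in> \<Gamma>" "w \<in> subbundle P" for u w
      using that cases subset split(2)
      by (intro connection_of_preserves) (auto simp: \<Omega>_def lc_coeff_def)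
    show "?D u w \<in> subbundle Q" if "u \<in> \<Gamma>" "w \<in> subbundle Q" for u w
      using that cases subset split(2)
      by (intro connection_of_preserves) (auto simp: \<Omega>_def lc_coeff_def)
    show "divergence_of \<A> ?D (e C) = cst (d C)" if C: "C < n" for C
    proof -
      have "divergence_of \<A> ?D (e C) = cst (\<Sum>A<n. \<eta> A * \<Omega> A C A)"
        unfolding divergence_of_eq[OF frame_section[OF C]] coord_def
        using C by (simp add: pairing_connection frame_section component_frame cst_mult cst_sum)
      also have "(\<Sum>A<n. \<eta> A * \<Omega> A C A) = d C"
      proof (cases "C \<in> P")
        case True
        have "(\<Sum>A<n. \<eta> A * \<Omega> A C A) = (\<Sum>A\<in>P. \<eta> A * pure_coeff d P A C A)"
          using subset True split by (intro sum.mono_neutral_cong_right) (auto simp: \<Omega>_def lc_coeff_def)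
        then show ?thesis using pure_coeff_divergence[OF subset(1) card(1) True] by simp
      next
        case False
        then have CQ: "C \<in> Q" using cases[OF C] by blast
        have "(\<Sum>A<n. \<eta> A * \<Omega> A C A) = (\<Sum>A\<in>Q. \<eta> A * pure_coeff d Q A C A)"
          using subset False CQ split by (intro sum.mono_neutral_cong_right) (auto simp: \<Omega>_def lc_coeff_def)
        then show ?thesis using pure_coeff_divergence[OF subset(2) card(2) CQ] by simp
      qed
      finally show ?thesis .
    qed
  qed
qed

text \<open>A Levi-Civita connection with divergence \<open>\<delta>\<close> exists, and for each of them Ricci-flatness is the
  same condition on the structure constants.\<close>

theorem generalized_einstein_iff_ricci_form:
  assumes split: "P \<union> Q = {..<n}" "P \<inter> Q = {}" and card: "card P \<ge> 2" "card Q \<ge> 2"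
    and E: "E_plus \<A> g = subbundle P" "E_minus \<A> g = subbundle Q"
    and \<delta>: "divergence_operator \<A> \<delta>" "\<And>A. A < n \<Longrightarrow> \<delta> (e A) = cst (d A)"
  shows "generalized_einstein \<A> g H F \<delta> \<longleftrightarrow>
    (\<forall>i\<in>Q. \<forall>b\<in>P. ricci_form \<eta> B d P Q i b = 0) \<and> (\<forall>b\<in>P. \<forall>i\<in>Q. ricci_form \<eta> B d Q P b i = 0)"
    (is "_ \<longleftrightarrow> ?flat")
proof -
  have swap: "Q \<union> P = {..<n}" "Q \<inter> P = {}" using split by auto
  have lt: "A < n" if "A \<in> P \<or> A \<in> Q" for A using that split by auto
  have ricci: "(\<forall>u\<in>E_minus \<A> g. \<forall>w\<in>E_plus \<A> g. ricci_plus \<A> g H F D u w = 0) \<and>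
      (\<forall>u\<in>E_plus \<A> g. \<forall>w\<in>E_minus \<A> g. ricci_minus \<A> g H F D u w = 0) \<longleftrightarrow> ?flat"
    if D: "framed_connection \<A> H F n e \<eta> B D"
      and tor: "\<And>u w x. u \<in> \<Gamma> \<Longrightarrow> w \<in> \<Gamma> \<Longrightarrow> x \<in> \<Gamma> \<Longrightarrow> torsion \<A> H F D u w x = 0"
      and pres: "\<And>u w. u \<in> \<Gamma> \<Longrightarrow> w \<in> subbundle P \<Longrightarrow> D u w \<in> subbundle P"
        "\<And>u w. u \<in> \<Gamma> \<Longrightarrow> w \<in> subbundle Q \<Longrightarrow> D u w \<in> subbundle Q"
      and div: "\<And>A. A < n \<Longrightarrow> divergence_of \<A> D (e A) = cst (d A)" for D
  proof -
    interpret framed_connection \<A> H F n e \<eta> B D by (rule D)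
    interpret PQ: levi_civita_frame \<A> H F n e \<eta> B D P Q
      by unfold_locales (use split tor pres in auto)
    interpret QP: levi_civita_frame \<A> H F n e \<eta> B D Q P
      by unfold_locales (use swap tor pres in auto)
    show ?thesis
      unfolding E ricci_plus_def ricci_minus_def
      using PQ.ricci_flat_iff[of d] QP.ricci_flat_iff[of d] div lt by blast
  qed
  show ?thesis
  proof
    assume "generalized_einstein \<A> g H F \<delta>"
    then obtain D where D: "levi_civita \<A> g H F D" "\<forall>u\<in>\<Gamma>. divergence_of \<A> D u = \<delta> u"
      and flat: "\<forall>u\<in>E_minus \<A> g. \<forall>w\<in>E_plus \<A> g. ricci_plus \<A> g H F D u w = 0"
        "\<forall>u\<in>E_plus \<A> g. \<forall>w\<in>E_minus \<A> g. ricci_minus \<A> g H F D u w = 0"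
      unfolding generalized_einstein_def by blast
    have conn: "framed_connection \<A> H F n e \<eta> B D"
      using D(1) unfolding levi_civita_def by unfold_locales blast
    then interpret framed_connection \<A> H F n e \<eta> B D .
    have pQ: "D u w \<in> subbundle Q" if "u \<in> \<Gamma>" "w \<in> subbundle Q" for u w
      using D(1) that unfolding levi_civita_def E by blast
    have pP: "D u w \<in> subbundle P" if u: "u \<in> \<Gamma>" and w: "w \<in> subbundle P" for u w
    proof -
      have "pairing (D u w) (e A) = 0" if "A < n" "A \<notin> P" for A
      proof -
        have A: "e A \<in> subbundle Q" using that split frame_subbundle by auto
        have "anchor u (pairing w (e A)) = pairing (D u w) (e A) + pairing w (D u (e A))"
          by (rule D_metric[OF u subbundle_section[OF w] subbundle_section[OF A]])
        then show ?thesis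
          using pairing_disjoint_subbundles[OF split(2) w A] pairing_disjoint_subbundles[OF split(2) w pQ[OF u A]]
            vector_field_0[OF anchor_vector_field[OF u]] by simp
      qed
      then show ?thesis using D_section[OF u subbundle_section[OF w]] by (simp add: subbundle_def)
    qed
    have tor: "torsion \<A> H F D u w x = 0" if "u \<in> \<Gamma>" "w \<in> \<Gamma>" "x \<in> \<Gamma>" for u w x
      using D(1) that unfolding levi_civita_def by blast
    have div: "divergence_of \<A> D (e A) = cst (d A)" if "A < n" for A
      using D(2) \<delta>(2) that frame_section by auto
    show ?flat using ricci[OF conn tor pP pQ div] flat by blast
  next
    assume flat: ?flat
    obtain D where D: "generalized_connection \<A> D"
      "\<And>u w x. u \<in> \<Gamma> \<Longrightarrow> w \<in> \<Gamma> \<Longrightarrow> x \<in> \<Gamma> \<Longrightarrow> torsion \<A> H F D u w x = 0"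
      "\<And>u w. u \<in> \<Gamma> \<Longrightarrow> w \<in> subbundle P \<Longrightarrow> D u w \<in> subbundle P"
      "\<And>u w. u \<in> \<Gamma> \<Longrightarrow> w \<in> subbundle Q \<Longrightarrow> D u w \<in> subbundle Q"
      "\<And>A. A < n \<Longrightarrow> divergence_of \<A> D (e A) = cst (d A)"
      using levi_civita_connection_exists[OF split card] by blast
    have conn: "framed_connection \<A> H F n e \<eta> B D" by unfold_locales (rule D(1))
    then interpret framed_connection \<A> H F n e \<eta> B D .
    have "divergence_of \<A> D u = \<delta> u" if u: "u \<in> \<Gamma>" for u
    proof -
      define \<tau> where "\<tau> u = divergence_of \<A> D u - \<delta> u" for u
      have "\<tau> u = (\<Sum>A<n. coord A u * \<tau> (e A))"
      proof (rule linear_on_sections[OF u])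
        fix u w assume mem: "u \<in> \<Gamma>" "w \<in> \<Gamma>"
        then have "\<delta> (u + w) = \<delta> u + \<delta> w" using \<delta>(1) unfolding divergence_operator_def by blast
        moreover have "divergence_of \<A> D (u + w) = divergence_of \<A> D u + divergence_of \<A> D w"
          using mem by (simp add: divergence_of_eq sections_add D_add_right coord_add D_section
              frame_section sum.distrib)
        ultimately show "\<tau> (u + w) = \<tau> u + \<tau> w" by (simp add: \<tau>_def)
      next
        fix f u assume f: "f \<in> R" and u: "u \<in> \<Gamma>"
        have "\<delta> (sscale f u) = anchor u f + f * \<delta> u"
          using \<delta>(1) f u unfolding divergence_operator_def by blast
        moreover have "divergence_of \<A> D (sscale f u) = anchor u f + f * divergence_of \<A> D u"
        proof -
          have "divergence_of \<A> D (sscale f u) =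
              (\<Sum>A<n. anchor (e A) f * coord A u + f * coord A (D (e A) u))"
            using f u by (simp add: divergence_of_eq sections_sscale D_sscale_right coord_add
                coord_sscale D_section frame_section anchor_smooth)
          also have "\<dots> = (\<Sum>A<n. coord A u * anchor (e A) f) + f * divergence_of \<A> D u"
            using u by (simp add: sum.distrib divergence_of_eq sum_distrib_left mult.commute)
          also have "(\<Sum>A<n. coord A u * anchor (e A) f) = anchor u f"
            by (rule linear_on_sections[OF u, of "\<lambda>u. anchor u f", symmetric]) (auto simp: fscale_apply)
          finally show ?thesis .
        qed
        ultimately show "\<tau> (sscale f u) = f * \<tau> u" by (simp add: \<tau>_def right_diff_distrib)
      qed
      also have "\<dots> = 0" using \<delta>(2) D(5) by (simp add: \<tau>_def)
      finally show ?thesis by (simp add: \<tau>_def)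
    qed
    moreover have "levi_civita \<A> g H F D"
      unfolding levi_civita_def E using D by blast
    ultimately show "generalized_einstein \<A> g H F \<delta>"
      unfolding generalized_einstein_def using ricci[OF conn D(2-5)] flat by blast
  qed
qed

end

section \<open>The orthonormal frame of a generalized metric\<close>

text \<open>The Levi-Civita symbol on \<open>{1, 2, 3}\<close>, written as a polynomial so that its symmetries are
  polynomial identities.\<close>

definition levi_symbol :: "nat \<Rightarrow> nat \<Rightarrow> nat \<Rightarrow> real" where
  "levi_symbol a b c = (real b - real a) * (real c - real b) * (real c - real a) / 2"

text \<open>For \<open>1 \<le> A \<le> 6\<close> the frame vector \<open>e\<^sub>A\<close> is \<open>v\<^sub>a + s g(v\<^sub>a)\<close> with \<open>a = base_index A\<close> and
  \<open>s = frame_sign A\<close>.\<close>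

definition base_index :: "nat \<Rightarrow> nat" where
  "base_index A = (if A \<le> 3 then A else A - 3)"

definition frame_sign :: "nat \<Rightarrow> real" where
  "frame_sign A = (if A \<le> 3 then 1 else - 1)"

definition frame_norm :: "(nat \<Rightarrow> real) \<Rightarrow> nat \<Rightarrow> real" where
  "frame_norm \<epsilon> A = (if A = 0 then 1 else frame_sign A * \<epsilon> (base_index A))"

text \<open>If an index is \<open>0\<close>, then it is cyclically moved to the front; the value is then a component of
  \<open>F\<close>, irrespective of the signs.\<close>

definition structure_constant ::
    "(nat \<Rightarrow> real) \<Rightarrow> real \<Rightarrow> (nat \<Rightarrow> nat \<Rightarrow> real) \<Rightarrow> nat \<Rightarrow> nat \<Rightarrow> nat \<Rightarrow> real" where
  "structure_constant \<alpha> h f A C K =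
     (if A = 0 then (if C = 0 \<or> K = 0 then 0 else f (base_index C) (base_index K))
      else if C = 0 then (if K = 0 then 0 else f (base_index K) (base_index A))
      else if K = 0 then f (base_index A) (base_index C)
      else levi_symbol (base_index A) (base_index C) (base_index K) / 2 *
        (frame_sign A * \<alpha> (base_index A) + frame_sign C * \<alpha> (base_index C)
          + frame_sign K * \<alpha> (base_index K) - h))"

locale orthonormal_setup = left_invariant_frame \<A> v
  for \<A> :: "('g::{topological_group_add,t2_space,second_countable_topology}, real^3) atlas" 
    and v :: "nat \<Rightarrow> 'g vfield" +
  fixes g F :: "'g form2" and H :: "'g form3" and \<delta> :: "'g sect \<Rightarrow> 'g scal"
    and \<epsilon> \<alpha> d :: "nat \<Rightarrow> real" and h :: real and f :: "nat \<Rightarrow> nat \<Rightarrow> real"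
  assumes metric: "pseudo_riemannian_metric \<A> g"
    and orthogonal: "\<And>a b. a \<in> {1..3} \<Longrightarrow> b \<in> {1..3} \<Longrightarrow> a \<noteq> b \<Longrightarrow> g (v a) (v b) = 0"
    and \<epsilon>_sign: "\<And>a. a \<in> {1..3} \<Longrightarrow> \<epsilon> a \<in> {- 1, 1}"
    and H_form: "H \<in> three_forms \<A>" and F_form: "F \<in> two_forms \<A>"
    and divergence: "divergence_operator \<A> \<delta>"
    and constants: "relative_constants g H F \<delta> v \<epsilon> \<alpha> h f d"
begin

lemma \<epsilon>_square: "a \<in> {1..3} \<Longrightarrow> \<epsilon> a * \<epsilon> a = 1"
  using \<epsilon>_sign[of a] by auto

lemma orthonormal: "a \<in> {1..3} \<Longrightarrow> b \<in> {1..3} \<Longrightarrow> g (v a) (v b) = cst (if a = b then \<epsilon> a else 0)"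
  using constants orthogonal[of a b] unfolding relative_constants_def by (auto simp: cst_0)

lemma metric_form: "X \<in> VF \<Longrightarrow> g X \<in> one_forms \<A>" "X \<in> VF \<Longrightarrow> (\<lambda>Y. g Y X) \<in> one_forms \<A>"
  using metric unfolding pseudo_riemannian_metric_def bilinear_forms_def by auto

lemma metric_commute: "X \<in> VF \<Longrightarrow> Y \<in> VF \<Longrightarrow> g X Y = g Y X"
  using metric unfolding pseudo_riemannian_metric_def by auto

lemma expand_vector_field: "X \<in> VF \<Longrightarrow> X = (\<Sum>a=1..3. fscale (cst (\<epsilon> a) * g X (v a)) (v a))"
  using orthonormal_expansion[OF metric orthonormal \<epsilon>_square] .

lemma expansion_coeff_smooth: "X \<in> VF \<Longrightarrow> a \<in> {1..3} \<Longrightarrow> cst (\<epsilon> a) * g X (v a) \<in> R"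
  using one_form_smooth[OF metric_form(1) basis_vector_field] smooth_funs_mult smooth_funs_cst by blast

lemma frame_induct:
  assumes X: "X \<in> VF" and base: "\<And>a. a \<in> {1..3} \<Longrightarrow> T (v a)"
    and add: "\<And>X Y. X \<in> VF \<Longrightarrow> Y \<in> VF \<Longrightarrow> T X \<Longrightarrow> T Y \<Longrightarrow> T (X + Y)"
    and scale: "\<And>k X. k \<in> R \<Longrightarrow> X \<in> VF \<Longrightarrow> T X \<Longrightarrow> T (fscale k X)"
  shows "T X"
proof -
  have mem: "fscale (cst (\<epsilon> a) * g X (v a)) (v a) \<in> VF" "T (fscale (cst (\<epsilon> a) * g X (v a)) (v a))"
    if "a \<in> {1..3}" for a
    using that X expansion_coeff_smooth basis_vector_field base
    by (auto intro!: vector_fields_fscale scale)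
  show ?thesis
    by (subst expand_vector_field[OF X], unfold sum_1_to_3(1)) (auto intro!: add mem vector_fields_plus)
qed

lemma one_form_eqI:
  assumes "\<xi> \<in> one_forms \<A>" "\<zeta> \<in> one_forms \<A>" "\<And>a. a \<in> {1..3} \<Longrightarrow> \<xi> (v a) = \<zeta> (v a)"
  shows "\<xi> = \<zeta>"
proof
  fix X show "\<xi> X = \<zeta> X"
  proof (cases "X \<in> VF")
    case True
    then show ?thesis
      by (rule frame_induct[where T = "\<lambda>X. \<xi> X = \<zeta> X"])
        (simp_all only: assms one_form_add[OF assms(1)] one_form_add[OF assms(2)]
          one_form_fscale[OF assms(1)] one_form_fscale[OF assms(2)])
  next
    case False
    then show ?thesis using one_form_outside[OF assms(1)] one_form_outside[OF assms(2)] by simp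
  qed
qed

lemma bracket_basis:
  assumes "a \<in> {1..3}" "b \<in> {1..3}"
  shows "lie_bracket (v a) (v b) = (\<Sum>c=1..3. fscale (cst (levi_symbol a b c * \<epsilon> c * \<alpha> c)) (v c))"
proof -
  have br: "lie_bracket (v 1) (v 2) = fscale (cst (\<epsilon> 3 * \<alpha> 3)) (v 3)"
    "lie_bracket (v 3) (v 1) = fscale (cst (\<epsilon> 2 * \<alpha> 2)) (v 2)"
    "lie_bracket (v 2) (v 3) = fscale (cst (\<epsilon> 1 * \<alpha> 1)) (v 1)"
    using constants unfolding relative_constants_def by auto
  have opp: "lie_bracket (v 2) (v 1) = fscale (cst (- (\<epsilon> 3 * \<alpha> 3))) (v 3)"
    "lie_bracket (v 1) (v 3) = fscale (cst (- (\<epsilon> 2 * \<alpha> 2))) (v 2)"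
    "lie_bracket (v 3) (v 2) = fscale (cst (- (\<epsilon> 1 * \<alpha> 1))) (v 1)"
    by (simp_all only: lie_bracket_commute[of "v 2" "v 1"] lie_bracket_commute[of "v 1" "v 3"]
        lie_bracket_commute[of "v 3" "v 2"] br) (simp_all add: fscale_def cst_def fun_eq_iff)
  have self: "lie_bracket X X = 0" for X :: "'g vfield"
    by (simp add: lie_bracket_def fun_eq_iff)
  have "\<forall>a\<in>{1..3}. \<forall>b\<in>{1..3}.
      lie_bracket (v a) (v b) = (\<Sum>c=1..3. fscale (cst (levi_symbol a b c * \<epsilon> c * \<alpha> c)) (v c))"
    unfolding ball_1_to_3(1) sum_1_to_3(1)
    by (intro conjI) (simp_all add: br opp br[simplified] opp[simplified] self levi_symbol_def cst_0 fscale_simps)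
  then show ?thesis using assms by blast
qed

lemma lie_bracket_closed:
  assumes X: "X \<in> VF" and Y: "Y \<in> VF" shows "lie_bracket X Y \<in> VF"
proof -
  have 1: "lie_bracket (v a) (v b) \<in> VF" if "a \<in> {1..3}" "b \<in> {1..3}" for a b
    unfolding bracket_basis[OF that]
    by (intro vector_fields_sum vector_fields_fscale smooth_funs_cst basis_vector_field)
  have 2: "lie_bracket (v a) Y \<in> VF" if a: "a \<in> {1..3}" for a
    using Y
  proof (rule frame_induct[where T = "\<lambda>Y. lie_bracket (v a) Y \<in> VF"])
    note va = basis_vector_field[OF a]
    show "lie_bracket (v a) (v b) \<in> VF" if "b \<in> {1..3}" for b using 1[OF a that] .
    show "lie_bracket (v a) (Y + Z) \<in> VF"
      if "Y \<in> VF" "Z \<in> VF" "lie_bracket (v a) Y \<in> VF" "lie_bracket (v a) Z \<in> VF" for Y Z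
      using that by (simp add: lie_bracket_add_right va vector_fields_plus)
    show "lie_bracket (v a) (fscale k Y) \<in> VF"
      if "k \<in> R" "Y \<in> VF" "lie_bracket (v a) Y \<in> VF" for k Y
      using that vector_field_smooth[OF va that(1)]
      by (simp add: lie_bracket_fscale_right va vector_fields_plus vector_fields_fscale)
  qed
  show ?thesis
    using X
  proof (rule frame_induct[where T = "\<lambda>X. lie_bracket X Y \<in> VF"])
    show "lie_bracket (v b) Y \<in> VF" if "b \<in> {1..3}" for b using 2[OF that] .
    show "lie_bracket (X + Z) Y \<in> VF"
      if "X \<in> VF" "Z \<in> VF" "lie_bracket X Y \<in> VF" "lie_bracket Z Y \<in> VF" for X Z
      using that Y by (simp add: lie_bracket_add_left vector_fields_plus)
    show "lie_bracket (fscale k X) Y \<in> VF"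
      if "k \<in> R" "X \<in> VF" "lie_bracket X Y \<in> VF" for k X
      using that Y vector_field_smooth[OF Y that(1)]
      by (simp add: lie_bracket_fscale_left vector_fields_diff vector_fields_fscale)
  qed
qed

sublocale courant_algebroid \<A> H F
  by unfold_locales (simp_all add: lie_bracket_closed H_form F_form)

lemma metric_bracket:
  assumes "a \<in> {1..3}" "b \<in> {1..3}" "c \<in> {1..3}"
  shows "g (lie_bracket (v a) (v b)) (v c) = cst (levi_symbol a b c * \<alpha> c)"
    "g (v c) (lie_bracket (v a) (v b)) = cst (levi_symbol a b c * \<alpha> c)"
proof -
  have form: "(\<lambda>Y. g Y (v c)) \<in> one_forms \<A>" using metric_form(2)[OF basis_vector_field[OF assms(3)]] .
  have mem: "fscale (cst k) (v x) \<in> VF" if "x \<in> {1..3}" for k x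
    using that by (intro vector_fields_fscale smooth_funs_cst basis_vector_field)
  have lin: "g (fscale (cst k) (v x)) (v c) = cst k * g (v x) (v c)" if "x \<in> {1..3}" for k x
    using one_form_fscale[OF form smooth_funs_cst basis_vector_field[OF that]] .
  have "g (lie_bracket (v a) (v b)) (v c) = (\<Sum>x=1..3. g (fscale (cst (levi_symbol a b x * \<epsilon> x * \<alpha> x)) (v x)) (v c))"
    unfolding bracket_basis[OF assms(1,2)] sum_1_to_3(1)
    using one_form_add[OF form] mem vector_fields_plus by simp
  also have "\<dots> = (\<Sum>x=1..3. if x = c then cst (levi_symbol a b c * \<alpha> c) else 0)"
  proof (rule sum.cong[OF refl])
    fix x :: nat assume x: "x \<in> {1..3}"
    show "g (fscale (cst (levi_symbol a b x * \<epsilon> x * \<alpha> x)) (v x)) (v c) = (if x = c then cst (levi_symbol a b c * \<alpha> c) else 0)"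
    proof -
      have e: "levi_symbol a b x * \<epsilon> x * \<alpha> x * \<epsilon> x = levi_symbol a b x * \<alpha> x" using \<epsilon>_square[OF x] by algebra
      have "g (fscale (cst (levi_symbol a b x * \<epsilon> x * \<alpha> x)) (v x)) (v c)
          = cst (levi_symbol a b x * \<epsilon> x * \<alpha> x) * cst (if x = c then \<epsilon> x else 0)"
        by (simp only: lin[OF x] orthonormal[OF x assms(3)])
      also have "\<dots> = cst (if x = c then levi_symbol a b x * \<alpha> x else 0)"
        using e by (simp only: cst_mult split: if_split) simp
      finally show ?thesis by (auto simp: cst_0)
    qed
  qed
  also have "\<dots> = cst (levi_symbol a b c * \<alpha> c)" using assms(3) by simp
  finally show 1: "g (lie_bracket (v a) (v b)) (v c) = cst (levi_symbol a b c * \<alpha> c)" .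
  then show "g (v c) (lie_bracket (v a) (v b)) = cst (levi_symbol a b c * \<alpha> c)"
    using metric_commute lie_bracket_closed basis_vector_field assms by metis
qed

lemma two_form_skew:
  assumes T: "T \<in> two_forms \<A>" and X: "X \<in> VF" and Y: "Y \<in> VF"
  shows "T Y X = - T X Y"
proof -
  have alt: "T Z Z = 0" if "Z \<in> VF" for Z using T that unfolding two_forms_def by blast
  have "T (X + Y) (X + Y) = T X X + T X Y + (T Y X + T Y Y)"
    using one_form_add[OF two_form_one_form'[OF T vector_fields_plus[OF X Y]] X Y]
      one_form_add[OF two_form_one_form[OF T X] X Y] one_form_add[OF two_form_one_form[OF T Y] X Y]
    by simp
  then have "T X Y + T Y X = 0" using alt X Y vector_fields_plus by (simp add: fun_eq_iff)
  then show ?thesis by (simp add: eq_neg_iff_add_eq_0 add.commute)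
qed

lemma F_basis: "a \<in> {1..3} \<Longrightarrow> b \<in> {1..3} \<Longrightarrow> F (v a) (v b) = cst (f a b)"
  using constants unfolding relative_constants_def by blast

lemma f_skew:
  assumes "a \<in> {1..3}" "b \<in> {1..3}" shows "f b a = - f a b"
proof -
  have "(cst (f b a) :: 'g scal) = - cst (f a b)"
    using two_form_skew[OF F_form basis_vector_field basis_vector_field] F_basis assms by metis
  then show ?thesis by (simp add: cst_def fun_eq_iff)
qed

lemma H_basis:
  assumes "a \<in> {1..3}" "b \<in> {1..3}" "c \<in> {1..3}"
  shows "H (v a) (v b) (v c) = cst (levi_symbol a b c * h)"
proof -
  have s23: "H X Z Y = - H X Y Z" and s13: "H Z Y X = - H X Y Z" if "X \<in> VF" "Y \<in> VF" "Z \<in> VF" for X Y Z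
    using two_form_skew[OF three_form_two_form[OF that(1)] that(2,3)]
      two_form_skew[OF three_form_two_form'[OF that(2)] that(1,3)] by auto
  have alt: "H X Y Y = 0" "H Y X Y = 0" "H Y Y X = 0" if "X \<in> VF" "Y \<in> VF" for X Y
    using three_form_two_form[OF that(1)] three_form_two_form'[OF that(1)] H_form that
    unfolding two_forms_def three_forms_def by auto
  have m: "v 1 \<in> VF" "v 2 \<in> VF" "v 3 \<in> VF" using basis_vector_field by auto
  have 123: "H (v 1) (v 2) (v 3) = cst h" using constants unfolding relative_constants_def by blast
  then have perm: "H (v 1) (v 3) (v 2) = cst (- h)" "H (v 3) (v 2) (v 1) = cst (- h)"
    "H (v 2) (v 3) (v 1) = cst h" "H (v 3) (v 1) (v 2) = cst h" "H (v 2) (v 1) (v 3) = cst (- h)"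
    using s23[OF m(1,2,3)] s13[OF m(1,2,3)] s23[OF m(3,2,1)] s13[OF m(1,3,2)] s13[OF m(3,1,2)]
    by (simp_all add: cst_minus flip: cst_minus)
  have "\<forall>a\<in>{1..3}. \<forall>b\<in>{1..3}. \<forall>c\<in>{1..3}. H (v a) (v b) (v c) = cst (levi_symbol a b c * h)"
    unfolding ball_1_to_3(1)
    by (intro conjI) (simp_all add: alt m m[simplified] 123[simplified] perm[simplified] levi_symbol_def cst_0)
  then show ?thesis using assms by blast
qed

end

lemma sum_less_7: "(\<Sum>A<7. k A) = k 0 + (\<Sum>a=1..3. k a) + (\<Sum>a=1..3. k (a + 3))"
  for k :: "nat \<Rightarrow> 'y::comm_monoid_add"
  by (simp add: sum_1_to_3 eval_nat_numeral lessThan_Suc add_ac)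

context orthonormal_setup
begin

text \<open>The section \<open>v\<^sub>a + s g(v\<^sub>a)\<close>, in the graph of \<open>s g\<close>. A real parameter \<open>s\<close> treats both halves of the
  frame at once.\<close>

definition graph_vec :: "real \<Rightarrow> nat \<Rightarrow> 'g sect" where
  "graph_vec s a = (v a, fscale (cst s) (g (v a)), 0)"

definition e0 :: "'g sect" where
  "e0 = (0, 0, 1)"

lemma base_index_range: "A < 7 \<Longrightarrow> A \<noteq> 0 \<Longrightarrow> base_index A \<in> {1..3}"
  by (auto simp: base_index_def)

lemma basis_E_0: "basis_E g v 0 = e0"
  by (simp add: basis_E_def e0_def)

lemma basis_E_graph_vec: "A \<noteq> 0 \<Longrightarrow> basis_E g v A = graph_vec (frame_sign A) (base_index A)"
  by (auto simp: basis_E_def graph_vec_def frame_sign_def base_index_def fscale_def cst_def fun_eq_iff)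

lemma one_form_0: "\<xi> \<in> one_forms \<A> \<Longrightarrow> \<xi> 0 = 0"
  using one_form_add[of \<xi> \<A> 0 0] vector_fields_0 by (simp add: fun_eq_iff)

lemma e0_section: "e0 \<in> \<Gamma>"
  by (simp add: e0_def sections_def vector_fields_0 one_forms_0 smooth_funs_1)

lemma graph_vec_section: "a \<in> {1..3} \<Longrightarrow> graph_vec s a \<in> \<Gamma>"
  unfolding graph_vec_def sections_def using basis_vector_field[of a]
  by (simp add: one_forms_fscale smooth_funs_cst metric_form smooth_funs_0)

lemma basis_E_section: "A < 7 \<Longrightarrow> basis_E g v A \<in> \<Gamma>"
  using basis_E_graph_vec[of A] graph_vec_section[OF base_index_range[of A]] e0_section
  by (cases "A = 0") (simp_all add: basis_E_0)

lemma pairing_graph_vec_right: 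
  assumes a: "a \<in> {1..3}" and u: "(X, \<xi>, l) \<in> \<Gamma>"
  shows "pairing (X, \<xi>, l) (graph_vec s a) = cst (1/2) * (\<xi> (v a) + cst s * g X (v a))"
proof -
  have "X \<in> VF" using u by (simp add: sections_def)
  then show ?thesis
    using metric_commute[OF basis_vector_field[OF a], of X] by (simp add: pairing_def graph_vec_def fscale_apply)
qed

lemma pairing_e0_right: 
  assumes "(X, \<xi>, l) \<in> \<Gamma>"
  shows "pairing (X, \<xi>, l) e0 = l"
  using assms one_form_0[of \<xi>] by (simp add: pairing_def e0_def sections_def)

lemma pairing_basis_E:
  assumes A: "A < 7" and C: "C < 7"
  shows "pairing (basis_E g v A) (basis_E g v C) = cst (if A = C then frame_norm \<epsilon> A else 0)"
proof -
  have pp: "pairing (graph_vec s a) (graph_vec t b) = cst (if a = b then (s + t) / 2 * \<epsilon> a else 0)"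
    if "a \<in> {1..3}" "b \<in> {1..3}" for s t a b
    using pairing_graph_vec_right[OF that(2), of "v a" "fscale (cst s) (g (v a))" 0 t] graph_vec_section[OF that(1)]
    by (simp add: graph_vec_def fscale_apply orthonormal[OF that] cst_mult cst_add)
      (auto simp: cst_def fun_eq_iff algebra_simps)
  have p0: "pairing (graph_vec s a) e0 = 0" if "a \<in> {1..3}" for s a
    using pairing_e0_right[of "v a" "fscale (cst s) (g (v a))" 0] graph_vec_section[OF that] by (simp add: graph_vec_def)
  have 00: "pairing e0 e0 = cst 1"
    using pairing_e0_right[of 0 0 1] e0_section by (simp add: e0_def cst_1)
  show ?thesis
  proof (cases "A = 0 \<or> C = 0")
    case True
    then show ?thesis
      using 00 p0[OF base_index_range[OF A]] p0[OF base_index_range[OF C]] 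
        pairing_commute[of e0 "basis_E g v C"]
      by (auto simp: basis_E_0 basis_E_graph_vec frame_norm_def cst_0)
  next
    case False
    have "base_index A = base_index C \<Longrightarrow> A \<noteq> C \<Longrightarrow> frame_sign A + frame_sign C = 0"
      using A C False by (auto simp: base_index_def frame_sign_def split: if_splits)
    then show ?thesis
      using False pp[OF base_index_range[OF A] base_index_range[OF C]]
      by (auto simp: basis_E_graph_vec frame_norm_def cst_0)
  qed
qed

lemma frame_norm_square: "A < 7 \<Longrightarrow> frame_norm \<epsilon> A * frame_norm \<epsilon> A = 1"
  using \<epsilon>_square[OF base_index_range[of A]] by (auto simp: frame_norm_def frame_sign_def)

text \<open>The vectors \<open>v\<^sub>a \<plusminus> g(v\<^sub>a)\<close> together contribute \<open>\<epsilon>\<^sub>a g(X, v\<^sub>a) v\<^sub>a\<close> to the vector field and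
  \<open>\<epsilon>\<^sub>a \<xi>(v\<^sub>a) g(v\<^sub>a)\<close> to the one-form.\<close>

lemma frame_expansion:
  assumes u: "u \<in> \<Gamma>"
  shows "u = (\<Sum>A<7. sscale (cst (frame_norm \<epsilon> A) * pairing u (basis_E g v A)) (basis_E g v A))"
proof -
  obtain X \<xi> l where eq: "u = (X, \<xi>, l)" by (rule prod_cases3)
  have mem: "X \<in> VF" "\<xi> \<in> one_forms \<A>" "l \<in> R" using u eq by (auto simp: sections_def)
  have basis: "basis_E g v a = graph_vec 1 a" "basis_E g v (a + 3) = graph_vec (- 1) a"
    "frame_norm \<epsilon> a = \<epsilon> a" "frame_norm \<epsilon> (a + 3) = - \<epsilon> a" if "a \<in> {1..3}" for a
    using that basis_E_graph_vec[of a] basis_E_graph_vec[of "a + 3"]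
    by (auto simp: frame_sign_def base_index_def frame_norm_def)
  have pair: "sscale (cst (\<epsilon> a) * pairing u (graph_vec 1 a)) (graph_vec 1 a)
      + sscale (cst (- \<epsilon> a) * pairing u (graph_vec (- 1) a)) (graph_vec (- 1) a)
    = (fscale (cst (\<epsilon> a) * g X (v a)) (v a), fscale (cst (\<epsilon> a) * \<xi> (v a)) (g (v a)), 0)"
    if a: "a \<in> {1..3}" for a
    unfolding eq using pairing_graph_vec_right[OF a u[unfolded eq]]
    by (simp add: graph_vec_def sscale_def) (simp add: fscale_def cst_def fun_eq_iff field_simps)
  have \<xi>: "\<xi> = (\<Sum>a=1..3. fscale (cst (\<epsilon> a) * \<xi> (v a)) (g (v a)))" (is "_ = ?\<zeta>")
  proof (rule one_form_eqI[OF mem(2)])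
    have form: "fscale (cst (\<epsilon> a) * \<xi> (v a)) (g (v a)) \<in> one_forms \<A>" if "a \<in> {1..3}" for a
      using one_form_smooth[OF mem(2) basis_vector_field[OF that]] metric_form(1)[OF basis_vector_field[OF that]]
      by (intro one_forms_fscale smooth_funs_mult smooth_funs_cst)
    then show "?\<zeta> \<in> one_forms \<A>" unfolding sum_1_to_3(1) by (intro one_forms_add) auto
    fix b :: nat assume b: "b \<in> {1..3}"
    have "?\<zeta> (v b) = (\<Sum>a=1..3. fscale (cst (\<epsilon> a) * \<xi> (v a)) (g (v a)) (v b))"
      by (rule sum_apply)
    also have "\<dots> = (\<Sum>a=1..3. if a = b then \<xi> (v b) else 0)"
    proof (rule sum.cong[OF refl])
      fix a :: nat assume a: "a \<in> {1..3}"
      show "fscale (cst (\<epsilon> a) * \<xi> (v a)) (g (v a)) (v b) = (if a = b then \<xi> (v b) else 0)"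
        unfolding fscale_apply orthonormal[OF a b] using \<epsilon>_square[OF a]
        by (auto simp: cst_def fun_eq_iff)
    qed
    finally show "\<xi> (v b) = ?\<zeta> (v b)" using b by simp
  qed
  have sum3: "(\<Sum>a=1..3. (x a, y a, 0)) = (\<Sum>a=1..3. x a, \<Sum>a=1..3. y a, 0)"
    for x :: "nat \<Rightarrow> 'g vfield" and y :: "nat \<Rightarrow> 'g form1"
    by (simp add: sum_1_to_3)
  have e0: "sscale (cst (frame_norm \<epsilon> 0) * pairing u (basis_E g v 0)) (basis_E g v 0) = (0, 0, l)"
    using pairing_e0_right[OF u[unfolded eq]]
    by (simp add: eq basis_E_0 frame_norm_def cst_1) (simp add: e0_def sscale_def fscale_simps)
  have "(\<Sum>A<7. sscale (cst (frame_norm \<epsilon> A) * pairing u (basis_E g v A)) (basis_E g v A)) =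
      (0, 0, l) + (\<Sum>a=1..3. sscale (cst (\<epsilon> a) * pairing u (graph_vec 1 a)) (graph_vec 1 a)
      + sscale (cst (- \<epsilon> a) * pairing u (graph_vec (- 1) a)) (graph_vec (- 1) a))"
    unfolding sum_less_7 e0 sum.distrib using basis by (simp add: add.assoc)
  also have "\<dots> = (0, 0, l) + (\<Sum>a=1..3. fscale (cst (\<epsilon> a) * g X (v a)) (v a), ?\<zeta>, 0)"
    unfolding sum3[symmetric] using pair by simp
  also have "\<dots> = u" unfolding \<xi>[symmetric] expand_vector_field[OF mem(1), symmetric] by (simp add: eq)
  finally show ?thesis ..
qed

lemma calculus_at_zero:
  assumes "Y \<in> VF"
  shows "lie_bracket 0 Y = 0" "lie_bracket Y 0 = 0" "H 0 Y = 0" "H Y 0 = 0" "F 0 = 0"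
    "diff1 \<A> 0 Y = 0" "lie_derivative \<A> Y 0 = 0" "diff0 \<A> 1 = 0"
    "\<xi> \<in> one_forms \<A> \<Longrightarrow> lie_derivative \<A> 0 \<xi> = 0" "\<xi> \<in> one_forms \<A> \<Longrightarrow> diff1 \<A> \<xi> 0 = 0"
proof -
  have br: "lie_bracket 0 Z = 0" if "Z \<in> VF" for Z
    using vector_field_0[OF that] by (simp add: lie_bracket_def fun_eq_iff)
  then show "lie_bracket 0 Y = 0" using assms .
  then show "lie_bracket Y 0 = 0" using lie_bracket_commute[of Y 0] by simp
  show "H 0 Y = 0" "H Y 0 = 0" "F 0 = 0"
    using form_linear(2,4,6)[OF vector_fields_0 vector_fields_0 assms smooth_funs_0]
    by (simp_all add: fscale_simps)
  show "diff1 \<A> 0 Y = 0" "lie_derivative \<A> Y 0 = 0" "diff0 \<A> 1 = 0"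
    using vector_field_0 vector_field_0[OF assms] vector_field_cst[of _ 1]
    by (auto simp: diff1_def lie_derivative_def diff0_def restrict_form_def fun_eq_iff cst_1)
  assume \<xi>: "\<xi> \<in> one_forms \<A>"
  show "lie_derivative \<A> 0 \<xi> = 0" "diff1 \<A> \<xi> 0 = 0"
  proof -
    have "\<xi> (lie_bracket 0 Z) = 0" "Z (\<xi> 0) = 0" if "Z \<in> VF" for Z
      using br[OF that] vector_field_0[OF that] one_form_0[OF \<xi>] by simp_all
    then show "lie_derivative \<A> 0 \<xi> = 0" "diff1 \<A> \<xi> 0 = 0"
      by (auto simp: diff1_def lie_derivative_def restrict_form_def fun_eq_iff)
  qed
qed

lemma dorfman_e0_e0: "dorf e0 e0 = 0"
  by (simp add: dorfman_def e0_def calculus_at_zero[OF vector_fields_0] calculus_at_zero(9,10)[OF vector_fields_0 one_forms_0]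
      fscale_simps zero_prod_def)

lemma dorfman_e0_graph_vec:
  assumes b: "b \<in> {1..3}" and c: "c \<in> {1..3}"
  shows "pairing (dorf e0 (graph_vec t b)) (graph_vec r c) = cst (f b c)" "pairing (dorf e0 (graph_vec t b)) e0 = 0"
proof -
  note vb = basis_vector_field[OF b]
  have form: "fscale (cst t) (g (v b)) \<in> one_forms \<A>"
    by (intro one_forms_fscale smooth_funs_cst metric_form vb)
  have eq: "dorf e0 (graph_vec t b) = (0, fscale 2 (F (v b)), 0)"
    using vector_field_cst[OF vb, of 1]
    by (simp add: dorfman_def e0_def graph_vec_def calculus_at_zero[OF vb] calculus_at_zero(9)[OF vb form] fscale_simps cst_1)
  have mem: "(0, fscale 2 (F (v b)), 0) \<in> \<Gamma>"
    using dorfman_section[OF e0_section graph_vec_section[OF b]] unfolding eq[symmetric] .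
  have "g 0 (v c) = 0" using one_form_0[OF metric_form(2)[OF basis_vector_field[OF c]]] .
  then show "pairing (dorf e0 (graph_vec t b)) (graph_vec r c) = cst (f b c)"
    unfolding eq pairing_graph_vec_right[OF c mem] fscale_apply F_basis[OF b c]
    by (simp add: cst_def fun_eq_iff)
  show "pairing (dorf e0 (graph_vec t b)) e0 = 0" unfolding eq pairing_e0_right[OF mem] ..
qed

lemma dorfman_graph_vec_e0:
  assumes a: "a \<in> {1..3}" and c: "c \<in> {1..3}"
  shows "pairing (dorf (graph_vec s a) e0) (graph_vec r c) = cst (f c a)" "pairing (dorf (graph_vec s a) e0) e0 = 0"
proof -
  note va = basis_vector_field[OF a]
  have form: "fscale (cst s) (g (v a)) \<in> one_forms \<A>"
    by (intro one_forms_fscale smooth_funs_cst metric_form va)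
  have diff0_0: "diff0 \<A> 0 = 0"
    using vector_field_0 by (auto simp: diff0_def restrict_form_def fun_eq_iff)
  have "F (v a) 0 = 0" using one_form_0[OF two_form_one_form[OF F_form va]] .
  then have eq: "dorf (graph_vec s a) e0 = (0, - fscale 2 (F (v a)), 0)"
    using vector_field_cst[OF va, of 1]
    by (simp add: dorfman_def e0_def graph_vec_def calculus_at_zero[OF va] calculus_at_zero(10)[OF va form] fscale_simps cst_1 diff0_0)
  have mem: "(0, - fscale 2 (F (v a)), 0) \<in> \<Gamma>"
    using dorfman_section[OF graph_vec_section[OF a] e0_section] unfolding eq[symmetric] .
  have "g 0 (v c) = 0" using one_form_0[OF metric_form(2)[OF basis_vector_field[OF c]]] .
  then show "pairing (dorf (graph_vec s a) e0) (graph_vec r c) = cst (f c a)"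
    unfolding eq pairing_graph_vec_right[OF c mem] uminus_apply fscale_apply F_basis[OF a c] f_skew[OF a c]
    by (simp add: cst_def fun_eq_iff)
  show "pairing (dorf (graph_vec s a) e0) e0 = 0" unfolding eq pairing_e0_right[OF mem] ..
qed

text \<open>For left-invariant sections all derivatives of functions vanish, so only Lie brackets, \<open>H\<close> and \<open>F\<close>
  remain. The three bracket terms are the same number \<open>\<plusminus>levi_symbol a b c\<close> times \<open>\<alpha>\<close> at different
  indices.\<close>

lemma dorfman_graph_vec_graph_vec:
  assumes a: "a \<in> {1..3}" and b: "b \<in> {1..3}" and c: "c \<in> {1..3}"
  shows "pairing (dorf (graph_vec s a) (graph_vec t b)) (graph_vec r c) = cst (levi_symbol a b c / 2 * (s * \<alpha> a + t * \<alpha> b + r * \<alpha> c - h))"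
    and "pairing (dorf (graph_vec s a) (graph_vec t b)) e0 = cst (f a b)"
proof -
  note va = basis_vector_field[OF a] and vb = basis_vector_field[OF b] and vc = basis_vector_field[OF c]
  define \<zeta> where "\<zeta> = lie_derivative \<A> (v a) (fscale (cst t) (g (v b))) - diff1 \<A> (fscale (cst s) (g (v a))) (v b)
      + H (v b) (v a)"
  have eq: "dorf (graph_vec s a) (graph_vec t b) = (lie_bracket (v a) (v b), \<zeta>, cst (f a b))"
    using vector_field_0[OF va] vector_field_0[OF vb] F_basis[OF a b]
    by (simp add: dorfman_def graph_vec_def fscale_simps \<zeta>_def)
  have mem: "(lie_bracket (v a) (v b), \<zeta>, cst (f a b)) \<in> \<Gamma>"
    using dorfman_section[OF graph_vec_section[OF a] graph_vec_section[OF b]] unfolding eq[symmetric] .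
  have "\<zeta> (v c) = - cst t * cst (levi_symbol a c b * \<alpha> b) + cst s * cst (levi_symbol b c a * \<alpha> a) + cst (levi_symbol b a c * h)"
    using va vb vc
    by (simp add: \<zeta>_def lie_derivative_def diff1_def restrict_form_def fscale_apply orthonormal[OF b c]
        orthonormal[OF a c] orthonormal[OF a b] metric_bracket(2)[OF a c b] metric_bracket(2)[OF b c a]
        H_basis[OF b a c] cst_mult vector_field_cst cst_minus)
      (simp add: cst_def fun_eq_iff)
  then show "pairing (dorf (graph_vec s a) (graph_vec t b)) (graph_vec r c) = cst (levi_symbol a b c / 2 * (s * \<alpha> a + t * \<alpha> b + r * \<alpha> c - h))"
    unfolding eq pairing_graph_vec_right[OF c mem] metric_bracket(1)[OF a b c]
    by (simp add: cst_def fun_eq_iff levi_symbol_def) (simp add: field_simps)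
  show "pairing (dorf (graph_vec s a) (graph_vec t b)) e0 = cst (f a b)" unfolding eq pairing_e0_right[OF mem] ..
qed

lemma structure_constants_E:
  assumes A: "A < 7" and C: "C < 7" and K: "K < 7"
  shows "pairing (dorf (basis_E g v A) (basis_E g v C)) (basis_E g v K) = cst (structure_constant \<alpha> h f A C K)"
proof -
  note ranges = base_index_range[OF A] base_index_range[OF C] base_index_range[OF K]
  show ?thesis
    using ranges pairing_0_left[OF e0_section] pairing_0_left[OF graph_vec_section[OF ranges(3)]]
    by (cases "A = 0"; cases "C = 0"; cases "K = 0")
      (auto simp: basis_E_0 basis_E_graph_vec structure_constant_def dorfman_e0_e0 dorfman_e0_graph_vec dorfman_graph_vec_e0
        dorfman_graph_vec_graph_vec cst_0)
qed

lemma structure_constant_skew: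
  assumes A: "A < 7" and C: "C < 7" and K: "K < 7"
  shows "structure_constant \<alpha> h f C A K = - structure_constant \<alpha> h f A C K"
    "structure_constant \<alpha> h f A K C = - structure_constant \<alpha> h f A C K"
proof -
  note ranges = base_index_range[OF A] base_index_range[OF C] base_index_range[OF K]
  have l: "levi_symbol b a c = - levi_symbol a b c" "levi_symbol a c b = - levi_symbol a b c" for a b c
    by (simp_all add: levi_symbol_def field_simps)
  show "structure_constant \<alpha> h f C A K = - structure_constant \<alpha> h f A C K"
    using ranges f_skew[of "base_index A" "base_index C"] f_skew[of "base_index A" "base_index K"]
      f_skew[of "base_index C" "base_index K"]
    by (auto simp: structure_constant_def l(1)[of "base_index A" "base_index C"] add.commute)
  show "structure_constant \<alpha> h f A K C = - structure_constant \<alpha> h f A C K"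
    using ranges f_skew[of "base_index A" "base_index C"] f_skew[of "base_index A" "base_index K"]
      f_skew[of "base_index C" "base_index K"]
    by (auto simp: structure_constant_def l(2)[of "base_index A" "base_index C" "base_index K"] algebra_simps)
qed

sublocale courant_frame \<A> H F 7 "basis_E g v" "frame_norm \<epsilon>" "structure_constant \<alpha> h f"
  by unfold_locales
    (fact basis_E_section pairing_basis_E frame_norm_square frame_expansion structure_constants_E
      structure_constant_skew)+

text \<open>A section orthogonal to \<open>e\<^sub>0, \<dots>, e\<^sub>3\<close> has no function part, and its one-form takes the value
  \<open>- g(X, v\<^sub>a)\<close> on \<open>v\<^sub>a\<close>.\<close>

lemma E_minus_eq: "E_minus \<A> g = subbundle {4, 5, 6}"
proof (intro equalityI subsetI)
  fix u assume "u \<in> E_minus \<A> g"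
  then obtain X where u: "u = (X, - g X, 0)" and X: "X \<in> VF" unfolding E_minus_def by blast
  have "- g X = fscale (cst (- 1)) (g X)" by (simp add: fscale_def cst_def fun_eq_iff)
  then have mem: "u \<in> \<Gamma>"
    using X metric_form(1)[OF X] unfolding u sections_def
    by (simp add: one_forms_fscale smooth_funs_cst smooth_funs_0)
  have "pairing u (basis_E g v A) = 0" if "A < 7" "A \<notin> {4, 5, 6}" for A
  proof (cases "A = 0")
    case True
    then show ?thesis using pairing_e0_right[OF mem[unfolded u]] by (simp add: u basis_E_0)
  next
    case False
    then have A: "A \<in> {1..3}" "basis_E g v A = graph_vec 1 A"
      using that basis_E_graph_vec[of A] by (auto simp: frame_sign_def base_index_def)
    then show ?thesis using pairing_graph_vec_right[OF A(1) mem[unfolded u], of 1] by (simp add: u cst_1)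
  qed
  then show "u \<in> subbundle {4, 5, 6}" using mem by (simp add: subbundle_def)
next
  fix u assume u: "u \<in> subbundle {4, 5, 6}"
  obtain X \<xi> l where eq: "u = (X, \<xi>, l)" by (rule prod_cases3)
  have mem: "(X, \<xi>, l) \<in> \<Gamma>" "X \<in> VF" "\<xi> \<in> one_forms \<A>" using u eq by (auto simp: subbundle_def sections_def)
  have l: "l = 0" 
  proof -
    have "pairing u (basis_E g v 0) = 0" using u by (simp add: subbundle_def)
    then show ?thesis using pairing_e0_right[OF mem(1)] by (simp add: eq basis_E_0)
  qed
  have "- g X = fscale (cst (- 1)) (g X)" by (simp add: fscale_def cst_def fun_eq_iff)
  then have form: "- g X \<in> one_forms \<A>" using metric_form(1)[OF mem(2)] one_forms_fscale smooth_funs_cst by metis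
  have "\<xi> (v a) = (- g X) (v a)" if a: "a \<in> {1..3}" for a
  proof -
    have "basis_E g v a = graph_vec 1 a"
      using a basis_E_graph_vec[of a] by (auto simp: frame_sign_def base_index_def)
    moreover have "a < 7" "a \<notin> {4, 5, 6}" using a by auto
    then have "pairing u (basis_E g v a) = 0" using u unfolding subbundle_def by blast
    ultimately have "pairing u (graph_vec 1 a) = 0" by simp
    then show ?thesis
      using pairing_graph_vec_right[OF a mem(1), of 1] by (simp add: eq cst_def fun_eq_iff eq_neg_iff_add_eq_0)
  qed
  then have "\<xi> = - g X" by (rule one_form_eqI[OF mem(3) form])
  then show "u \<in> E_minus \<A> g" using eq l mem(2) unfolding E_minus_def by blast
qed

lemma E_plus_eq: "E_plus \<A> g = subbundle {0, 1, 2, 3}"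
proof (intro equalityI subsetI)
  fix u assume "u \<in> E_plus \<A> g"
  then have u: "u \<in> \<Gamma>" "\<And>w. w \<in> subbundle {4, 5, 6} \<Longrightarrow> pairing u w = 0"
    unfolding E_plus_def E_minus_eq by auto
  have "pairing u (basis_E g v A) = 0" if "A < 7" "A \<notin> {0, 1, 2, 3}" for A
  proof -
    have "A \<in> {4, 5, 6}" using that by auto
    then show ?thesis by (rule u(2)[OF frame_subbundle[OF _ that(1)]])
  qed
  then show "u \<in> subbundle {0, 1, 2, 3}" using u(1) by (simp add: subbundle_def)
next
  fix u assume u: "u \<in> subbundle {0, 1, 2, 3}"
  have "{0, 1, 2, 3} \<inter> {4, 5, 6} = ({} :: nat set)" by auto
  then have "pairing u w = 0" if "w \<in> subbundle {4, 5, 6}" for w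
    using pairing_disjoint_subbundles[OF _ u that] by blast
  then show "u \<in> E_plus \<A> g"
    using subbundle_section[OF u] unfolding E_plus_def E_minus_eq by blast
qed

theorem generalized_einstein_iff_ricci_forms_vanish:
  "generalized_einstein \<A> g H F \<delta> \<longleftrightarrow>
    (\<forall>i\<in>{4, 5, 6}. \<forall>b\<in>{0, 1, 2, 3}.
      ricci_form (frame_norm \<epsilon>) (structure_constant \<alpha> h f) d {0, 1, 2, 3} {4, 5, 6} i b = 0) \<and>
    (\<forall>b\<in>{0, 1, 2, 3}. \<forall>i\<in>{4, 5, 6}.
      ricci_form (frame_norm \<epsilon>) (structure_constant \<alpha> h f) d {4, 5, 6} {0, 1, 2, 3} b i = 0)"
proof (rule generalized_einstein_iff_ricci_form)
  show "{0, 1, 2, 3} \<union> {4, 5, 6} = {..<7::nat}" by auto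
  show "\<delta> (basis_E g v A) = cst (d A)" if "A < 7" for A
    using constants that unfolding relative_constants_def by (auto simp: Ball_def)
qed (simp_all add: E_plus_eq E_minus_eq divergence)

end

section \<open>The Einstein equations in dimension three\<close>

text \<open>The common value of both Ricci curvatures at \<open>(e\<^bsub>i+3\<^esub>, e\<^sub>i)\<close>; \<open>(i, j, k)\<close> is a cyclic permutation of
  \<open>(1, 2, 3)\<close>.\<close>

definition ricci_diagonal :: "(nat \<Rightarrow> real) \<Rightarrow> (nat \<Rightarrow> real) \<Rightarrow> real \<Rightarrow> (nat \<Rightarrow> nat \<Rightarrow> real) \<Rightarrow> nat \<Rightarrow> nat \<Rightarrow> nat \<Rightarrow> real" where
  "ricci_diagonal \<epsilon> \<alpha> h f i j k =
     - \<epsilon> j * \<epsilon> k / 2 * ((\<alpha> j - \<alpha> k)\<^sup>2 + h\<^sup>2 - (\<alpha> i)\<^sup>2) - (\<epsilon> j * (f i j)\<^sup>2 + \<epsilon> k * (f k i)\<^sup>2)"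

abbreviation "ric_plus \<epsilon> \<alpha> h f d \<equiv> ricci_form (frame_norm \<epsilon>) (structure_constant \<alpha> h f) d {0, 1, 2, 3} {4, 5, 6}"
abbreviation "ric_minus \<epsilon> \<alpha> h f d \<equiv> ricci_form (frame_norm \<epsilon>) (structure_constant \<alpha> h f) d {4, 5, 6} {0, 1, 2, 3}"

text \<open>All \<open>24\<close> components. They are polynomial identities, obtained by writing out the sums; on the
  right, the indices of \<open>f\<close> are brought into cyclic order.\<close>

lemma ricci_form_values:
  assumes f: "f 1 1 = 0" "f 2 2 = 0" "f 3 3 = 0" "f 2 1 = - f 1 2" "f 3 2 = - f 2 3" "f 1 3 = - f 3 1"
  shows
    "ric_plus \<epsilon> \<alpha> h f d 4 1 = ricci_diagonal \<epsilon> \<alpha> h f 1 2 3" "ric_minus \<epsilon> \<alpha> h f d 1 4 = ricci_diagonal \<epsilon> \<alpha> h f 1 2 3"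
    "ric_plus \<epsilon> \<alpha> h f d 5 2 = ricci_diagonal \<epsilon> \<alpha> h f 2 3 1" "ric_minus \<epsilon> \<alpha> h f d 2 5 = ricci_diagonal \<epsilon> \<alpha> h f 2 3 1"
    "ric_plus \<epsilon> \<alpha> h f d 6 3 = ricci_diagonal \<epsilon> \<alpha> h f 3 1 2" "ric_minus \<epsilon> \<alpha> h f d 3 6 = ricci_diagonal \<epsilon> \<alpha> h f 3 1 2"
    "ric_plus \<epsilon> \<alpha> h f d 4 0 = \<epsilon> 2 * \<epsilon> 3 * f 2 3 * (\<alpha> 1 + h) - (\<epsilon> 2 * f 1 2 * d 2 - \<epsilon> 3 * f 3 1 * d 3)"
    "ric_plus \<epsilon> \<alpha> h f d 5 0 = \<epsilon> 3 * \<epsilon> 1 * f 3 1 * (\<alpha> 2 + h) - (\<epsilon> 3 * f 2 3 * d 3 - \<epsilon> 1 * f 1 2 * d 1)"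
    "ric_plus \<epsilon> \<alpha> h f d 6 0 = \<epsilon> 1 * \<epsilon> 2 * f 1 2 * (\<alpha> 3 + h) - (\<epsilon> 1 * f 3 1 * d 1 - \<epsilon> 2 * f 2 3 * d 2)"
    "ric_minus \<epsilon> \<alpha> h f d 0 4 = \<epsilon> 2 * \<epsilon> 3 * f 2 3 * (\<alpha> 1 + h) - (\<epsilon> 2 * f 1 2 * d 5 - \<epsilon> 3 * f 3 1 * d 6)"
    "ric_minus \<epsilon> \<alpha> h f d 0 5 = \<epsilon> 3 * \<epsilon> 1 * f 3 1 * (\<alpha> 2 + h) - (\<epsilon> 3 * f 2 3 * d 6 - \<epsilon> 1 * f 1 2 * d 4)"
    "ric_minus \<epsilon> \<alpha> h f d 0 6 = \<epsilon> 1 * \<epsilon> 2 * f 1 2 * (\<alpha> 3 + h) - (\<epsilon> 1 * f 3 1 * d 4 - \<epsilon> 2 * f 2 3 * d 5)"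
    "ric_plus \<epsilon> \<alpha> h f d 4 2 = f 1 2 * d 0 + \<epsilon> 3 / 2 * (- \<alpha> 1 + \<alpha> 2 + \<alpha> 3 - h) * d 3 + \<epsilon> 3 * f 3 1 * f 2 3"
    "ric_plus \<epsilon> \<alpha> h f d 5 1 = - f 1 2 * d 0 - \<epsilon> 3 / 2 * (\<alpha> 1 - \<alpha> 2 + \<alpha> 3 - h) * d 3 + \<epsilon> 3 * f 3 1 * f 2 3"
    "ric_plus \<epsilon> \<alpha> h f d 5 3 = f 2 3 * d 0 + \<epsilon> 1 / 2 * (- \<alpha> 2 + \<alpha> 3 + \<alpha> 1 - h) * d 1 + \<epsilon> 1 * f 1 2 * f 3 1"
    "ric_plus \<epsilon> \<alpha> h f d 6 2 = - f 2 3 * d 0 - \<epsilon> 1 / 2 * (\<alpha> 2 - \<alpha> 3 + \<alpha> 1 - h) * d 1 + \<epsilon> 1 * f 1 2 * f 3 1"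
    "ric_plus \<epsilon> \<alpha> h f d 6 1 = f 3 1 * d 0 + \<epsilon> 2 / 2 * (- \<alpha> 3 + \<alpha> 1 + \<alpha> 2 - h) * d 2 + \<epsilon> 2 * f 2 3 * f 1 2"
    "ric_plus \<epsilon> \<alpha> h f d 4 3 = - f 3 1 * d 0 - \<epsilon> 2 / 2 * (\<alpha> 3 - \<alpha> 1 + \<alpha> 2 - h) * d 2 + \<epsilon> 2 * f 2 3 * f 1 2"
    "ric_minus \<epsilon> \<alpha> h f d 2 4 = \<epsilon> 3 / 2 * (\<alpha> 2 - \<alpha> 1 - \<alpha> 3 - h) * d 6 + \<epsilon> 3 * f 3 1 * f 2 3"
    "ric_minus \<epsilon> \<alpha> h f d 1 5 = - \<epsilon> 3 / 2 * (\<alpha> 1 - \<alpha> 2 - \<alpha> 3 - h) * d 6 + \<epsilon> 3 * f 3 1 * f 2 3"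
    "ric_minus \<epsilon> \<alpha> h f d 3 5 = \<epsilon> 1 / 2 * (\<alpha> 3 - \<alpha> 2 - \<alpha> 1 - h) * d 4 + \<epsilon> 1 * f 1 2 * f 3 1"
    "ric_minus \<epsilon> \<alpha> h f d 2 6 = - \<epsilon> 1 / 2 * (\<alpha> 2 - \<alpha> 3 - \<alpha> 1 - h) * d 4 + \<epsilon> 1 * f 1 2 * f 3 1"
    "ric_minus \<epsilon> \<alpha> h f d 1 6 = \<epsilon> 2 / 2 * (\<alpha> 1 - \<alpha> 3 - \<alpha> 2 - h) * d 5 + \<epsilon> 2 * f 2 3 * f 1 2"
    "ric_minus \<epsilon> \<alpha> h f d 3 4 = - \<epsilon> 2 / 2 * (\<alpha> 3 - \<alpha> 1 - \<alpha> 2 - h) * d 5 + \<epsilon> 2 * f 2 3 * f 1 2"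
  by (simp add: ricci_form_def frame_norm_def structure_constant_def frame_sign_def base_index_def
      levi_symbol_def f[simplified] ricci_diagonal_def; simp add: field_simps power2_eq_square)+

lemma einstein_conditions_imp_flat:
  assumes \<epsilon>: "\<epsilon> 1 \<in> {-1, 1}" "\<epsilon> 2 \<in> {-1, 1}" "\<epsilon> 3 \<in> {-1, 1::real}"
    and f: "f 1 1 = 0" "f 2 2 = 0" "f 3 3 = 0" "f 2 1 = - f 1 2" "f 3 2 = - f 2 3" "f 1 3 = - f 3 1"
    and c: "einstein_conditions \<epsilon> \<alpha> h f d"
  shows "\<forall>i\<in>{4, 5, 6}. \<forall>b\<in>{0, 1, 2, 3}. ric_plus \<epsilon> \<alpha> h f d i b = 0"
    and "\<forall>b\<in>{0, 1, 2, 3}. \<forall>i\<in>{4, 5, 6}. ric_minus \<epsilon> \<alpha> h f d b i = 0"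
proof -
  note vals = ricci_form_values[OF f, of \<epsilon> \<alpha> h d]
  have basic: "\<alpha> 3 = \<alpha> 1" "h = - \<alpha> 2" "f 1 2 = 0" "f 2 3 = 0" "d 1 = 0" "d 3 = 0" "d 4 = 0" "d 6 = 0"
    and pos: "\<epsilon> 2 * \<alpha> 2 * (\<alpha> 1 - \<alpha> 2) > 0"
    and cases: "(d 0 * d 2 \<noteq> 0 \<and>
       (d 2 / d 0)\<^sup>2 = \<epsilon> 2 * (\<alpha> 1 - \<alpha> 2) / \<alpha> 2 \<and> f 1 3 = \<epsilon> 2 * \<alpha> 2 * (d 2 / d 0)) \<or>
      (d 0 = 0 \<and> d 2 = 0 \<and> (f 1 3)\<^sup>2 = \<epsilon> 2 * \<alpha> 2 * (\<alpha> 1 - \<alpha> 2))"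
    using c unfolding einstein_conditions_def by auto
  have \<alpha>2: "\<alpha> 2 \<noteq> 0" using pos by auto
  have \<epsilon>2: "\<epsilon> 1 * \<epsilon> 1 = 1" "\<epsilon> 2 * \<epsilon> 2 = 1" "\<epsilon> 3 * \<epsilon> 3 = 1" using \<epsilon> by auto
  have sq: "(f 3 1)\<^sup>2 = \<epsilon> 2 * \<alpha> 2 * (\<alpha> 1 - \<alpha> 2)" and lin: "f 3 1 * d 0 + \<epsilon> 2 * \<alpha> 2 * d 2 = 0"
  proof -
    from cases show "(f 3 1)\<^sup>2 = \<epsilon> 2 * \<alpha> 2 * (\<alpha> 1 - \<alpha> 2)"
    proof
      assume *: "d 0 * d 2 \<noteq> 0 \<and> (d 2 / d 0)\<^sup>2 = \<epsilon> 2 * (\<alpha> 1 - \<alpha> 2) / \<alpha> 2 \<and> f 1 3 = \<epsilon> 2 * \<alpha> 2 * (d 2 / d 0)"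
      then have "f 3 1 = - (\<epsilon> 2 * \<alpha> 2 * (d 2 / d 0))" using f(6) by simp
      then have "(f 3 1)\<^sup>2 = (\<epsilon> 2 * \<epsilon> 2) * (\<alpha> 2)\<^sup>2 * (d 2 / d 0)\<^sup>2" by (simp add: power2_eq_square)
      also have "\<dots> = (\<alpha> 2)\<^sup>2 * (\<epsilon> 2 * (\<alpha> 1 - \<alpha> 2) / \<alpha> 2)" using * \<epsilon>2 by simp
      finally show ?thesis using \<alpha>2 by (simp add: power2_eq_square)
    qed (simp add: f(6)[simplified])
    from cases have "f 1 3 * d 0 = \<epsilon> 2 * \<alpha> 2 * d 2" by (auto simp: field_simps)
    then show "f 3 1 * d 0 + \<epsilon> 2 * \<alpha> 2 * d 2 = 0" unfolding f(6) by simp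
  qed
  have diag: "ricci_diagonal \<epsilon> \<alpha> h f 1 2 3 = 0" "ricci_diagonal \<epsilon> \<alpha> h f 2 3 1 = 0" "ricci_diagonal \<epsilon> \<alpha> h f 3 1 2 = 0"
  proof -
    show "ricci_diagonal \<epsilon> \<alpha> h f 2 3 1 = 0" using basic by (simp add: ricci_diagonal_def)
    have "\<epsilon> 2 / 2 * ((\<alpha> 1 - \<alpha> 2)\<^sup>2 + (\<alpha> 2)\<^sup>2 - (\<alpha> 1)\<^sup>2) + (f 3 1)\<^sup>2 = 0"
      unfolding sq by (simp add: power2_eq_square field_simps)
    then have *: "x * \<epsilon> 2 / 2 * ((\<alpha> 1 - \<alpha> 2)\<^sup>2 + (\<alpha> 2)\<^sup>2 - (\<alpha> 1)\<^sup>2) + x * (f 3 1)\<^sup>2 = 0" for x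
      by algebra
    show "ricci_diagonal \<epsilon> \<alpha> h f 1 2 3 = 0" "ricci_diagonal \<epsilon> \<alpha> h f 3 1 2 = 0"
      using *[of "\<epsilon> 3"] *[of "\<epsilon> 1"] basic
      by (simp_all add: ricci_diagonal_def mult_ac power2_commute)
  qed
  show "\<forall>i\<in>{4, 5, 6}. \<forall>b\<in>{0, 1, 2, 3}. ric_plus \<epsilon> \<alpha> h f d i b = 0"
    unfolding ball_simps vals diag using basic lin
    by (simp; simp add: field_simps)
  show "\<forall>b\<in>{0, 1, 2, 3}. \<forall>i\<in>{4, 5, 6}. ric_minus \<epsilon> \<alpha> h f d b i = 0"
    unfolding ball_simps vals diag using basic by simp
qed

text \<open>The Einstein equations in the form used for solving them: \<open>p = (F\<^sub>2\<^sub>3, F\<^sub>3\<^sub>1, F\<^sub>1\<^sub>2)\<close>, and \<open>d\<close> and \<open>m\<close>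
  are the divergences of \<open>v\<^sub>a + g(v\<^sub>a)\<close> and \<open>v\<^sub>a - g(v\<^sub>a)\<close>. Two components that differ by exchanging
  their indices are replaced by their sum and difference. In this form the system is invariant under
  cyclic permutations.\<close>

definition flat_equations ::
    "real \<Rightarrow> real \<Rightarrow> real \<Rightarrow> real \<Rightarrow> real \<Rightarrow> real \<Rightarrow> real \<Rightarrow> real \<Rightarrow> real \<Rightarrow> real \<Rightarrow> real \<Rightarrow> real \<Rightarrow> real \<Rightarrow> real \<Rightarrow>
     real \<Rightarrow> real \<Rightarrow> real \<Rightarrow> bool" where
  "flat_equations e1 e2 e3 a1 a2 a3 h p1 p2 p3 d0 d1 d2 d3 m1 m2 m3 \<longleftrightarrow>
     e1 * e1 = 1 \<and> e2 * e2 = 1 \<and> e3 * e3 = 1 \<and>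
     e2 * e3 * ((a2 - a3)\<^sup>2 + h\<^sup>2 - a1\<^sup>2) + 2 * (e2 * p3\<^sup>2 + e3 * p2\<^sup>2) = 0 \<and>
     e3 * e1 * ((a3 - a1)\<^sup>2 + h\<^sup>2 - a2\<^sup>2) + 2 * (e3 * p1\<^sup>2 + e1 * p3\<^sup>2) = 0 \<and>
     e1 * e2 * ((a1 - a2)\<^sup>2 + h\<^sup>2 - a3\<^sup>2) + 2 * (e1 * p2\<^sup>2 + e2 * p1\<^sup>2) = 0 \<and>
     (a2 - a3) * d1 = 2 * p2 * p3 \<and> (a3 - a1) * d2 = 2 * p3 * p1 \<and> (a1 - a2) * d3 = 2 * p1 * p2 \<and>
     (a2 - a3) * m1 = 2 * p2 * p3 \<and> (a3 - a1) * m2 = 2 * p3 * p1 \<and> (a1 - a2) * m3 = 2 * p1 * p2 \<and>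
     2 * p1 * d0 + e1 * (a1 - h) * d1 = 0 \<and> 2 * p2 * d0 + e2 * (a2 - h) * d2 = 0 \<and>
     2 * p3 * d0 + e3 * (a3 - h) * d3 = 0 \<and>
     (a1 + h) * m1 = 0 \<and> (a2 + h) * m2 = 0 \<and> (a3 + h) * m3 = 0 \<and>
     e2 * e3 * p1 * (a1 + h) = e2 * p3 * d2 - e3 * p2 * d3 \<and>
     e3 * e1 * p2 * (a2 + h) = e3 * p1 * d3 - e1 * p3 * d1 \<and>
     e1 * e2 * p3 * (a3 + h) = e1 * p2 * d1 - e2 * p1 * d2 \<and>
     e2 * e3 * p1 * (a1 + h) = e2 * p3 * m2 - e3 * p2 * m3 \<and>
     e3 * e1 * p2 * (a2 + h) = e3 * p1 * m3 - e1 * p3 * m1 \<and>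
     e1 * e2 * p3 * (a3 + h) = e1 * p2 * m1 - e2 * p1 * m2"

lemma flat_equations_rotate:
  "flat_equations e1 e2 e3 a1 a2 a3 h p1 p2 p3 d0 d1 d2 d3 m1 m2 m3 \<Longrightarrow>
   flat_equations e2 e3 e1 a2 a3 a1 h p2 p3 p1 d0 d2 d3 d1 m2 m3 m1"
  unfolding flat_equations_def by blast

lemma flat_imp_flat_equations:
  assumes \<epsilon>: "\<epsilon> 1 \<in> {-1, 1}" "\<epsilon> 2 \<in> {-1, 1}" "\<epsilon> 3 \<in> {-1, 1::real}"
    and f: "f 1 1 = 0" "f 2 2 = 0" "f 3 3 = 0" "f 2 1 = - f 1 2" "f 3 2 = - f 2 3" "f 1 3 = - f 3 1"
    and plus: "\<forall>i\<in>{4, 5, 6}. \<forall>b\<in>{0, 1, 2, 3}. ric_plus \<epsilon> \<alpha> h f d i b = 0"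
    and minus: "\<forall>b\<in>{0, 1, 2, 3}. \<forall>i\<in>{4, 5, 6}. ric_minus \<epsilon> \<alpha> h f d b i = 0"
  shows "flat_equations (\<epsilon> 1) (\<epsilon> 2) (\<epsilon> 3) (\<alpha> 1) (\<alpha> 2) (\<alpha> 3) h (f 2 3) (f 3 1) (f 1 2)
    (d 0) (d 1) (d 2) (d 3) (d 4) (d 5) (d 6)"
proof -
  note vals = ricci_form_values[OF f, of \<epsilon> \<alpha> h d]
  have sq: "\<epsilon> 1 * \<epsilon> 1 = 1" "\<epsilon> 2 * \<epsilon> 2 = 1" "\<epsilon> 3 * \<epsilon> 3 = 1" using \<epsilon> by auto
  have zero: "ric_plus \<epsilon> \<alpha> h f d i b = 0" "ric_minus \<epsilon> \<alpha> h f d b i = 0" if "i \<in> {4, 5, 6}" "b \<in> {0, 1, 2, 3}" for i b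
    using plus minus that by blast+
  have diag: "\<epsilon> 2 * \<epsilon> 3 * ((\<alpha> 2 - \<alpha> 3)\<^sup>2 + h\<^sup>2 - (\<alpha> 1)\<^sup>2) + 2 * (\<epsilon> 2 * (f 1 2)\<^sup>2 + \<epsilon> 3 * (f 3 1)\<^sup>2) = 0"
    "\<epsilon> 3 * \<epsilon> 1 * ((\<alpha> 3 - \<alpha> 1)\<^sup>2 + h\<^sup>2 - (\<alpha> 2)\<^sup>2) + 2 * (\<epsilon> 3 * (f 2 3)\<^sup>2 + \<epsilon> 1 * (f 1 2)\<^sup>2) = 0"
    "\<epsilon> 1 * \<epsilon> 2 * ((\<alpha> 1 - \<alpha> 2)\<^sup>2 + h\<^sup>2 - (\<alpha> 3)\<^sup>2) + 2 * (\<epsilon> 1 * (f 3 1)\<^sup>2 + \<epsilon> 2 * (f 2 3)\<^sup>2) = 0"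
    using zero[of 4 1] zero[of 5 2] zero[of 6 3] unfolding vals ricci_diagonal_def by simp_all
  have mixed: "\<epsilon> 2 * \<epsilon> 3 * f 2 3 * (\<alpha> 1 + h) = \<epsilon> 2 * f 1 2 * d 2 - \<epsilon> 3 * f 3 1 * d 3"
    "\<epsilon> 3 * \<epsilon> 1 * f 3 1 * (\<alpha> 2 + h) = \<epsilon> 3 * f 2 3 * d 3 - \<epsilon> 1 * f 1 2 * d 1"
    "\<epsilon> 1 * \<epsilon> 2 * f 1 2 * (\<alpha> 3 + h) = \<epsilon> 1 * f 3 1 * d 1 - \<epsilon> 2 * f 2 3 * d 2"
    "\<epsilon> 2 * \<epsilon> 3 * f 2 3 * (\<alpha> 1 + h) = \<epsilon> 2 * f 1 2 * d 5 - \<epsilon> 3 * f 3 1 * d 6"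
    "\<epsilon> 3 * \<epsilon> 1 * f 3 1 * (\<alpha> 2 + h) = \<epsilon> 3 * f 2 3 * d 6 - \<epsilon> 1 * f 1 2 * d 4"
    "\<epsilon> 1 * \<epsilon> 2 * f 1 2 * (\<alpha> 3 + h) = \<epsilon> 1 * f 3 1 * d 4 - \<epsilon> 2 * f 2 3 * d 5"
    using zero[of 4 0] zero[of 5 0] zero[of 6 0] unfolding vals by simp_all
  \<comment> \<open>Sum and difference of two components with exchanged indices.\<close>
  have pair: "(y - x) * k = 2 * p * q \<and> 2 * r * d0 + e * (z - h) * k = 0"
    if "r * d0 + e / 2 * (- y + x + z - h) * k + e * q * p = 0"
      "- r * d0 - e / 2 * (y - x + z - h) * k + e * q * p = 0" and "e * e = 1"
    for x y z k p q r e d0 :: real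
  proof
    have "e * ((x - y) * k + 2 * p * q) = 0"
      using that(1,2) by (simp add: field_simps)
    moreover have "e \<noteq> 0" using that(3) by auto
    ultimately have "(x - y) * k + 2 * p * q = 0" by (simp only: mult_eq_0_iff) simp
    then show "(y - x) * k = 2 * p * q" by (simp add: left_diff_distrib)
    show "2 * r * d0 + e * (z - h) * k = 0" using that(1,2) by (simp add: field_simps)
  qed
  have offp: "(\<alpha> 2 - \<alpha> 3) * d 1 = 2 * f 3 1 * f 1 2 \<and> 2 * f 2 3 * d 0 + \<epsilon> 1 * (\<alpha> 1 - h) * d 1 = 0"
    "(\<alpha> 3 - \<alpha> 1) * d 2 = 2 * f 1 2 * f 2 3 \<and> 2 * f 3 1 * d 0 + \<epsilon> 2 * (\<alpha> 2 - h) * d 2 = 0"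
    "(\<alpha> 1 - \<alpha> 2) * d 3 = 2 * f 2 3 * f 3 1 \<and> 2 * f 1 2 * d 0 + \<epsilon> 3 * (\<alpha> 3 - h) * d 3 = 0"
    using zero[of 5 3] zero[of 6 2] zero[of 6 1] zero[of 4 3] zero[of 4 2] zero[of 5 1]
    unfolding vals
    by (intro pair sq; simp)+
  \<comment> \<open>The same argument; \<open>d 0\<close> does not occur in these components, so it is replaced by \<open>0\<close>, as
    is its factor.\<close>
  have offm: "(\<alpha> 2 - \<alpha> 3) * d 4 = 2 * f 3 1 * f 1 2 \<and> 2 * 0 * 0 + \<epsilon> 1 * (- \<alpha> 1 - h) * d 4 = 0"
    "(\<alpha> 3 - \<alpha> 1) * d 5 = 2 * f 1 2 * f 2 3 \<and> 2 * 0 * 0 + \<epsilon> 2 * (- \<alpha> 2 - h) * d 5 = 0"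
    "(\<alpha> 1 - \<alpha> 2) * d 6 = 2 * f 2 3 * f 3 1 \<and> 2 * 0 * 0 + \<epsilon> 3 * (- \<alpha> 3 - h) * d 6 = 0"
    using zero[of 5 3] zero[of 6 2] zero[of 6 1] zero[of 4 3] zero[of 4 2] zero[of 5 1]
    unfolding vals
    by (intro pair sq; simp add: algebra_simps)+
  then have "(\<alpha> 1 + h) * d 4 = 0" "(\<alpha> 2 + h) * d 5 = 0" "(\<alpha> 3 + h) * d 6 = 0"
    using sq by auto
  with offp offm show ?thesis unfolding flat_equations_def using sq diag mixed by (intro conjI; blast)
qed

text \<open>Here \<open>m\<^sub>3\<close> and \<open>d\<^sub>3\<close> are nonzero, which forces \<open>\<alpha>\<^sub>3 = - h\<close> and \<open>\<alpha>\<^sub>3 = h\<close>, so both vanish. Eliminating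
  \<open>m\<^sub>3\<close> expresses \<open>p\<^sub>1\<^sup>2\<close> and \<open>p\<^sub>2\<^sup>2\<close> by \<open>\<alpha>\<^sub>1\<close> and \<open>\<alpha>\<^sub>2\<close>, and then the diagonal equations give
  \<open>2\<alpha>\<^sub>1 + \<alpha>\<^sub>2 = 0 = \<alpha>\<^sub>1 + 2\<alpha>\<^sub>2\<close>.\<close>

lemma flat_equations_no_two:
  assumes eqs: "flat_equations e1 e2 e3 a1 a2 a3 h p1 p2 p3 d0 d1 d2 d3 m1 m2 m3"
    and p: "p1 \<noteq> 0" "p2 \<noteq> 0" "p3 = 0"
  shows False
proof -
  note E = eqs[unfolded flat_equations_def]
  have m3: "(a1 - a2) * m3 = 2 * p1 * p2" and d3: "(a1 - a2) * d3 = 2 * p1 * p2" using E by auto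
  then have nz: "m3 \<noteq> 0" "d3 \<noteq> 0" "a1 \<noteq> a2" using p by auto
  have e: "e1 * e1 = 1" "e2 * e2 = 1" "e3 * e3 = 1" "e1 \<noteq> 0" "e2 \<noteq> 0" "e3 \<noteq> 0" using E by auto
  have "a3 + h = 0" using E nz by auto
  moreover have "a3 - h = 0" using E nz p e by auto
  ultimately have h: "h = 0" "a3 = 0" by auto
  have "a2 * m1 = 0" "a1 * m1 = 0" "a1 * m2 = 0" "a2 * m2 = 0" using E h p by auto
  then have m: "m1 = 0" "m2 = 0" using nz by auto
  have "e2 * e3 * p1 * (a1 + h) = e2 * p3 * m2 - e3 * p2 * m3"
    "e3 * e1 * p2 * (a2 + h) = e3 * p1 * m3 - e1 * p3 * m1" using E by blast+
  then have "e3 * (e2 * p1 * a1 + p2 * m3) = 0" "e3 * (e1 * p2 * a2 - p1 * m3) = 0"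
    unfolding h m p by (simp_all add: algebra_simps)
  then have "e2 * p1 * a1 = - p2 * m3" "e1 * p2 * a2 = p1 * m3"
    using e(6) by (simp_all only: mult_eq_0_iff) simp_all
  then have "e2 * p1 * a1 * (a1 - a2) = - p2 * (2 * p1 * p2)" "e1 * p2 * a2 * (a1 - a2) = p1 * (2 * p1 * p2)"
    using m3 by algebra+
  then have "p1 * (e2 * a1 * (a1 - a2) + 2 * p2\<^sup>2) = 0" "p2 * (e1 * a2 * (a1 - a2) - 2 * p1\<^sup>2) = 0"
    by algebra+
  then have 1: "e2 * a1 * (a1 - a2) = - 2 * p2\<^sup>2" and 2: "e1 * a2 * (a1 - a2) = 2 * p1\<^sup>2"
    using p by (simp_all only: mult_eq_0_iff) simp_all
  have "e3 * (e2 * (a2\<^sup>2 - a1\<^sup>2) + 2 * p2\<^sup>2) = 0" "e3 * (e1 * (a1\<^sup>2 - a2\<^sup>2) + 2 * p1\<^sup>2) = 0"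
    using E h p by (auto simp: algebra_simps)
  then have "e2 * (a2\<^sup>2 - a1\<^sup>2) + 2 * p2\<^sup>2 = 0" "e1 * (a1\<^sup>2 - a2\<^sup>2) + 2 * p1\<^sup>2 = 0" using e by auto
  then have "e2 * ((a1 - a2) * (2 * a1 + a2)) = 0" "e1 * ((a1 - a2) * (a1 + 2 * a2)) = 0"
    using 1 2 by algebra+
  then have "2 * a1 + a2 = 0" "a1 + 2 * a2 = 0" using e nz by auto
  then show False using nz by auto
qed

text \<open>With \<open>p\<^sub>1 = p\<^sub>3 = 0\<close> the mixed equations give \<open>h\<close> and the divergences, the second diagonal equation
  becomes \<open>(\<alpha>\<^sub>3 - \<alpha>\<^sub>1)\<^sup>2 = 0\<close>, and the first one gives \<open>p\<^sub>2\<^sup>2\<close>.\<close>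

lemma flat_equations_one:
  assumes eqs: "flat_equations e1 e2 e3 a1 a2 a3 h p1 p2 p3 d0 d1 d2 d3 m1 m2 m3"
    and p: "p1 = 0" "p2 \<noteq> 0" "p3 = 0"
  shows "a1 = a3" "h = - a2" "d1 = 0" "d3 = 0" "m1 = 0" "m3 = 0"
    "p2\<^sup>2 = e2 * a2 * (a1 - a2)" "p2 * d0 + e2 * a2 * d2 = 0"
proof -
  note E = eqs[unfolded flat_equations_def]
  have e: "e1 * e1 = 1" "e2 * e2 = 1" "e3 * e3 = 1" "e1 \<noteq> 0" "e2 \<noteq> 0" "e3 \<noteq> 0" using E by auto
  have "a2 + h = 0" using E p e by auto
  then show h: "h = - a2" by simp
  show "d1 = 0" "d3 = 0" "m1 = 0" "m3 = 0" using E p e by auto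
  have "e3 * e1 * ((a3 - a1)\<^sup>2) = 0" using E p h by auto
  then show a: "a1 = a3" using e by auto
  have "e2 * e3 * ((a2 - a3)\<^sup>2 + h\<^sup>2 - a1\<^sup>2) + 2 * (e2 * p3\<^sup>2 + e3 * p2\<^sup>2) = 0" using E by blast
  then have "e3 * (e2 * ((a2 - a1)\<^sup>2 + a2\<^sup>2 - a1\<^sup>2) + 2 * p2\<^sup>2) = 0"
    using p h a by (simp add: algebra_simps)
  then have "e2 * ((a2 - a1)\<^sup>2 + a2\<^sup>2 - a1\<^sup>2) + 2 * p2\<^sup>2 = 0" using e by auto
  then show "p2\<^sup>2 = e2 * a2 * (a1 - a2)" by (simp add: power2_eq_square algebra_simps)
  have "2 * p2 * d0 + e2 * (a2 - h) * d2 = 0" using E by blast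
  then show "p2 * d0 + e2 * a2 * d2 = 0" unfolding h by (simp add: algebra_simps)
qed

text \<open>If all three components were nonzero, all \<open>m\<^sub>a\<close> would be nonzero, and all \<open>\<alpha>\<^sub>a\<close> would be \<open>- h\<close>.\<close>

lemma flat_equations_single_component:
  assumes eqs: "flat_equations e1 e2 e3 a1 a2 a3 h p1 p2 p3 d0 d1 d2 d3 m1 m2 m3"
    and p: "p1 \<noteq> 0 \<or> p2 \<noteq> 0 \<or> p3 \<noteq> 0"
  shows "p1 = 0 \<and> p2 \<noteq> 0 \<and> p3 = 0 \<or> p2 = 0 \<and> p3 \<noteq> 0 \<and> p1 = 0 \<or> p3 = 0 \<and> p1 \<noteq> 0 \<and> p2 = 0"
proof -
  note r1 = flat_equations_rotate[OF eqs]
  note r2 = flat_equations_rotate[OF r1]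
  have "\<not> (p1 \<noteq> 0 \<and> p2 \<noteq> 0 \<and> p3 \<noteq> 0)"
  proof
    assume nz: "p1 \<noteq> 0 \<and> p2 \<noteq> 0 \<and> p3 \<noteq> 0"
    note E = eqs[unfolded flat_equations_def]
    have "(a2 - a3) * m1 = 2 * p2 * p3" "(a3 - a1) * m2 = 2 * p3 * p1" "(a1 - a2) * m3 = 2 * p1 * p2"
      using E by auto
    then have "m1 \<noteq> 0" "m2 \<noteq> 0" "m3 \<noteq> 0" "a1 \<noteq> a2" using nz by auto
    moreover have "(a1 + h) * m1 = 0" "(a2 + h) * m2 = 0" using E by auto
    ultimately show False by auto
  qed
  then show ?thesis
    using p flat_equations_no_two[OF eqs] flat_equations_no_two[OF r1] flat_equations_no_two[OF r2] by blast
qed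

text \<open>The two alternatives in \<^const>\<open>einstein_conditions\<close> are the cases \<open>d 0 \<noteq> 0\<close> and \<open>d 0 = 0\<close> of one linear
  and one quadratic equation.\<close>

lemma einstein_conditionsI:
  assumes \<epsilon>: "\<epsilon> 2 * \<epsilon> 2 = 1" and "\<alpha> 1 = \<alpha> 3" "h = - \<alpha> 2" "f 1 2 = 0" "f 2 3 = 0" "d 1 = 0" "d 3 = 0" "d 4 = 0" "d 6 = 0"
    and nz: "f 1 3 \<noteq> 0" and sq: "(f 1 3)\<^sup>2 = \<epsilon> 2 * \<alpha> 2 * (\<alpha> 1 - \<alpha> 2)"
    and lin: "f 1 3 * d 0 = \<epsilon> 2 * \<alpha> 2 * d 2"
  shows "einstein_conditions \<epsilon> \<alpha> h f d"
proof -
  have pos: "\<epsilon> 2 * \<alpha> 2 * (\<alpha> 1 - \<alpha> 2) > 0" using nz unfolding sq[symmetric] by simp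
  then have \<alpha>2: "\<alpha> 2 \<noteq> 0" and \<epsilon>0: "\<epsilon> 2 \<noteq> 0" by auto
  have "(d 0 * d 2 \<noteq> 0 \<and>
       (d 2 / d 0)\<^sup>2 = \<epsilon> 2 * (\<alpha> 1 - \<alpha> 2) / \<alpha> 2 \<and> f 1 3 = \<epsilon> 2 * \<alpha> 2 * (d 2 / d 0)) \<or>
      (d 0 = 0 \<and> d 2 = 0 \<and> (f 1 3)\<^sup>2 = \<epsilon> 2 * \<alpha> 2 * (\<alpha> 1 - \<alpha> 2))"
  proof (cases "d 0 = 0")
    case True
    then have "d 2 = 0" using lin \<alpha>2 \<epsilon>0 by simp
    then show ?thesis using True sq by simp
  next
    case False
    then have "d 2 \<noteq> 0" using lin nz by auto
    have eq: "f 1 3 = \<epsilon> 2 * \<alpha> 2 * (d 2 / d 0)" using lin False by (simp add: field_simps)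
    have "(\<epsilon> 2 * \<epsilon> 2) * (\<alpha> 2)\<^sup>2 * (d 2 / d 0)\<^sup>2 = \<epsilon> 2 * \<alpha> 2 * (\<alpha> 1 - \<alpha> 2)"
      using sq unfolding eq by (simp add: power2_eq_square mult_ac)
    then have "(\<alpha> 2)\<^sup>2 * (d 2 / d 0)\<^sup>2 = \<epsilon> 2 * \<alpha> 2 * (\<alpha> 1 - \<alpha> 2)" unfolding \<epsilon> by simp
    then have "\<alpha> 2 * (\<alpha> 2 * (d 2 / d 0)\<^sup>2) = \<alpha> 2 * (\<epsilon> 2 * (\<alpha> 1 - \<alpha> 2))"
      by (simp only: power2_eq_square mult_ac)
    then have "\<alpha> 2 * (d 2 / d 0)\<^sup>2 = \<epsilon> 2 * (\<alpha> 1 - \<alpha> 2)"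
      unfolding mult_left_cancel[OF \<alpha>2] .
    then have "(d 2 / d 0)\<^sup>2 = \<epsilon> 2 * (\<alpha> 1 - \<alpha> 2) / \<alpha> 2"
      unfolding nonzero_eq_divide_eq[OF \<alpha>2] by (rule trans[OF mult.commute])
    then show ?thesis using False \<open>d 2 \<noteq> 0\<close> eq by simp
  qed
  then show ?thesis unfolding einstein_conditions_def using assms pos by simp
qed

section \<open>Identification of the Lie algebras\<close>

context smooth_manifold
begin

lemma lie_bracket_cst:
  assumes "X \<in> VF" "Y \<in> VF"
  shows "lie_bracket (fscale (cst c) X) Y = fscale (cst c) (lie_bracket X Y)"
    "lie_bracket X (fscale (cst c) Y) = fscale (cst c) (lie_bracket X Y)"
  using lie_bracket_fscale_left[OF assms smooth_funs_cst] lie_bracket_fscale_right[OF assms smooth_funs_cst]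
    vector_field_cst[OF assms(1)] vector_field_cst[OF assms(2)]
  by (simp_all add: fscale_simps)

end

lemma pushforward_linear:
  "pushforward a (X + Y) = pushforward a X + pushforward a Y"
  "pushforward a (fscale (cst c) X) = fscale (cst c) (pushforward a X)"
  by (auto simp: pushforward_def fscale_def cst_def fun_eq_iff)

context left_invariant_frame
begin

lemma lie_algebra_vector_field: "X \<in> lie_algebra \<A> \<Longrightarrow> X \<in> VF"
  by (simp add: lie_algebra_def)

lemma lie_algebra_add: "X \<in> lie_algebra \<A> \<Longrightarrow> Y \<in> lie_algebra \<A> \<Longrightarrow> X + Y \<in> lie_algebra \<A>"
  and lie_algebra_scale: "X \<in> lie_algebra \<A> \<Longrightarrow> fscale (cst c) X \<in> lie_algebra \<A>"
  by (auto simp: lie_algebra_def pushforward_linear vector_fields_plus vector_fields_fscale smooth_funs_cst)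

text \<open>The isomorphism sends \<open>x v\<^sub>1 + y v\<^sub>2 + z v\<^sub>3\<close> to \<open>M x y z\<close>.\<close>

theorem isomorphic_to_matricesI:
  fixes M :: "real \<Rightarrow> real \<Rightarrow> real \<Rightarrow> real^3^3"
  assumes brackets: "lie_bracket (v 1) (v 2) = fscale (cst k3) (v 3)"
      "lie_bracket (v 3) (v 1) = fscale (cst k2) (v 2)"
      "lie_bracket (v 2) (v 3) = fscale (cst k1) (v 1)"
    and add: "\<And>x y z x' y' z'. M (x + x') (y + y') (z + z') = M x y z + M x' y' z'"
    and scale: "\<And>c x y z. M (c * x) (c * y) (c * z) = c *\<^sub>R M x y z"
    and inj: "\<And>x y z. M x y z = 0 \<Longrightarrow> x = 0 \<and> y = 0 \<and> z = 0"
    and L: "\<And>A. A \<in> L \<longleftrightarrow> (\<exists>x y z. A = M x y z)"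
    and commutator: "\<And>x y z x' y' z'. M x y z ** M x' y' z' - M x' y' z' ** M x y z =
      M (k1 * (y * z' - z * y')) (k2 * (z * x' - x * z')) (k3 * (x * y' - y * x'))"
  shows "isomorphic_to_matrices (lie_algebra \<A>) L"
proof -
  define T where "T = (\<lambda>(x, y, z). fscale (cst x) (v 1) + fscale (cst y) (v 2) + fscale (cst z) (v 3))"
  define N where "N = (\<lambda>(x, y, z). M x y z)"
  have va: "v a \<in> lie_algebra \<A>" if "a \<in> {1..3}" for a
    using basis that unfolding lie_algebra_basis_def by blast
  have v: "v 1 \<in> lie_algebra \<A>" "v 2 \<in> lie_algebra \<A>" "v 3 \<in> lie_algebra \<A>" by (rule va; simp)+
  note vf = v[THEN lie_algebra_vector_field]
  have T_add: "T (p + q) = T p + T q" for p q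
    by (cases p; cases q; simp add: T_def fscale_simps flip: cst_add)
  have T_scale: "T (c *\<^sub>R p) = fscale (cst c) (T p)" for c p
    by (cases p; simp add: T_def fscale_simps flip: cst_mult)
  have N_add: "N (p + q) = N p + N q" for p q
    by (cases p; cases q; simp add: N_def add)
  have N_scale: "N (c *\<^sub>R p) = c *\<^sub>R N p" for c p
    by (cases p; simp add: N_def scale)
  have T_mem: "T p \<in> lie_algebra \<A>" for p
    using v by (cases p; simp add: T_def lie_algebra_add lie_algebra_scale)
  have T0: "p = 0" if "T p = 0" for p
  proof -
    obtain x y z where p: "p = (x, y, z)" by (rule prod_cases3)
    define c :: "nat \<Rightarrow> real" where "c a = (if a = 1 then x else if a = 2 then y else z)" for a
    have "(\<Sum>a=1..3. fscale (cst (c a)) (v a)) = 0"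
      unfolding sum_1_to_3(1) using that by (simp add: p T_def c_def)
    then have "\<forall>a\<in>{1..3}. c a = 0" using basis unfolding lie_algebra_basis_def by blast
    then show ?thesis by (simp add: ball_1_to_3 c_def p zero_prod_def)
  qed
  have T_diff: "T (p - q) = T p - T q" and N_diff: "N (p - q) = N p - N q" for p q
    using T_add[of "p - q" q] N_add[of "p - q" q] by simp_all
  have T_bij: "bij_betw T UNIV (lie_algebra \<A>)"
    unfolding bij_betw_def
  proof
    show "inj T" using T0 T_diff by (metis eq_iff_diff_eq_0 injI)
    show "range T = lie_algebra \<A>"
    proof
      show "range T \<subseteq> lie_algebra \<A>" using T_mem by blast
      show "lie_algebra \<A> \<subseteq> range T"
      proof
        fix X assume "X \<in> lie_algebra \<A>"
        then obtain c where "X = (\<Sum>a=1..3. fscale (cst (c a)) (v a))"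
          using basis unfolding lie_algebra_basis_def by blast
        then have "X = T (c 1, c 2, c 3)" unfolding sum_1_to_3(1) by (simp add: T_def)
        then show "X \<in> range T" by blast
      qed
    qed
  qed
  have N_bij: "bij_betw N UNIV L"
    unfolding bij_betw_def
  proof
    have "p = 0" if "N p = 0" for p
      using that inj by (cases p) (auto simp: N_def zero_prod_def)
    then show "inj N" using N_diff by (metis eq_iff_diff_eq_0 injI)
    show "range N = L" using L by (force simp: N_def image_def)
  qed
  define br :: "real \<times> real \<times> real \<Rightarrow> real \<times> real \<times> real \<Rightarrow> real \<times> real \<times> real" where
    "br = (\<lambda>(x, y, z) (x', y', z'). (k1 * (y * z' - z * y'), k2 * (z * x' - x * z'), k3 * (x * y' - y * x')))"
  have N_br: "N p ** N q - N q ** N p = N (br p q)" for p q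
    by (cases p; cases q; simp add: N_def br_def commutator)
  have T_br: "lie_bracket (T p) (T q) = T (br p q)" for p q
  proof -
    obtain x y z where p: "p = (x, y, z)" by (rule prod_cases3)
    obtain x' y' z' where q: "q = (x', y', z')" by (rule prod_cases3)
    have self: "lie_bracket X X = 0" for X :: "'a vfield"
      by (simp add: lie_bracket_def fun_eq_iff)
    note opp = lie_bracket_commute[of "v 2" "v 1"] lie_bracket_commute[of "v 1" "v 3"]
      lie_bracket_commute[of "v 3" "v 2"]
    have mem: "fscale (cst c) (v 1) \<in> VF" "fscale (cst c) (v 2) \<in> VF" "fscale (cst c) (v 3) \<in> VF" for c
      using vf by (simp_all add: vector_fields_fscale smooth_funs_cst)
    have "lie_bracket (T p) (T q) =
       fscale (cst x) (fscale (cst x') 0 + fscale (cst y') (fscale (cst k3) (v 3)) - fscale (cst z') (fscale (cst k2) (v 2)))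
     + fscale (cst y) (- fscale (cst x') (fscale (cst k3) (v 3)) + fscale (cst z') (fscale (cst k1) (v 1)))
     + fscale (cst z) (fscale (cst x') (fscale (cst k2) (v 2)) - fscale (cst y') (fscale (cst k1) (v 1)))"
      unfolding p q T_def prod.case
      using vf mem by (simp only: lie_bracket_add_left lie_bracket_add_right vector_fields_plus
          lie_bracket_cst self opp brackets)
        (simp add: fscale_def fun_eq_iff algebra_simps)
    also have "\<dots> = T (br p q)"
      unfolding p q T_def br_def prod.case
      by (simp add: fscale_def fun_eq_iff cst_def algebra_simps)
    finally show ?thesis .
  qed
  define \<phi> where "\<phi> = N \<circ> inv_into UNIV T"
  have \<phi>T: "\<phi> (T p) = N p" for p
    using T_bij by (simp add: \<phi>_def bij_betw_def)
  have ex: "\<exists>p. X = T p" if "X \<in> lie_algebra \<A>" for X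
    using T_bij that unfolding bij_betw_def by blast
  have "bij_betw \<phi> (lie_algebra \<A>) L"
    unfolding \<phi>_def using bij_betw_inv_into[OF T_bij] N_bij by (rule bij_betw_trans)
  moreover have "\<phi> (X + Y) = \<phi> X + \<phi> Y" "\<phi> (lie_bracket X Y) = \<phi> X ** \<phi> Y - \<phi> Y ** \<phi> X"
    if XY: "X \<in> lie_algebra \<A>" "Y \<in> lie_algebra \<A>" for X Y
  proof -
    obtain p q where pq: "X = T p" "Y = T q" using ex[OF XY(1)] ex[OF XY(2)] by blast
    show "\<phi> (X + Y) = \<phi> X + \<phi> Y" unfolding pq T_add[symmetric] \<phi>T N_add ..
    show "\<phi> (lie_bracket X Y) = \<phi> X ** \<phi> Y - \<phi> Y ** \<phi> X" unfolding pq T_br \<phi>T N_br ..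
  qed
  moreover have "\<phi> (fscale (cst c) X) = c *\<^sub>R \<phi> X" if X: "X \<in> lie_algebra \<A>" for X c
  proof -
    obtain p where p: "X = T p" using ex[OF X] by blast
    show ?thesis unfolding p T_scale[symmetric] \<phi>T N_scale ..
  qed
  ultimately show ?thesis unfolding isomorphic_to_matrices_def by blast
qed

end

definition rows3 :: "real \<Rightarrow> real \<Rightarrow> real \<Rightarrow> real \<Rightarrow> real \<Rightarrow> real \<Rightarrow> real \<Rightarrow> real \<Rightarrow> real \<Rightarrow> real^3^3" where
  "rows3 a b c d e f g h i = vector [vector [a, b, c], vector [d, e, f], vector [g, h, i]]"

lemma rows3_eq_iff:
  "A = rows3 a b c d e f g h i \<longleftrightarrow>
    A$1$1 = a \<and> A$1$2 = b \<and> A$1$3 = c \<and> A$2$1 = d \<and> A$2$2 = e \<and> A$2$3 = f \<and> A$3$1 = g \<and> A$3$2 = h \<and> A$3$3 = i"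
  by (auto simp: rows3_def vec_eq_iff forall_3)

lemma rows3_nth:
  "rows3 a b c d e f g h i $ 1 $ 1 = a" "rows3 a b c d e f g h i $ 1 $ 2 = b" "rows3 a b c d e f g h i $ 1 $ 3 = c"
  "rows3 a b c d e f g h i $ 2 $ 1 = d" "rows3 a b c d e f g h i $ 2 $ 2 = e" "rows3 a b c d e f g h i $ 2 $ 3 = f"
  "rows3 a b c d e f g h i $ 3 $ 1 = g" "rows3 a b c d e f g h i $ 3 $ 2 = h" "rows3 a b c d e f g h i $ 3 $ 3 = i"
  by (simp_all add: rows3_def)

definition skew3 :: "real \<Rightarrow> real \<Rightarrow> real \<Rightarrow> real^3^3" where
  "skew3 a b c = rows3 0 (- c) b c 0 (- a) (- b) a 0"

definition skew21 :: "real \<Rightarrow> real \<Rightarrow> real \<Rightarrow> real^3^3" where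
  "skew21 a b c = rows3 0 (- c) b c 0 (- a) b (- a) 0"

text \<open>Identifying skew matrices with vectors, the commutator is the cross product; for \<open>skew21\<close> its last
  component changes sign.\<close>

lemma skew3_commutator:
  "skew3 a b c ** skew3 a' b' c' - skew3 a' b' c' ** skew3 a b c =
    skew3 (b * c' - c * b') (c * a' - a * c') (a * b' - b * a')"
  by (simp add: skew3_def rows3_eq_iff rows3_nth matrix_matrix_mult_def sum_3)

lemma skew21_commutator:
  "skew21 a b c ** skew21 a' b' c' - skew21 a' b' c' ** skew21 a b c =
    skew21 (b * c' - c * b') (c * a' - a * c') (- (a * b' - b * a'))"
  by (simp add: skew21_def rows3_eq_iff rows3_nth matrix_matrix_mult_def sum_3)

lemma so3_iff: "A \<in> so3 \<longleftrightarrow> (\<exists>a b c. A = skew3 a b c)"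
proof -
  have "A \<in> so3 \<longleftrightarrow> A = skew3 (A$3$2) (A$1$3) (A$2$1)"
    unfolding so3_def skew3_def rows3_eq_iff by (auto simp: vec_eq_iff forall_3 transpose_def)
  moreover have "A = skew3 a b c \<Longrightarrow> A = skew3 (A$3$2) (A$1$3) (A$2$1)" for a b c
    by (simp add: skew3_def rows3_nth)
  ultimately show ?thesis by blast
qed

text \<open>With \<open>J = diag(1, 1, -1)\<close> the condition says that \<open>J A\<close> is skew.\<close>

lemma so21_iff: "A \<in> so21 \<longleftrightarrow> (\<exists>a b c. A = skew21 a b c)"
proof -
  have "A \<in> so21 \<longleftrightarrow> A = skew21 (- (A$3$2)) (A$1$3) (A$2$1)"
    unfolding so21_def skew21_def rows3_eq_iff
    by (auto simp: vec_eq_iff forall_3 transpose_def Let_def matrix_matrix_mult_def sum_3)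
  moreover have "A = skew21 a b c \<Longrightarrow> A = skew21 (- (A$3$2)) (A$1$3) (A$2$1)" for a b c
    by (simp add: skew21_def rows3_nth)
  ultimately show ?thesis by blast
qed

text \<open>Up to the sign of \<open>s\<^sub>3\<close>, the solution is \<open>s\<^sub>1 = \<surd>(k\<^sub>2 k\<^sub>3)\<close> and cyclically.\<close>

lemma scaling_factors:
  fixes k1 k2 k3 :: real
  assumes "k1 * k2 > 0" "k1 * k3 > 0"
  obtains s1 s2 s3 where "s1 \<noteq> 0" "s2 \<noteq> 0" "s3 \<noteq> 0"
    "s2 * s3 = s1 * k1" "s3 * s1 = s2 * k2" "s1 * s2 = s3 * k3"
proof -
  have nz: "k1 \<noteq> 0" "k2 \<noteq> 0" "k3 \<noteq> 0" using assms by auto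
  have abs: "\<bar>k1\<bar> = sgn k1 * k1" "\<bar>k2\<bar> = sgn k1 * k2" "\<bar>k3\<bar> = sgn k1 * k3"
    using assms by (auto simp: sgn_if zero_less_mult_iff)
  have sgn: "sgn k1 * sgn k1 = 1" using nz by (simp add: sgn_if)
  define r1 r2 r3 where "r1 = sqrt \<bar>k1\<bar>" and "r2 = sqrt \<bar>k2\<bar>" and "r3 = sqrt \<bar>k3\<bar>"
  have r: "r1 * r1 = sgn k1 * k1" "r2 * r2 = sgn k1 * k2" "r3 * r3 = sgn k1 * k3"
    unfolding abs[symmetric] by (simp_all add: r1_def r2_def r3_def)
  show ?thesis
  proof
    show "r2 * r3 \<noteq> 0" "r1 * r3 \<noteq> 0" "sgn k1 * (r1 * r2) \<noteq> 0"
      using nz by (simp_all add: r1_def r2_def r3_def sgn_if)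
    show "(r1 * r3) * (sgn k1 * (r1 * r2)) = (r2 * r3) * k1"
      "(sgn k1 * (r1 * r2)) * (r2 * r3) = (r1 * r3) * k2"
      "(r2 * r3) * (r1 * r3) = (sgn k1 * (r1 * r2)) * k3"
      using r sgn by algebra+
  qed
qed

context left_invariant_frame
begin

text \<open>The centre is spanned by \<open>v\<^sub>2\<close>, which corresponds to the upper right corner.\<close>

lemma isomorphic_heis:
  assumes brackets: "lie_bracket (v 1) (v 2) = fscale (cst 0) (v 3)"
      "lie_bracket (v 3) (v 1) = fscale (cst k) (v 2)"
      "lie_bracket (v 2) (v 3) = fscale (cst 0) (v 1)"
    and k: "k \<noteq> 0"
  shows "isomorphic_to_matrices (lie_algebra \<A>) heis"
proof (rule isomorphic_to_matricesI[OF brackets, of "\<lambda>x y z. rows3 0 z (y / k) 0 0 x 0 0 0"])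
  show "A \<in> heis \<longleftrightarrow> (\<exists>x y z. A = rows3 0 z (y / k) 0 0 x 0 0 0)" for A
  proof
    assume "A \<in> heis"
    then have "A = rows3 0 (A$1$2) ((k * A$1$3) / k) 0 0 (A$2$3) 0 0 0"
      using k by (simp add: heis_def rows3_eq_iff)
    then show "\<exists>x y z. A = rows3 0 z (y / k) 0 0 x 0 0 0" by blast
  qed (auto simp: heis_def rows3_nth)
  show "x = 0 \<and> y = 0 \<and> z = 0" if "rows3 0 z (y / k) 0 0 x 0 0 0 = 0" for x y z
    using that k unfolding eq_commute[of _ 0] by (simp add: rows3_eq_iff)
qed (use k in \<open>auto simp: rows3_eq_iff rows3_nth matrix_matrix_mult_def sum_3 add_divide_distrib
  eq_commute[of "rows3 _ _ _ _ _ _ _ _ _"]\<close>)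

lemma isomorphic_so3:
  assumes brackets: "lie_bracket (v 1) (v 2) = fscale (cst k3) (v 3)"
      "lie_bracket (v 3) (v 1) = fscale (cst k2) (v 2)"
      "lie_bracket (v 2) (v 3) = fscale (cst k1) (v 1)"
    and k: "k1 * k2 > 0" "k1 * k3 > 0"
  shows "isomorphic_to_matrices (lie_algebra \<A>) so3"
proof -
  obtain s1 s2 s3 where nz: "s1 \<noteq> 0" "s2 \<noteq> 0" "s3 \<noteq> 0"
    and s: "s2 * s3 = s1 * k1" "s3 * s1 = s2 * k2" "s1 * s2 = s3 * k3"
    using scaling_factors[OF k] by metis
  show ?thesis
  proof (rule isomorphic_to_matricesI[OF brackets, of "\<lambda>x y z. skew3 (s1 * x) (s2 * y) (s3 * z)"])
    show "A \<in> so3 \<longleftrightarrow> (\<exists>x y z. A = skew3 (s1 * x) (s2 * y) (s3 * z))" for A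
      unfolding so3_iff using nz by (metis nonzero_mult_div_cancel_left times_divide_eq_right)
    show "skew3 (s1 * x) (s2 * y) (s3 * z) ** skew3 (s1 * x') (s2 * y') (s3 * z')
        - skew3 (s1 * x') (s2 * y') (s3 * z') ** skew3 (s1 * x) (s2 * y) (s3 * z)
        = skew3 (s1 * (k1 * (y * z' - z * y'))) (s2 * (k2 * (z * x' - x * z'))) (s3 * (k3 * (x * y' - y * x')))"
      for x y z x' y' z'
    proof -
      have "s2 * y * (s3 * z') - s3 * z * (s2 * y') = s1 * (k1 * (y * z' - z * y'))"
        "s3 * z * (s1 * x') - s1 * x * (s3 * z') = s2 * (k2 * (z * x' - x * z'))"
        "s1 * x * (s2 * y') - s2 * y * (s1 * x') = s3 * (k3 * (x * y' - y * x'))"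
        using s by algebra+
      then show ?thesis unfolding skew3_commutator by simp
    qed
    show "x = 0 \<and> y = 0 \<and> z = 0" if "skew3 (s1 * x) (s2 * y) (s3 * z) = 0" for x y z
      using that nz unfolding eq_commute[of _ 0] by (simp add: skew3_def rows3_eq_iff)
  qed (simp_all add: skew3_def rows3_eq_iff rows3_nth algebra_simps eq_commute[of "rows3 _ _ _ _ _ _ _ _ _"])
qed

lemma isomorphic_so21:
  assumes brackets: "lie_bracket (v 1) (v 2) = fscale (cst k3) (v 3)"
      "lie_bracket (v 3) (v 1) = fscale (cst k2) (v 2)"
      "lie_bracket (v 2) (v 3) = fscale (cst k1) (v 1)"
    and k: "k1 * k2 > 0" "k1 * k3 < 0"
  shows "isomorphic_to_matrices (lie_algebra \<A>) so21"
proof -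
  have "k1 * (- k3) > 0" using k(2) by simp
  then obtain s1 s2 s3 where nz: "s1 \<noteq> 0" "s2 \<noteq> 0" "s3 \<noteq> 0"
    and s: "s2 * s3 = s1 * k1" "s3 * s1 = s2 * k2" "s1 * s2 = s3 * (- k3)"
    using scaling_factors[OF k(1)] by metis
  show ?thesis
  proof (rule isomorphic_to_matricesI[OF brackets, of "\<lambda>x y z. skew21 (s1 * x) (s2 * y) (s3 * z)"])
    show "A \<in> so21 \<longleftrightarrow> (\<exists>x y z. A = skew21 (s1 * x) (s2 * y) (s3 * z))" for A
      unfolding so21_iff using nz by (metis nonzero_mult_div_cancel_left times_divide_eq_right)
    show "skew21 (s1 * x) (s2 * y) (s3 * z) ** skew21 (s1 * x') (s2 * y') (s3 * z')
        - skew21 (s1 * x') (s2 * y') (s3 * z') ** skew21 (s1 * x) (s2 * y) (s3 * z)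
        = skew21 (s1 * (k1 * (y * z' - z * y'))) (s2 * (k2 * (z * x' - x * z'))) (s3 * (k3 * (x * y' - y * x')))"
      for x y z x' y' z'
    proof -
      have "s2 * y * (s3 * z') - s3 * z * (s2 * y') = s1 * (k1 * (y * z' - z * y'))"
        "s3 * z * (s1 * x') - s1 * x * (s3 * z') = s2 * (k2 * (z * x' - x * z'))"
        "- (s1 * x * (s2 * y') - s2 * y * (s1 * x')) = s3 * (k3 * (x * y' - y * x'))"
        using s by algebra+
      then show ?thesis unfolding skew21_commutator by simp
    qed
    show "x = 0 \<and> y = 0 \<and> z = 0" if "skew21 (s1 * x) (s2 * y) (s3 * z) = 0" for x y z
      using that nz unfolding eq_commute[of _ 0] by (simp add: skew21_def rows3_eq_iff)
  qed (simp_all add: skew21_def rows3_eq_iff rows3_nth algebra_simps eq_commute[of "rows3 _ _ _ _ _ _ _ _ _"])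
qed

lemma permuted_frame:
  assumes \<sigma>: "\<sigma> permutes {1..3}" shows "left_invariant_frame \<A> (v \<circ> \<sigma>)"
proof
  have reindex: "(\<Sum>a=1..3. fscale (cst (c (\<sigma> a))) ((v \<circ> \<sigma>) a)) = (\<Sum>b=1..3. fscale (cst (c b)) (v b))" for c
    using sum.permute[OF \<sigma>, of "\<lambda>b. fscale (cst (c b)) (v b)"] by (simp add: comp_def)
  show "lie_algebra_basis \<A> (v \<circ> \<sigma>)"
    unfolding lie_algebra_basis_def
  proof (intro conjI ballI allI impI)
    show "(v \<circ> \<sigma>) a \<in> lie_algebra \<A>" if "a \<in> {1..3}" for a
    proof -
      have "\<sigma> a \<in> {1..3}" using permutes_in_image[OF \<sigma>] that by blast
      then show ?thesis using basis unfolding lie_algebra_basis_def by simp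
    qed
    show "\<exists>c. X = (\<Sum>a=1..3. fscale (cst (c a)) ((v \<circ> \<sigma>) a))" if X: "X \<in> lie_algebra \<A>" for X
    proof -
      obtain c where "X = (\<Sum>b=1..3. fscale (cst (c b)) (v b))"
        using basis X unfolding lie_algebra_basis_def by blast
      then show ?thesis using reindex[of c] by (intro exI[of _ "\<lambda>a. c (\<sigma> a)"]) simp
    qed
    show "c a = 0" if zero: "(\<Sum>a=1..3. fscale (cst (c a)) ((v \<circ> \<sigma>) a)) = 0" and a: "a \<in> {1..3}" for c a
    proof -
      have "(\<Sum>b=1..3. fscale (cst (c (inv \<sigma> b))) (v b)) = 0"
        using reindex[of "\<lambda>b. c (inv \<sigma> b)"] zero permutes_inverses(2)[OF \<sigma>] by simp
      moreover have "(\<Sum>b=1..3. fscale (cst (k b)) (v b)) = 0 \<Longrightarrow> \<forall>b\<in>{1..3}. k b = 0" for k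
        using basis unfolding lie_algebra_basis_def by blast
      ultimately have "\<forall>b\<in>{1..3}. c (inv \<sigma> b) = 0" by simp
      then show ?thesis
        using permutes_in_image[OF \<sigma>] a permutes_inverses(2)[OF \<sigma>] by metis
    qed
  qed
qed

end

definition rotate3 :: "nat \<Rightarrow> nat" where
  "rotate3 a = (if a = 1 then 2 else if a = 2 then 3 else if a = 3 then 1 else a)"

lemma rotate3_permutes: "rotate3 permutes {1..3}"
proof -
  have "Transposition.transpose 1 2 permutes {1..3::nat}" "Transposition.transpose 2 3 permutes {1..3::nat}"
    by (simp_all add: permutes_swap_id)
  then have "Transposition.transpose 1 2 \<circ> Transposition.transpose 2 3 permutes {1..3::nat}"
    by (rule permutes_compose[rotated])
  moreover have "Transposition.transpose 1 2 \<circ> Transposition.transpose 2 3 = rotate3"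
    by (auto simp: fun_eq_iff rotate3_def Transposition.transpose_def)
  ultimately show ?thesis by simp
qed

context left_invariant_frame
begin

text \<open>One of the three constants has the opposite sign of the other two, and a cyclic permutation makes
  it the third.\<close>

lemma isomorphic_so21_mixed_signs:
  assumes brackets: "lie_bracket (v 1) (v 2) = fscale (cst k3) (v 3)"
      "lie_bracket (v 3) (v 1) = fscale (cst k2) (v 2)"
      "lie_bracket (v 2) (v 3) = fscale (cst k1) (v 1)"
    and k: "k1 \<noteq> 0" "k2 \<noteq> 0" "k3 \<noteq> 0" "\<not> (k1 * k2 > 0 \<and> k1 * k3 > 0)"
  shows "isomorphic_to_matrices (lie_algebra \<A>) so21"
proof -
  note r1 = permuted_frame[OF rotate3_permutes]
  note r2 = permuted_frame[OF permutes_compose[OF rotate3_permutes rotate3_permutes]]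
  have "(k1 * k2 > 0 \<and> k1 * k3 < 0) \<or> (k2 * k3 > 0 \<and> k2 * k1 < 0) \<or> (k3 * k1 > 0 \<and> k3 * k2 < 0)"
    using k by (cases "k1 > 0"; cases "k2 > 0"; cases "k3 > 0")
      (simp_all add: zero_less_mult_iff mult_less_0_iff)
  then consider "k1 * k2 > 0" "k1 * k3 < 0" | "k2 * k3 > 0" "k2 * k1 < 0" | "k3 * k1 > 0" "k3 * k2 < 0"
    by blast
  then show ?thesis
  proof cases
    case 1
    then show ?thesis using isomorphic_so21[OF brackets] by blast
  next
    case 2
    show ?thesis
      by (rule left_invariant_frame.isomorphic_so21[OF r1, of k1 k3 k2])
        (use brackets 2 in \<open>simp_all add: rotate3_def\<close>)
  next
    case 3
    show ?thesis
      by (rule left_invariant_frame.isomorphic_so21[OF r2, of k2 k1 k3])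
        (use brackets 3 in \<open>simp_all add: rotate3_def\<close>)
  qed
qed

end

section \<open>Solutions of the Einstein equations\<close>

context orthonormal_setup
begin

lemma f_values: "f 1 1 = 0" "f 2 2 = 0" "f 3 3 = 0" "f 2 1 = - f 1 2" "f 3 2 = - f 2 3" "f 1 3 = - f 3 1"
  using f_skew[of 1 1] f_skew[of 2 2] f_skew[of 3 3] f_skew[of 1 2] f_skew[of 2 3] f_skew[of 3 1] by auto

lemma \<epsilon>_values: "\<epsilon> 1 \<in> {-1, 1}" "\<epsilon> 2 \<in> {-1, 1}" "\<epsilon> 3 \<in> {-1, 1}"
  using \<epsilon>_sign by auto

lemma brackets:
  "lie_bracket (v 1) (v 2) = fscale (cst (\<epsilon> 3 * \<alpha> 3)) (v 3)"
  "lie_bracket (v 3) (v 1) = fscale (cst (\<epsilon> 2 * \<alpha> 2)) (v 2)"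
  "lie_bracket (v 2) (v 3) = fscale (cst (\<epsilon> 1 * \<alpha> 1)) (v 1)"
  using constants unfolding relative_constants_def by auto

lemma einstein_conditions_imp_generalized_einstein:
  "einstein_conditions \<epsilon> \<alpha> h f d \<Longrightarrow> generalized_einstein \<A> g H F \<delta>"
  unfolding generalized_einstein_iff_ricci_forms_vanish
  using einstein_conditions_imp_flat[OF \<epsilon>_values f_values] by (intro conjI)

lemma generalized_einstein_imp_flat_equations:
  "generalized_einstein \<A> g H F \<delta> \<Longrightarrow>
    flat_equations (\<epsilon> 1) (\<epsilon> 2) (\<epsilon> 3) (\<alpha> 1) (\<alpha> 2) (\<alpha> 3) h (f 2 3) (f 3 1) (f 1 2)
      (d 0) (d 1) (d 2) (d 3) (d 4) (d 5) (d 6)"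
  unfolding generalized_einstein_iff_ricci_forms_vanish
  by (rule flat_imp_flat_equations[OF \<epsilon>_values f_values]) blast+

lemma generalized_einstein_single_component:
  assumes "generalized_einstein \<A> g H F \<delta>" and "f 2 3 = 0" "f 1 2 = 0" "f 3 1 \<noteq> 0"
  shows "einstein_conditions \<epsilon> \<alpha> h f d"
proof (rule einstein_conditionsI)
  note one = flat_equations_one[OF generalized_einstein_imp_flat_equations[OF assms(1)] assms(2,4,3)]
  show "\<epsilon> 2 * \<epsilon> 2 = 1" by (rule \<epsilon>_square) simp
  show "\<alpha> 1 = \<alpha> 3" "h = - \<alpha> 2" "d 1 = 0" "d 3 = 0" "d 4 = 0" "d 6 = 0" by (rule one)+
  show "f 1 2 = 0" "f 2 3 = 0" by (rule assms)+
  show "f 1 3 \<noteq> 0" "(f 1 3)\<^sup>2 = \<epsilon> 2 * \<alpha> 2 * (\<alpha> 1 - \<alpha> 2)"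
    unfolding f_values(6) using assms(4) one(7) by simp_all
  show "f 1 3 * d 0 = \<epsilon> 2 * \<alpha> 2 * d 2" unfolding f_values(6) using one(8) by simp
qed

lemma F_nonzero_component:
  assumes "F \<noteq> 0" shows "f 2 3 \<noteq> 0 \<or> f 3 1 \<noteq> 0 \<or> f 1 2 \<noteq> 0"
proof (rule ccontr)
  assume "\<not> ?thesis"
  then have zero: "\<forall>a\<in>{1..3}. \<forall>b\<in>{1..3}. f a b = 0"
    unfolding ball_1_to_3 using f_values by simp
  have base: "F (v a) = 0" if a: "a \<in> {1..3}" for a
  proof (rule one_form_eqI[OF two_form_one_form[OF F_form basis_vector_field[OF a]] one_forms_0])
    fix b :: nat assume b: "b \<in> {1..3}"
    show "F (v a) (v b) = 0 (v b)" using F_basis[OF a b] zero a b by (simp add: cst_0)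
  qed
  have "F X = 0" for X
  proof (cases "X \<in> VF")
    case True
    then show ?thesis
    proof (rule frame_induct[where T = "\<lambda>X. F X = 0"])
      show "F (v a) = 0" if "a \<in> {1..3}" for a by (rule base[OF that])
      show "F (X + Y) = 0" if "X \<in> VF" "Y \<in> VF" "F X = 0" "F Y = 0" for X Y
        using form_linear(1)[OF that(1,2,1) smooth_funs_0] that(3,4) by simp
      show "F (fscale k X) = 0" if "k \<in> R" "X \<in> VF" "F X = 0" for k X
        using form_linear(2)[OF that(2,2,2,1)] that(3) by (simp add: fscale_simps)
    qed
  next
    case False
    then show ?thesis using F_form unfolding two_forms_def bilinear_forms_def by blast
  qed
  then have "F = 0" by (auto simp: fun_eq_iff)
  then show False using assms by contradiction
qed

text \<open>The signs of the permuted basis are determined by the old ones, since they are values of the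
  metric.\<close>

lemma permuted_setup:
  assumes \<sigma>: "\<sigma> permutes {1..3}" and rel: "relative_constants g H F \<delta> (v \<circ> \<sigma>) \<epsilon>' \<alpha>' h' f' d'"
  shows "orthonormal_setup \<A> (v \<circ> \<sigma>) g F H \<delta> \<epsilon>' \<alpha>' d' h' f'"
proof -
  interpret p: left_invariant_frame \<A> "v \<circ> \<sigma>" by (rule permuted_frame[OF \<sigma>])
  have mem: "\<sigma> a \<in> {1..3}" if "a \<in> {1..3}" for a using permutes_in_image[OF \<sigma>] that by blast
  show ?thesis
  proof
    show "g ((v \<circ> \<sigma>) a) ((v \<circ> \<sigma>) b) = 0" if "a \<in> {1..3}" "b \<in> {1..3}" "a \<noteq> b" for a b
      using orthogonal[OF mem[OF that(1)] mem[OF that(2)]] permutes_inj[OF \<sigma>] that(3)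
      by (simp add: inj_eq)
    show "\<epsilon>' a \<in> {- 1, 1}" if a: "a \<in> {1..3}" for a
    proof -
      have "g (v (\<sigma> a)) (v (\<sigma> a)) = cst (\<epsilon>' a)" 
        using rel a unfolding relative_constants_def by simp
      then have "(cst (\<epsilon>' a) :: 'g scal) = cst (\<epsilon> (\<sigma> a))"
        using orthonormal[OF mem[OF a] mem[OF a]] by simp
      then have "\<epsilon>' a = \<epsilon> (\<sigma> a)" by (simp add: cst_def fun_eq_iff)
      then show ?thesis using \<epsilon>_sign[OF mem[OF a]] by simp
    qed
  qed (fact metric H_form F_form divergence rel)+
qed

text \<open>A cyclic permutation is even, so \<open>h\<close> and the \<open>\<alpha>\<^sub>a\<close> keep their signs.\<close>

lemma relative_constants_rotate:
  "relative_constants g H F \<delta> (v \<circ> rotate3) (\<epsilon> \<circ> rotate3) (\<alpha> \<circ> rotate3) h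
     (\<lambda>a b. f (rotate3 a) (rotate3 b))
     (\<lambda>A. if A = 0 then d 0 else if A \<le> 3 then d (rotate3 A) else d (rotate3 (A - 3) + 3))"
proof -
  have r: "rotate3 1 = 2" "rotate3 2 = 3" "rotate3 3 = 1" by (simp_all add: rotate3_def)
  have norm: "g (v a) (v a) = cst (\<epsilon> a)" if "a \<in> {1..3}" for a using orthonormal[OF that that] by simp
  have F: "F (v a) (v b) = cst (f a b)" if "a \<in> {1..3}" "b \<in> {1..3}" for a b by (rule F_basis[OF that])
  have "\<delta> (basis_E g v A) = cst (d A)" if "A \<in> {0..6}" for A
    using constants that unfolding relative_constants_def by blast
  then have \<delta>: "\<delta> (basis_E g v 0) = cst (d 0)" "\<delta> (basis_E g v 1) = cst (d 1)" "\<delta> (basis_E g v 2) = cst (d 2)"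
    "\<delta> (basis_E g v 3) = cst (d 3)" "\<delta> (basis_E g v 4) = cst (d 4)" "\<delta> (basis_E g v 5) = cst (d 5)"
    "\<delta> (basis_E g v 6) = cst (d 6)" by simp_all
  have E: "basis_E g (v \<circ> rotate3) 0 = basis_E g v 0" "basis_E g (v \<circ> rotate3) 1 = basis_E g v 2"
    "basis_E g (v \<circ> rotate3) 2 = basis_E g v 3" "basis_E g (v \<circ> rotate3) 3 = basis_E g v 1"
    "basis_E g (v \<circ> rotate3) 4 = basis_E g v 5" "basis_E g (v \<circ> rotate3) 5 = basis_E g v 6"
    "basis_E g (v \<circ> rotate3) 6 = basis_E g v 4"
    by (simp_all add: basis_E_def rotate3_def)
  have upto6: "{0..6} = {0, 1, 2, 3, 4, 5, 6::nat}" by auto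
  have "H (v 2) (v 3) (v 1) = cst h"
    using H_basis[of 2 3 1] by (simp add: levi_symbol_def)
  then show ?thesis
    unfolding relative_constants_def ball_1_to_3(1) upto6 ball_simps E comp_apply r
    using \<delta> brackets norm[of 1] norm[of 2] norm[of 3] F by (simp add: rotate3_def)
qed

text \<open>The three structure constants are \<open>\<epsilon>\<^sub>1\<alpha>\<^sub>1\<close>, \<open>\<epsilon>\<^sub>2\<alpha>\<^sub>2 \<noteq> 0\<close> and \<open>\<epsilon>\<^sub>3\<alpha>\<^sub>1\<close>. Up to isomorphism only their
  signs matter, and the hypotheses determine which of these vanish or agree.\<close>

lemma heis_so3_so21:
  assumes "einstein_conditions \<epsilon> \<alpha> h f d"
  shows "\<alpha> 1 = 0 \<Longrightarrow> isomorphic_to_matrices (lie_algebra \<A>) heis"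
    and "\<alpha> 1 \<noteq> 0 \<Longrightarrow> \<epsilon> 1 = \<epsilon> 3 \<Longrightarrow> sgn (\<epsilon> 2 * \<alpha> 2) = sgn (\<epsilon> 1 * \<alpha> 1) \<Longrightarrow>
      isomorphic_to_matrices (lie_algebra \<A>) so3"
    and "\<alpha> 1 \<noteq> 0 \<Longrightarrow> (\<epsilon> 1 = \<epsilon> 3 \<and> sgn (\<epsilon> 2 * \<alpha> 2) = - sgn (\<epsilon> 1 * \<alpha> 1)) \<or> \<epsilon> 3 = - \<epsilon> 1 \<Longrightarrow>
      isomorphic_to_matrices (lie_algebra \<A>) so21"
proof -
  have \<alpha>: "\<alpha> 1 = \<alpha> 3" and "\<epsilon> 2 * \<alpha> 2 * (\<alpha> 1 - \<alpha> 2) > 0"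
    using assms unfolding einstein_conditions_def by auto
  then have k2: "\<epsilon> 2 * \<alpha> 2 \<noteq> 0" by auto
  have \<epsilon>0: "\<epsilon> 1 \<noteq> 0" "\<epsilon> 3 \<noteq> 0" using \<epsilon>_values by auto
  show "isomorphic_to_matrices (lie_algebra \<A>) heis" if "\<alpha> 1 = 0"
    by (rule isomorphic_heis[OF _ _ _ k2]) (use brackets \<alpha> that in simp_all)
  show "isomorphic_to_matrices (lie_algebra \<A>) so3"
    if nz: "\<alpha> 1 \<noteq> 0" and eq: "\<epsilon> 1 = \<epsilon> 3" and sg: "sgn (\<epsilon> 2 * \<alpha> 2) = sgn (\<epsilon> 1 * \<alpha> 1)"
  proof (rule isomorphic_so3[OF brackets])
    have k1: "\<epsilon> 1 * \<alpha> 1 \<noteq> 0" using nz \<epsilon>0 by simp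
    then have pos: "sgn (\<epsilon> 1 * \<alpha> 1) * sgn (\<epsilon> 1 * \<alpha> 1) = 1" by (simp add: sgn_if)
    have "sgn ((\<epsilon> 1 * \<alpha> 1) * (\<epsilon> 2 * \<alpha> 2)) = 1" using pos sg sgn_mult by metis
    then show "\<epsilon> 1 * \<alpha> 1 * (\<epsilon> 2 * \<alpha> 2) > 0" by (simp only: sgn_1_pos)
    show "\<epsilon> 1 * \<alpha> 1 * (\<epsilon> 3 * \<alpha> 3) > 0"
      using k1 unfolding eq[symmetric] \<alpha>[symmetric] by (metis not_real_square_gt_zero)
  qed
  show "isomorphic_to_matrices (lie_algebra \<A>) so21"
    if nz: "\<alpha> 1 \<noteq> 0" and c: "(\<epsilon> 1 = \<epsilon> 3 \<and> sgn (\<epsilon> 2 * \<alpha> 2) = - sgn (\<epsilon> 1 * \<alpha> 1)) \<or> \<epsilon> 3 = - \<epsilon> 1"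
  proof (rule isomorphic_so21_mixed_signs[OF brackets _ k2])
    show k1: "\<epsilon> 1 * \<alpha> 1 \<noteq> 0" and "\<epsilon> 3 * \<alpha> 3 \<noteq> 0" using nz \<epsilon>0 \<alpha> by simp_all
    show "\<not> (0 < \<epsilon> 1 * \<alpha> 1 * (\<epsilon> 2 * \<alpha> 2) \<and> 0 < \<epsilon> 1 * \<alpha> 1 * (\<epsilon> 3 * \<alpha> 3))"
    proof
      assume pos: "0 < \<epsilon> 1 * \<alpha> 1 * (\<epsilon> 2 * \<alpha> 2) \<and> 0 < \<epsilon> 1 * \<alpha> 1 * (\<epsilon> 3 * \<alpha> 3)"
      from c show False
      proof
        assume "\<epsilon> 1 = \<epsilon> 3 \<and> sgn (\<epsilon> 2 * \<alpha> 2) = - sgn (\<epsilon> 1 * \<alpha> 1)"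
        then have "sgn (\<epsilon> 1 * \<alpha> 1) * sgn (\<epsilon> 2 * \<alpha> 2) = - (sgn (\<epsilon> 1 * \<alpha> 1) * sgn (\<epsilon> 1 * \<alpha> 1))" by simp
        also have "\<dots> = - 1" using k1 by (simp add: sgn_if)
        finally have "sgn (\<epsilon> 1 * \<alpha> 1 * (\<epsilon> 2 * \<alpha> 2)) = - 1" by (simp only: sgn_mult)
        then show False unfolding sgn_1_neg using pos by linarith
      next
        assume "\<epsilon> 3 = - \<epsilon> 1"
        then have "\<epsilon> 1 * \<alpha> 1 * (\<epsilon> 3 * \<alpha> 3) = - ((\<epsilon> 1 * \<alpha> 1) * (\<epsilon> 1 * \<alpha> 1))" using \<alpha> by simp
        then show False using pos zero_le_square[of "\<epsilon> 1 * \<alpha> 1"] by linarith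
      qed
    qed
  qed
qed

text \<open>Being generalized Einstein does not refer to the basis. So the analysis of the case \<open>F\<^sub>3\<^sub>1 \<noteq> 0\<close> can
  be applied to the basis itself or to one of its two cyclic permutations.\<close>

lemma generalized_einstein_imp_einstein_conditions:
  assumes ge: "generalized_einstein \<A> g H F \<delta>" and F: "F \<noteq> 0"
  shows "\<exists>\<sigma> \<epsilon>' \<alpha>' h' f' d'. \<sigma> permutes {1..3} \<and>
    relative_constants g H F \<delta> (v \<circ> \<sigma>) \<epsilon>' \<alpha>' h' f' d' \<and> einstein_conditions \<epsilon>' \<alpha>' h' f' d'"
proof -
  note rot = rotate3_permutes
  have r: "rotate3 1 = 2" "rotate3 2 = 3" "rotate3 3 = 1" by (simp_all add: rotate3_def)
  interpret r1: orthonormal_setup \<A> "v \<circ> rotate3" g F H \<delta> "\<epsilon> \<circ> rotate3" "\<alpha> \<circ> rotate3"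
    "\<lambda>A. if A = 0 then d 0 else if A \<le> 3 then d (rotate3 A) else d (rotate3 (A - 3) + 3)" h
    "\<lambda>a b. f (rotate3 a) (rotate3 b)"
    by (rule permuted_setup[OF rot relative_constants_rotate])
  note rel2 = r1.relative_constants_rotate
  note set2 = r1.permuted_setup[OF rot rel2]
  consider "f 2 3 = 0" "f 1 2 = 0" "f 3 1 \<noteq> 0" | "f 3 1 = 0" "f 2 3 = 0" "f 1 2 \<noteq> 0" | "f 1 2 = 0" "f 3 1 = 0" "f 2 3 \<noteq> 0"
    using flat_equations_single_component[OF generalized_einstein_imp_flat_equations[OF ge]]
      F_nonzero_component[OF F] by blast
  then show ?thesis
  proof cases
    case 1
    have "relative_constants g H F \<delta> (v \<circ> id) \<epsilon> \<alpha> h f d" using constants by simp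
    then show ?thesis
      using generalized_einstein_single_component[OF ge 1] permutes_id by blast
  next
    case 2
    then show ?thesis
      using r1.generalized_einstein_single_component[OF ge, unfolded r] r1.constants rot by blast
  next
    case 3
    have "v \<circ> rotate3 \<circ> rotate3 = v \<circ> (rotate3 \<circ> rotate3)" by (simp add: comp_assoc)
    note rel = rel2[unfolded this]
    show ?thesis
      by (rule exI[of _ "rotate3 \<circ> rotate3"], intro exI conjI, rule permutes_compose[OF rot rot], rule rel,
        rule orthonormal_setup.generalized_einstein_single_component[OF set2 ge])
        (use 3 in \<open>simp_all add: rotate3_def\<close>)
  qed
qed

end

theorem theorem28:
  fixes \<A> :: "('g::{topological_group_add,t2_space,second_countable_topology}, real^3) atlas"
    and g F :: "'g form2" and H :: "'g form3" and \<delta> :: "'g sect \<Rightarrow> 'g scal"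
    and v :: "nat \<Rightarrow> 'g vfield"
    and \<epsilon> \<alpha> d :: "nat \<Rightarrow> real" and h :: real and f :: "nat \<Rightarrow> nat \<Rightarrow> real"
  assumes "lie_group \<A>"
    and "pseudo_riemannian_metric \<A> g" and "left_invariant2 \<A> g"
    and "lie_algebra_basis \<A> v"
    and "\<And>a b. a \<in> {1..3} \<Longrightarrow> b \<in> {1..3} \<Longrightarrow> a \<noteq> b \<Longrightarrow> g (v a) (v b) = 0"
    and "\<And>a. a \<in> {1..3} \<Longrightarrow> \<epsilon> a \<in> {- 1, 1}"
    and "H \<in> three_forms \<A>" and "left_invariant3 \<A> H"
    and "F \<in> two_forms \<A>" and "left_invariant2 \<A> F" and "closed_two_form \<A> F" and "F \<noteq> 0"
    and "left_invariant_divergence \<A> \<delta>"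
    and "relative_constants g H F \<delta> v \<epsilon> \<alpha> h f d"
  shows
    "(generalized_einstein \<A> g H F \<delta> \<longleftrightarrow>
       (\<exists>\<sigma> \<epsilon>' \<alpha>' h' f' d'. \<sigma> permutes {1..3} \<and>
          relative_constants g H F \<delta> (v \<circ> \<sigma>) \<epsilon>' \<alpha>' h' f' d' \<and>
          einstein_conditions \<epsilon>' \<alpha>' h' f' d')) \<and>
     (\<forall>\<sigma> \<epsilon>' \<alpha>' h' f' d'. \<sigma> permutes {1..3} \<longrightarrow>
        relative_constants g H F \<delta> (v \<circ> \<sigma>) \<epsilon>' \<alpha>' h' f' d' \<longrightarrow>
        einstein_conditions \<epsilon>' \<alpha>' h' f' d' \<longrightarrow>
          (\<alpha>' 1 = 0 \<longrightarrow> isomorphic_to_matrices (lie_algebra \<A>) heis) \<and>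
          (\<alpha>' 1 \<noteq> 0 \<longrightarrow> \<epsilon>' 1 = \<epsilon>' 3 \<longrightarrow> sgn (\<epsilon>' 2 * \<alpha>' 2) = sgn (\<epsilon>' 1 * \<alpha>' 1) \<longrightarrow>
             isomorphic_to_matrices (lie_algebra \<A>) so3) \<and>
          (\<alpha>' 1 \<noteq> 0 \<longrightarrow>
             (\<epsilon>' 1 = \<epsilon>' 3 \<and> sgn (\<epsilon>' 2 * \<alpha>' 2) = - sgn (\<epsilon>' 1 * \<alpha>' 1)) \<or> \<epsilon>' 3 = - \<epsilon>' 1 \<longrightarrow>
             isomorphic_to_matrices (lie_algebra \<A>) so21))"
proof -
  have atlas: "smooth_atlas \<A>" using assms(1) unfolding lie_group_def by blast
  have "divergence_operator \<A> \<delta>" using assms(13) unfolding left_invariant_divergence_def by blast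
  then interpret orthonormal_setup \<A> v g F H \<delta> \<epsilon> \<alpha> d h f
    by unfold_locales (use assms atlas in blast)+
  have permuted: "orthonormal_setup \<A> (v \<circ> \<sigma>) g F H \<delta> \<epsilon>' \<alpha>' d' h' f'"
    if "\<sigma> permutes {1..3}" "relative_constants g H F \<delta> (v \<circ> \<sigma>) \<epsilon>' \<alpha>' h' f' d'" for \<sigma> \<epsilon>' \<alpha>' h' f' d'
    by (rule permuted_setup[OF that])
  show ?thesis
  proof (intro conjI)
    show "generalized_einstein \<A> g H F \<delta> \<longleftrightarrow>
       (\<exists>\<sigma> \<epsilon>' \<alpha>' h' f' d'. \<sigma> permutes {1..3} \<and>
          relative_constants g H F \<delta> (v \<circ> \<sigma>) \<epsilon>' \<alpha>' h' f' d' \<and>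
          einstein_conditions \<epsilon>' \<alpha>' h' f' d')"
    proof
      show "generalized_einstein \<A> g H F \<delta>" if "\<exists>\<sigma> \<epsilon>' \<alpha>' h' f' d'. \<sigma> permutes {1..3} \<and>
          relative_constants g H F \<delta> (v \<circ> \<sigma>) \<epsilon>' \<alpha>' h' f' d' \<and> einstein_conditions \<epsilon>' \<alpha>' h' f' d'"
        using that orthonormal_setup.einstein_conditions_imp_generalized_einstein[OF permuted] by blast
    qed (rule generalized_einstein_imp_einstein_conditions[OF _ assms(12)])
  next
    show "\<forall>\<sigma> \<epsilon>' \<alpha>' h' f' d'. \<sigma> permutes {1..3} \<longrightarrow>
        relative_constants g H F \<delta> (v \<circ> \<sigma>) \<epsilon>' \<alpha>' h' f' d' \<longrightarrow>
        einstein_conditions \<epsilon>' \<alpha>' h' f' d' \<longrightarrow>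
          (\<alpha>' 1 = 0 \<longrightarrow> isomorphic_to_matrices (lie_algebra \<A>) heis) \<and>
          (\<alpha>' 1 \<noteq> 0 \<longrightarrow> \<epsilon>' 1 = \<epsilon>' 3 \<longrightarrow> sgn (\<epsilon>' 2 * \<alpha>' 2) = sgn (\<epsilon>' 1 * \<alpha>' 1) \<longrightarrow>
             isomorphic_to_matrices (lie_algebra \<A>) so3) \<and>
          (\<alpha>' 1 \<noteq> 0 \<longrightarrow>
             (\<epsilon>' 1 = \<epsilon>' 3 \<and> sgn (\<epsilon>' 2 * \<alpha>' 2) = - sgn (\<epsilon>' 1 * \<alpha>' 1)) \<or> \<epsilon>' 3 = - \<epsilon>' 1 \<longrightarrow>
             isomorphic_to_matrices (lie_algebra \<A>) so21)"
      using orthonormal_setup.heis_so3_so21[OF permuted] by (intro allI impI conjI)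
  qed
qed

end
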